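(* Let $n\ge2$ and let $M\subset\mathbb R^n$ be an origin-symmetric star-shaped body such that $\|x\|_M^{-1}$ is a positive definite distribution. Then for any origin-symmetric star-shaped bodies $K,L\subset\mathbb R^n$ such that, for every $\xi\in S^{n-1}$, $$\int_{K\cap\xi^\perp}\|x\|_M\,dx\le\int_{L\cap\xi^\perp}\|x\|_M\,dx,$$ we have $$\mathrm{Vol}_n(K)\le\mathrm{Vol}_n(L).$$
   Context: $\xi^\perp$ is the hyperplane through the origin orthogonal to $\xi$, with $(n-1)$-dimensional Lebesgue measure. A star-shaped body is a compact set with non-empty interior that is star-shaped with respect to the origin. The Minkowski functional of $M$ is $\|x\|_M=\min\{a>0: x\in aM\}$. The Fourier transform of a tempered distribution $f$ is defined by $\langle\hat f,\phi\rangle=\langle f,\hat\phi\rangle$ for Schwartz functions $\phi$, with $\hat\phi(\xi)=\int\phi(x)e^{-i(x,\xi)}dx$. A distribution $f$ is positive definite iff $\langle\hat f,\phi\rangle\ge0$ for every nonnegative Schwartz function $\phi$. *)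

theory Defs
  imports "HOL-Analysis.Analysis"
begin

subsection \<open>Star-shaped bodies and the Minkowski functional\<close>

text \<open>Non-emptiness (of the interior) forces the origin to lie in the set. Neither continuity
  of the radial function nor an interior origin is required.\<close>

definition star_shaped_body :: "'a::euclidean_space set \<Rightarrow> bool" where
  "star_shaped_body K \<longleftrightarrow>
     compact K \<and> interior K \<noteq> {} \<and> (\<forall>x\<in>K. closed_segment 0 x \<subseteq> K)"

definition origin_symmetric :: "'a::real_vector set \<Rightarrow> bool" where
  "origin_symmetric K \<longleftrightarrow> (\<forall>x\<in>K. - x \<in> K)"

text \<open>The infimum equals the minimum whenever \<open>x \<noteq> 0\<close> and the set is non-empty (see the lemma
  below). At \<open>x = 0\<close> there is no minimum, and the infimum gives the usual value 0. For an empty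
  set of dilation factors the value is meaningless, so statements must exclude that case.\<close>

definition minkowski_functional :: "'a::real_vector set \<Rightarrow> 'a \<Rightarrow> real" where
  "minkowski_functional M x = Inf {a. 0 < a \<and> x \<in> (*\<^sub>R) a ` M}"

lemma minkowski_functional_is_min:
  fixes M :: "'a::euclidean_space set"
  assumes M: "compact M" and x: "x \<noteq> 0" and ex: "\<exists>a>0. x \<in> (*\<^sub>R) a ` M"
  shows "minkowski_functional M x \<in> {a. 0 < a \<and> x \<in> (*\<^sub>R) a ` M}"
    and "\<And>a. \<lbrakk>0 < a; x \<in> (*\<^sub>R) a ` M\<rbrakk> \<Longrightarrow> minkowski_functional M x \<le> a"
proof -
  define A where "A = {a. 0 < a \<and> x \<in> (*\<^sub>R) a ` M}"
  have A_iff: "a \<in> A \<longleftrightarrow> 0 < a \<and> inverse a *\<^sub>R x \<in> M" for a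
  proof (cases "0 < a")
    case True
    have "x \<in> (*\<^sub>R) a ` M \<longleftrightarrow> inverse a *\<^sub>R x \<in> M"
    proof
      assume "inverse a *\<^sub>R x \<in> M"
      then have "a *\<^sub>R (inverse a *\<^sub>R x) \<in> (*\<^sub>R) a ` M" by (rule imageI)
      then show "x \<in> (*\<^sub>R) a ` M" using True by simp
    next
      assume "x \<in> (*\<^sub>R) a ` M"
      then obtain y where "y \<in> M" "x = a *\<^sub>R y" by blast
      then show "inverse a *\<^sub>R x \<in> M" using True by simp
    qed
    then show ?thesis by (simp add: A_def)
  qed (simp add: A_def)
  obtain R where R: "R > 0" "\<And>y. y \<in> M \<Longrightarrow> norm y \<le> R"
    using compact_imp_bounded[OF M] by (auto simp: bounded_pos)
  have lower: "norm x / R \<le> a" if "a \<in> A" for a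
  proof -
    have a: "0 < a" and "norm (inverse a *\<^sub>R x) \<le> R" using that A_iff R(2) by blast+
    then have "norm x / a \<le> R" by (simp add: divide_inverse_commute)
    then show ?thesis using a R(1) by (simp add: pos_divide_le_eq mult.commute)
  qed
  have bdd: "bdd_below A" using lower by (rule bdd_belowI)
  have ne: "A \<noteq> {}" using ex by (auto simp: A_def)
  have pos: "norm x / R > 0" using x R by simp
  have "closed A"
    unfolding closed_sequential_limits
  proof (intro allI impI)
    fix s l assume sl: "(\<forall>n. s n \<in> A) \<and> s \<longlonglongrightarrow> l"
    have "norm x / R \<le> l" using sl lower by (metis LIMSEQ_le_const)
    then have l: "l > 0" using pos by simp
    then have lim: "(\<lambda>n. inverse (s n) *\<^sub>R x) \<longlonglongrightarrow> inverse l *\<^sub>R x"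
      using sl by (intro tendsto_scaleR tendsto_inverse tendsto_const) simp_all
    have mem: "inverse (s n) *\<^sub>R x \<in> M" for n using sl A_iff by blast
    have "inverse l *\<^sub>R x \<in> M"
      by (rule closed_sequentially[OF compact_imp_closed[OF M] mem lim])
    then show "l \<in> A" using l by (simp add: A_iff)
  qed
  then show "minkowski_functional M x \<in> {a. 0 < a \<and> x \<in> (*\<^sub>R) a ` M}"
    using closed_contains_Inf[OF ne bdd] unfolding minkowski_functional_def A_def by blast
  show "minkowski_functional M x \<le> a" if "0 < a" "x \<in> (*\<^sub>R) a ` M" for a
    using cInf_lower[OF _ bdd, of a] that unfolding minkowski_functional_def A_def by blast
qed


subsection \<open>Lebesgue measure on a linear subspace\<close>

definition orthonormal_basis_of :: "'a::euclidean_space set \<Rightarrow> 'a set \<Rightarrow> bool" where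
  "orthonormal_basis_of S B \<longleftrightarrow>
     B \<subseteq> S \<and> pairwise orthogonal B \<and> (\<forall>b\<in>B. norm b = 1) \<and> span B = S"

lemma orthonormal_basis_of_exists: "subspace S \<Longrightarrow> \<exists>B. orthonormal_basis_of S B"
  unfolding orthonormal_basis_of_def by (erule orthonormal_basis_subspace) blast

text \<open>Product Lebesgue measure in orthonormal coordinates of \<open>S\<close>, as a measure on the ambient
  space. By rotation invariance of Lebesgue measure it does not depend on the chosen
  orthonormal basis.\<close>

definition lborel_subspace :: "'a::euclidean_space set \<Rightarrow> 'a measure" where
  "lborel_subspace S =
     (let B = (SOME B. orthonormal_basis_of S B)
      in distr (\<Pi>\<^sub>M b\<in>B. lborel) borel (\<lambda>t. \<Sum>b\<in>B. t b *\<^sub>R b))"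


subsection \<open>Schwartz functions and tempered distributions\<close>

text \<open>\<open>partials vs f\<close> is the iterated partial derivative of \<open>f\<close> in the directions \<open>vs\<close> (the last
  one is applied first); it is meaningful if all the inner derivatives are differentiable.\<close>

fun partials :: "'a::euclidean_space list \<Rightarrow> ('a \<Rightarrow> complex) \<Rightarrow> 'a \<Rightarrow> complex" where
  "partials [] f = f"
| "partials (v # vs) f = (\<lambda>x. frechet_derivative (partials vs f) (at x) v)"

text \<open>Requiring every partial derivative to be differentiable amounts to smoothness.\<close>

definition schwartz :: "('a::euclidean_space \<Rightarrow> complex) \<Rightarrow> bool" where
  "schwartz \<phi> \<longleftrightarrow> (\<forall>vs. set vs \<subseteq> Basis \<longrightarrow>
     (\<forall>x. partials vs \<phi> differentiable (at x)) \<and>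
     (\<forall>k. bounded (range (\<lambda>x. (norm x ^ k) *\<^sub>R partials vs \<phi> x))))"

definition schwartz_seminorm ::
    "nat \<Rightarrow> 'a::euclidean_space list \<Rightarrow> ('a \<Rightarrow> complex) \<Rightarrow> real" where
  "schwartz_seminorm k vs \<phi> = (SUP x. norm x ^ k * norm (partials vs \<phi> x))"

text \<open>A distribution is a functional of which only the values on Schwartz functions matter:
  it is linear there, and continuous, i.e. bounded by finitely many seminorms.\<close>

definition tempered_distribution :: "(('a::euclidean_space \<Rightarrow> complex) \<Rightarrow> complex) \<Rightarrow> bool" where
  "tempered_distribution T \<longleftrightarrow>
     (\<forall>\<phi> \<psi>. schwartz \<phi> \<longrightarrow> schwartz \<psi> \<longrightarrow> T (\<lambda>x. \<phi> x + \<psi> x) = T \<phi> + T \<psi>) \<and>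
     (\<forall>c \<phi>. schwartz \<phi> \<longrightarrow> T (\<lambda>x. c * \<phi> x) = c * T \<phi>) \<and>
     (\<exists>N C. \<forall>\<phi>. schwartz \<phi> \<longrightarrow>
        norm (T \<phi>) \<le> C * (\<Sum>k\<le>N. \<Sum>vs | set vs \<subseteq> Basis \<and> length vs \<le> N.
                              schwartz_seminorm k vs \<phi>))"

definition distribution_of :: "('a::euclidean_space \<Rightarrow> real) \<Rightarrow> ('a \<Rightarrow> complex) \<Rightarrow> complex" where
  "distribution_of f \<phi> = (\<integral>x. of_real (f x) * \<phi> x \<partial>lborel)"

definition fourier :: "('a::euclidean_space \<Rightarrow> complex) \<Rightarrow> 'a \<Rightarrow> complex" where
  "fourier \<phi> \<xi> = (\<integral>x. \<phi> x * exp (- \<i> * of_real (x \<bullet> \<xi>)) \<partial>lborel)"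

definition fourier_distribution ::
    "(('a::euclidean_space \<Rightarrow> complex) \<Rightarrow> complex) \<Rightarrow> ('a \<Rightarrow> complex) \<Rightarrow> complex" where
  "fourier_distribution T \<phi> = T (fourier \<phi>)"

definition positive_definite_distribution ::
    "(('a::euclidean_space \<Rightarrow> complex) \<Rightarrow> complex) \<Rightarrow> bool" where
  "positive_definite_distribution T \<longleftrightarrow> tempered_distribution T \<and>
     (\<forall>\<phi>. schwartz \<phi> \<and> (\<forall>x. \<phi> x \<in> \<real>\<^sub>\<ge>\<^sub>0) \<longrightarrow> fourier_distribution T \<phi> \<in> \<real>\<^sub>\<ge>\<^sub>0)"

end

theory Submission
  imports Defs "HOL-Probability.Characteristic_Functions" "HOL-Probability.Sinc_Integral"
begin

text \<open>Let \<open>\<rho> = 1 / \<parallel>\<cdot>\<parallel>\<^sub>M\<close>, so that \<open>Vol K\<close> is the integral of \<open>\<rho>\<close> times the section density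
  \<open>\<parallel>\<cdot>\<parallel>\<^sub>M 1\<^sub>K\<close>. Testing positive definiteness on translated Gaussians only, one gets that the Fourier
  transform \<open>p\<close> of \<open>\<rho>(x) exp (-|x|\<^sup>2/2)\<close> is nonnegative everywhere. Pair \<open>p(\<xi>)\<close> with
  \<open>exp (-\<tau>\<^sup>2|\<xi>|\<^sup>2/2)\<close> times the slab average \<open>\<integral>F(y) exp (-(y \<bullet> \<xi>)\<^sup>2/2) dy\<close>, which is nonnegative for
  large \<open>\<xi>\<close> if the hyperplane integrals of \<open>F\<close> are positive. The small frequencies contribute a bounded
  amount, while homogeneity of \<open>\<rho>\<close> makes the whole pairing grow like \<open>log (1/\<tau>) \<integral>\<rho>F\<close> as \<open>\<tau>\<close>
  tends to 0; hence \<open>\<integral>\<rho>F \<ge> 0\<close>.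

  This is applied to continuous approximations of \<open>F = \<parallel>\<cdot>\<parallel>\<^sub>M (1\<^sub>L - 1\<^sub>K)\<close>. Since \<open>\<parallel>\<cdot>\<parallel>\<^sub>M\<close> is only lower
  semicontinuous and possibly unbounded (the sections may have infinite weight), it is approximated
  from below, and the indicators of the compact sets \<open>K\<close>, \<open>L\<close> from above.\<close>

subsection \<open>Gaussian integrals\<close>

text \<open>The usual route represents the Fourier transform of \<rho> by a measure and applies
  Parseval on the sphere; here Gaussian integrals and Fubini replace both. The logarithm is what
  remains of the spherical formula: \<rho> has degree -1, so its transform has degree 1 - n, while
  the slab average decays like 1 / |\<xi>| with a hyperplane integral as coefficient. Their product
  has degree -n at infinity, the borderline where an integral over R^n diverges logarithmically,
  with the spherical pairing as coefficient. The factor with \<tau> cuts this divergence off at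
  |\<xi>| of order 1 / \<tau>. The price is that slabs have positive thickness, so a weak inequality
  between sections does not fix the sign of their averages; it has to be made strict first, by a
  perturbation that is removed at the end.\<close>

lemma integrable_lborel_affine:
  fixes f :: "'a::euclidean_space \<Rightarrow> 'b::{banach, second_countable_topology}"
  assumes "integrable lborel f" "c \<noteq> 0"
  shows "integrable lborel (\<lambda>x. f (t + c *\<^sub>R x))"
proof -
  have [measurable]: "f \<in> borel_measurable borel"
    using assms(1) by auto
  have "integrable (density (distr lborel borel (\<lambda>x. t + c *\<^sub>R x)) (\<lambda>_. \<bar>c\<bar>^DIM('a))) f"
    using assms by (subst lborel_affine[symmetric]) auto
  then have "integrable lborel (\<lambda>x. \<bar>c\<bar>^DIM('a) *\<^sub>R f (t + c *\<^sub>R x))"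
    by (subst (asm) integrable_density) (auto simp: integrable_distr_eq)
  from integrable_scaleR_right[OF this, of "inverse (\<bar>c\<bar>^DIM('a))"] show ?thesis
    using assms(2) by simp
qed

lemma integral_lborel_affine:
  fixes f :: "'a::euclidean_space \<Rightarrow> 'b::{banach, second_countable_topology}"
  assumes [measurable]: "f \<in> borel_measurable borel" and "c \<noteq> 0"
  shows "(\<integral>x. f x \<partial>lborel) = \<bar>c\<bar>^DIM('a) *\<^sub>R (\<integral>x. f (t + c *\<^sub>R x) \<partial>lborel)"
  using \<open>c \<noteq> 0\<close>
  by (subst lborel_affine[of c t]) (auto simp: integral_density integral_distr)

lemma
  fixes f :: "'a::euclidean_space \<Rightarrow> real \<Rightarrow> complex"
  assumes f: "\<And>b. b \<in> Basis \<Longrightarrow> integrable lborel (f b)"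
  shows integrable_lborel_prod: "integrable lborel (\<lambda>x. \<Prod>b\<in>Basis. f b (x \<bullet> b))"
    and integral_lborel_prod:
      "(\<integral>x. (\<Prod>b\<in>Basis. f b (x \<bullet> b)) \<partial>lborel) = (\<Prod>b\<in>Basis. (\<integral>x. f b x \<partial>lborel))"
proof -
  interpret product_sigma_finite "\<lambda>_::'a. lborel :: real measure"
    by standard
  have [measurable]: "b \<in> Basis \<Longrightarrow> f b \<in> borel_measurable borel" for b
    using f by auto
  have *: "b \<in> Basis \<Longrightarrow> (\<Sum>b'\<in>Basis. t b' *\<^sub>R b') \<bullet> b = t b" for t :: "'a \<Rightarrow> real" and b
    by simp
  show "integrable lborel (\<lambda>x. \<Prod>b\<in>Basis. f b (x \<bullet> b))"
    by (subst lborel_eq, subst integrable_distr_eq)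
       (auto simp: * f intro!: product_integrable_prod cong: prod.cong)
  show "(\<integral>x. (\<Prod>b\<in>Basis. f b (x \<bullet> b)) \<partial>lborel) = (\<Prod>b\<in>Basis. (\<integral>x. f b x \<partial>lborel))"
    by (subst lborel_eq, subst integral_distr)
       (auto simp: * f product_integral_prod cong: prod.cong)
qed

lemma norm_sq_eq_sum_Basis: "(norm x)\<^sup>2 = (\<Sum>b\<in>Basis. (x \<bullet> b)\<^sup>2)"
  for x :: "'a::euclidean_space"
  by (subst power2_norm_eq_inner, subst euclidean_inner) (simp add: power2_eq_square)

text \<open>The characteristic function of the standard normal distribution, cleared of its
  normalising factor.\<close>

lemma
  fixes t :: real
  shows integrable_gaussian_iexp_real: "integrable lborel (\<lambda>x. of_real (exp (- x\<^sup>2 / 2)) * iexp (t * x))"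
    and integral_gaussian_iexp_real:
      "(\<integral>x. of_real (exp (- x\<^sup>2 / 2)) * iexp (t * x) \<partial>lborel) = of_real (sqrt (2 * pi) * exp (- t\<^sup>2 / 2))"
proof -
  have eq: "of_real (exp (- x\<^sup>2 / 2)) * iexp (t * x)
      = of_real (sqrt (2 * pi)) * (std_normal_density x *\<^sub>R iexp (t * x))" for x
    by (simp add: std_normal_density_def scaleR_conv_of_real)
  have "integrable lborel std_normal_density"
    by (simp add: integrable_normal_density)
  then have int: "integrable lborel (\<lambda>x. std_normal_density x *\<^sub>R iexp (t * x))"
    by (rule Bochner_Integration.integrable_bound) (auto simp: norm_mult)
  show "integrable lborel (\<lambda>x. of_real (exp (- x\<^sup>2 / 2)) * iexp (t * x))"
    unfolding eq by (intro integrable_mult_right int)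
  have "(\<integral>x. std_normal_density x *\<^sub>R iexp (t * x) \<partial>lborel) = char std_normal_distribution t"
    unfolding char_def by (subst integral_density) auto
  then show "(\<integral>x. of_real (exp (- x\<^sup>2 / 2)) * iexp (t * x) \<partial>lborel)
      = of_real (sqrt (2 * pi) * exp (- t\<^sup>2 / 2))"
    unfolding eq integral_mult_right_zero by (simp add: char_std_normal_distribution)
qed

lemma
  fixes z :: "'a::euclidean_space"
  shows integrable_gaussian_iexp: "integrable lborel (\<lambda>x. of_real (exp (- (norm x)\<^sup>2 / 2)) * iexp (z \<bullet> x))"
    and integral_gaussian_iexp:
      "(\<integral>x. of_real (exp (- (norm x)\<^sup>2 / 2)) * iexp (z \<bullet> x) \<partial>lborel)
        = of_real (sqrt (2 * pi) ^ DIM('a) * exp (- (norm z)\<^sup>2 / 2))"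
proof -
  have eq: "of_real (exp (- (norm x)\<^sup>2 / 2)) * iexp (z \<bullet> x) =
     (\<Prod>b\<in>Basis. of_real (exp (- (x \<bullet> b)\<^sup>2 / 2)) * iexp ((z \<bullet> b) * (x \<bullet> b)))" for x
  proof -
    have "of_real (exp (- (norm x)\<^sup>2 / 2)) * iexp (z \<bullet> x)
       = exp (of_real (\<Sum>b\<in>Basis. - (x \<bullet> b)\<^sup>2 / 2) + \<i> * of_real (\<Sum>b\<in>Basis. (z \<bullet> b) * (x \<bullet> b)))"
      by (simp only: norm_sq_eq_sum_Basis euclidean_inner[of z x] exp_add exp_of_real
            sum_negf[symmetric] sum_divide_distrib)
    also have "\<dots> = exp (\<Sum>b\<in>Basis. of_real (- (x \<bullet> b)\<^sup>2 / 2) + \<i> * of_real ((z \<bullet> b) * (x \<bullet> b)))"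
      by (simp only: sum.distrib sum_distrib_left of_real_sum)
    also have "\<dots> = (\<Prod>b\<in>Basis. of_real (exp (- (x \<bullet> b)\<^sup>2 / 2)) * iexp ((z \<bullet> b) * (x \<bullet> b)))"
      by (subst exp_sum) (simp_all only: exp_add exp_of_real finite_Basis)
    finally show ?thesis .
  qed
  show "integrable lborel (\<lambda>x. of_real (exp (- (norm x)\<^sup>2 / 2)) * iexp (z \<bullet> x))"
    unfolding eq by (intro integrable_lborel_prod integrable_gaussian_iexp_real)
  have "(\<integral>x. of_real (exp (- (norm x)\<^sup>2 / 2)) * iexp (z \<bullet> x) \<partial>lborel)
      = (\<Prod>b\<in>Basis. complex_of_real (sqrt (2 * pi) * exp (- (z \<bullet> b)\<^sup>2 / 2)))"
    unfolding eq by (subst integral_lborel_prod) (simp_all only: integrable_gaussian_iexp_real integral_gaussian_iexp_real)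
  also have "\<dots> = of_real (sqrt (2 * pi) ^ DIM('a) * exp (- (norm z)\<^sup>2 / 2))"
    by (simp only: of_real_prod[symmetric] prod.distrib prod_constant exp_sum[symmetric] finite_Basis)
       (simp add: norm_sq_eq_sum_Basis sum_negf sum_divide_distrib)
  finally show "(\<integral>x. of_real (exp (- (norm x)\<^sup>2 / 2)) * iexp (z \<bullet> x) \<partial>lborel)
        = of_real (sqrt (2 * pi) ^ DIM('a) * exp (- (norm z)\<^sup>2 / 2))" .
qed

lemma
  fixes z :: "'a::euclidean_space"
  assumes "\<tau> > 0"
  shows integrable_scaled_gaussian_iexp:
      "integrable lborel (\<lambda>x. of_real (exp (- \<tau>\<^sup>2 * (norm x)\<^sup>2 / 2)) * iexp (z \<bullet> x))"
    and integral_scaled_gaussian_iexp: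
      "(\<integral>x. of_real (exp (- \<tau>\<^sup>2 * (norm x)\<^sup>2 / 2)) * iexp (z \<bullet> x) \<partial>lborel)
        = of_real (sqrt (2 * pi) ^ DIM('a) * (exp (- (norm z)\<^sup>2 / (2 * \<tau>\<^sup>2)) / \<tau> ^ DIM('a)))"
proof -
  let ?g = "\<lambda>x. of_real (exp (- (norm x)\<^sup>2 / 2)) * iexp ((z /\<^sub>R \<tau>) \<bullet> x)"
  have [simp]: "(z /\<^sub>R \<tau>) \<bullet> (\<tau> *\<^sub>R x) = z \<bullet> x" for x
    using assms by simp
  have eq: "?g (0 + \<tau> *\<^sub>R x) = of_real (exp (- \<tau>\<^sup>2 * (norm x)\<^sup>2 / 2)) * iexp (z \<bullet> x)" for x
    using assms by (simp add: power_mult_distrib del: inner_scaleR_left inner_scaleR_right)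
  show "integrable lborel (\<lambda>x. of_real (exp (- \<tau>\<^sup>2 * (norm x)\<^sup>2 / 2)) * iexp (z \<bullet> x))"
    using integrable_lborel_affine[OF integrable_gaussian_iexp[of "z /\<^sub>R \<tau>"], of \<tau> 0] assms
    unfolding eq by simp
  have n: "(norm (z /\<^sub>R \<tau>))\<^sup>2 / 2 = (norm z)\<^sup>2 / (2 * \<tau>\<^sup>2)"
    using assms by (simp add: power_mult_distrib power_inverse) (simp add: field_simps)
  have "of_real (sqrt (2 * pi) ^ DIM('a) * exp (- ((norm z)\<^sup>2 / (2 * \<tau>\<^sup>2))))
     = \<tau>^DIM('a) *\<^sub>R (\<integral>x. of_real (exp (- \<tau>\<^sup>2 * (norm x)\<^sup>2 / 2)) * iexp (z \<bullet> x) \<partial>lborel)"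
  proof -
    have "(\<integral>x. ?g x \<partial>lborel) = \<bar>\<tau>\<bar>^DIM('a) *\<^sub>R (\<integral>x. ?g (0 + \<tau> *\<^sub>R x) \<partial>lborel)"
      using assms by (intro integral_lborel_affine) auto
    then show ?thesis
      using assms unfolding eq integral_gaussian_iexp
      unfolding minus_divide_left[symmetric] n by (simp only: abs_of_pos)
  qed
  then have "(\<integral>x. of_real (exp (- \<tau>\<^sup>2 * (norm x)\<^sup>2 / 2)) * iexp (z \<bullet> x) \<partial>lborel)
     = of_real (sqrt (2 * pi) ^ DIM('a) * exp (- ((norm z)\<^sup>2 / (2 * \<tau>\<^sup>2)))) /\<^sub>R \<tau>^DIM('a)"
    using assms by (simp add: divideR_right)
  then show "(\<integral>x. of_real (exp (- \<tau>\<^sup>2 * (norm x)\<^sup>2 / 2)) * iexp (z \<bullet> x) \<partial>lborel)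
        = of_real (sqrt (2 * pi) ^ DIM('a) * (exp (- (norm z)\<^sup>2 / (2 * \<tau>\<^sup>2)) / \<tau> ^ DIM('a)))"
    by (simp add: scaleR_conv_of_real field_simps)
qed

lemma
  assumes "\<tau> > 0"
  shows integrable_scaled_gaussian:
      "integrable lborel (\<lambda>x::'a::euclidean_space. exp (- \<tau>\<^sup>2 * (norm x)\<^sup>2 / 2))"
    and integral_scaled_gaussian:
      "(\<integral>x. exp (- \<tau>\<^sup>2 * (norm x)\<^sup>2 / 2) \<partial>(lborel :: 'a measure)) = (sqrt (2 * pi) / \<tau>) ^ DIM('a)"
proof -
  show "integrable lborel (\<lambda>x::'a. exp (- \<tau>\<^sup>2 * (norm x)\<^sup>2 / 2))"
    using integrable_norm[OF integrable_scaled_gaussian_iexp[OF assms, of "0::'a"]] by simp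
  have "complex_of_real (\<integral>x. exp (- \<tau>\<^sup>2 * (norm x)\<^sup>2 / 2) \<partial>(lborel :: 'a measure))
     = of_real ((sqrt (2 * pi) / \<tau>) ^ DIM('a))"
    using integral_scaled_gaussian_iexp[OF assms, of "0::'a"]
    by (simp add: power_divide flip: integral_complex_of_real)
  then show "(\<integral>x. exp (- \<tau>\<^sup>2 * (norm x)\<^sup>2 / 2) \<partial>(lborel :: 'a measure)) = (sqrt (2 * pi) / \<tau>) ^ DIM('a)"
    using of_real_eq_iff by blast
qed

text \<open>The weight is 1 on the hyperplane orthogonal to \<xi> and falls off at distance about 1
  / |\<xi>|, so |\<xi>| times this value approximates \<open>sqrt (2 * pi)\<close> times the
  hyperplane integral of F when \<xi> is large.\<close>

definition gaussian_slab :: "('a::euclidean_space \<Rightarrow> real) \<Rightarrow> 'a \<Rightarrow> real" where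
  "gaussian_slab F \<xi> = (\<integral>y. F y * exp (- (y \<bullet> \<xi>)\<^sup>2 / 2) \<partial>lborel)"

text \<open>\<open>1 / |x|\<close> is a constant times \<open>\<integral>exp (-s\<^sup>2|x|\<^sup>2/2) ds\<close>; this replaces polar coordinates.\<close>

lemma integrable_gaussian_div_norm:
  assumes "2 \<le> DIM('a)"
  shows "integrable lborel (\<lambda>x::'a::euclidean_space. exp (- (norm x)\<^sup>2 / 2) / norm x)"
proof (rule integrableI_nonneg)
  define C where "C = sqrt (2 * pi) ^ DIM('a) / sqrt (2 * pi)"
  let ?h = "\<lambda>(x::'a) s::real. exp (- (sqrt (1 + s\<^sup>2))\<^sup>2 * (norm x)\<^sup>2 / 2) / sqrt (2 * pi)"
  have sqrt_pos: "sqrt (1 + s\<^sup>2) > 0" for s :: real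
    by (simp add: add_pos_nonneg)
  \<comment> \<open>Only an inequality: at x = 0 the left side is 0 by the convention on division.
    For x \<noteq> 0 both sides agree, the factor \<open>sqrt (2 * pi)\<close> in \<open>?h\<close>
    being the one-dimensional Gaussian integral.\<close>
  have inner: "ennreal (exp (- (norm x)\<^sup>2 / 2) / norm x) \<le> (\<integral>\<^sup>+s. ennreal (?h x s) \<partial>lborel)" for x :: 'a
  proof (cases "x = 0")
    case False
    have h: "?h x s = exp (- (norm x)\<^sup>2 / 2) / sqrt (2 * pi) * exp (- (norm x)\<^sup>2 * (norm s)\<^sup>2 / 2)" for s
      by (simp add: exp_add[symmetric] field_simps)
    have int: "integrable lborel (?h x)"
      unfolding h using False by (intro integrable_mult_right integrable_scaled_gaussian) auto
    have "(\<integral>\<^sup>+s. ennreal (?h x s) \<partial>lborel) = ennreal (\<integral>s. ?h x s \<partial>lborel)"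
      using int by (intro nn_integral_eq_integral) auto
    also have "(\<integral>s. ?h x s \<partial>lborel) = exp (- (norm x)\<^sup>2 / 2) / norm x"
      unfolding h integral_mult_right_zero using False by (subst integral_scaled_gaussian) auto
    finally show ?thesis by simp
  qed simp
  have outer: "(\<integral>\<^sup>+x. ennreal (?h x s) \<partial>lborel) \<le> ennreal (C * inverse (1 + s\<^sup>2))" for s
  proof -
    have int: "integrable lborel (\<lambda>x. ?h x s)"
      using sqrt_pos by (intro integrable_divide integrable_scaled_gaussian) auto
    have "(\<integral>\<^sup>+x. ennreal (?h x s) \<partial>lborel) = ennreal (\<integral>x. ?h x s \<partial>lborel)"
      using int by (intro nn_integral_eq_integral) auto
    also have "(\<integral>x. ?h x s \<partial>lborel) = C * (1 / sqrt (1 + s\<^sup>2)) ^ DIM('a)"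
      unfolding integral_divide_zero using sqrt_pos[of s]
      by (subst integral_scaled_gaussian) (auto simp: C_def power_divide)
    \<comment> \<open>Dimension at least 2 enters here: the power of a number at most 1 is lowered
      to 2, which leaves the integrable kernel \<open>inverse (1 + s\<^sup>2)\<close>.\<close>
    also have "\<dots> \<le> C * (1 / sqrt (1 + s\<^sup>2)) ^ 2"
      using assms sqrt_pos[of s] by (intro mult_left_mono power_decreasing) (auto simp: C_def)
    also have "(1 / sqrt (1 + s\<^sup>2)) ^ 2 = inverse (1 + s\<^sup>2)"
      using sqrt_pos[of s] by (simp add: power_divide divide_inverse power_inverse)
    finally show ?thesis by (simp add: ennreal_leI)
  qed
  have "(\<integral>\<^sup>+x. ennreal (exp (- (norm x)\<^sup>2 / 2) / norm (x::'a)) \<partial>lborel)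
      \<le> (\<integral>\<^sup>+x. (\<integral>\<^sup>+s. ennreal (?h x s) \<partial>lborel) \<partial>lborel)"
    by (intro nn_integral_mono inner)
  also have "\<dots> = (\<integral>\<^sup>+s. (\<integral>\<^sup>+x. ennreal (?h x s) \<partial>lborel) \<partial>lborel)"
    by (rule lborel_pair.Fubini'[symmetric]) measurable
  also have "\<dots> \<le> (\<integral>\<^sup>+s. ennreal (C * inverse (1 + s\<^sup>2)) \<partial>lborel)"
    by (intro nn_integral_mono outer)
  also have "\<dots> < \<infinity>"
  proof -
    have "integrable lborel (\<lambda>s::real. C * inverse (1 + s\<^sup>2))"
      using integrable_inverse_1_plus_square
      by (intro integrable_mult_right) (simp add: set_integrable_def)
    moreover have "0 \<le> C * inverse (1 + s\<^sup>2)" for s :: real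
      by (auto simp: C_def)
    ultimately show ?thesis
      by (subst nn_integral_eq_integral) auto
  qed
  finally show "(\<integral>\<^sup>+x. ennreal (exp (- (norm x)\<^sup>2 / 2) / norm (x::'a)) \<partial>lborel) < \<infinity>" .
qed auto

text \<open>The product B |f x| |g y| majorises the integrand on the product space, so Fubini needs
  nothing else. Stated over a normed field, to serve complex exponentials as well as real bumps as
  kernels.\<close>

lemma
  fixes f :: "'a::euclidean_space \<Rightarrow> 'c::{real_normed_field, banach, second_countable_topology}"
    and g :: "'b::euclidean_space \<Rightarrow> 'c"
  assumes f: "integrable lborel f" and g: "integrable lborel g"
    and k[measurable]: "(\<lambda>(x, y). k x y) \<in> borel_measurable (lborel \<Otimes>\<^sub>M lborel)"
    and bound: "\<And>x y. norm (k x y) \<le> (B :: real)"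
  shows integral_swap_bounded_kernel:
      "(\<integral>x. f x * (\<integral>y. g y * k x y \<partial>lborel) \<partial>lborel) = (\<integral>y. g y * (\<integral>x. f x * k x y \<partial>lborel) \<partial>lborel)"
    and integrable_bounded_kernel:
      "integrable lborel (\<lambda>x. f x * (\<integral>y. g y * k x y \<partial>lborel))"
proof -
  have [measurable]: "f \<in> borel_measurable borel" "g \<in> borel_measurable borel"
    using f g by auto
  have [measurable]: "(\<lambda>y. k x y) \<in> borel_measurable borel" for x
    using measurable_Pair2[OF k, of x] by simp
  have [measurable]: "(\<lambda>x. k x y) \<in> borel_measurable borel" for y
    using measurable_Pair1[OF k, of y] by simp
  have B: "0 \<le> B"
    using order_trans[OF norm_ge_zero bound[of undefined undefined]] .
  let ?H = "\<lambda>x y. f x * (g y * k x y)"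
  have norm_H: "norm (?H x y) \<le> norm (f x) * (B * norm (g y))" for x y
    using mult_left_mono[OF bound[of x y], of "norm (g y)"]
    by (auto simp: norm_mult mult.commute intro!: mult_left_mono)
  have int_bound: "integrable lborel (\<lambda>y. norm (f x) * (B * norm (g y)))" for x
    using g by (intro integrable_mult_right integrable_norm)
  have int_y: "integrable lborel (\<lambda>y. ?H x y)" for x
    by (rule Bochner_Integration.integrable_bound[OF int_bound[of x]])
       (auto intro!: AE_I2 order_trans[OF norm_H abs_ge_self])
  have "integrable (lborel \<Otimes>\<^sub>M lborel) (\<lambda>(x, y). ?H x y)"
  proof (rule lborel_pair.Fubini_integrable)
    have "(\<integral>y. norm (?H x y) \<partial>lborel) \<le> norm (f x) * (B * (\<integral>y. norm (g y) \<partial>lborel))" for x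
      using integral_mono[OF integrable_norm[OF int_y[of x]] int_bound[of x] norm_H] by simp
    then show "integrable lborel (\<lambda>x. \<integral>y. norm (case (x, y) of (x, y) \<Rightarrow> ?H x y) \<partial>lborel)"
      using f B
      by (intro Bochner_Integration.integrable_bound[OF integrable_mult_left[OF integrable_norm[OF f], of "B * (\<integral>y. norm (g y) \<partial>lborel)"]])
         (auto intro!: AE_I2 simp: abs_mult)
  qed (auto simp: int_y intro!: AE_I2)
  note int = this
  have "(\<integral>x. (\<integral>y. ?H x y \<partial>lborel) \<partial>lborel) = (\<integral>y. (\<integral>x. ?H x y \<partial>lborel) \<partial>lborel)"
    using lborel_pair.Fubini_integral[OF int] by simp
  then show "(\<integral>x. f x * (\<integral>y. g y * k x y \<partial>lborel) \<partial>lborel)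
      = (\<integral>y. g y * (\<integral>x. f x * k x y \<partial>lborel) \<partial>lborel)"
    by (subst (asm) (2) mult.left_commute) simp
  show "integrable lborel (\<lambda>x. f x * (\<integral>y. g y * k x y \<partial>lborel))"
    using lborel_pair.integrable_fst[OF int] by simp
qed

subsection \<open>Homogeneous weights of degree -1\<close>

text \<open>Abstracts the inverse of the Minkowski functional: \<open>le\<close> reflects
  boundedness of the body, and \<open>scale\<close> with c = -1 encodes evenness. At the origin
  \<open>le\<close> and \<open>nonneg\<close> force the value 0, since division by 0 gives
  0.\<close>

locale homogeneous_weight =
  fixes \<rho> :: "'a::euclidean_space \<Rightarrow> real" and R :: real
  assumes DIM_ge_2: "2 \<le> DIM('a)"
    and measurable_weight[measurable]: "\<rho> \<in> borel_measurable borel"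
    and nonneg: "\<And>x. 0 \<le> \<rho> x"
    and le: "\<And>x. \<rho> x \<le> R / norm x"
    and scale: "\<And>c x. c \<noteq> 0 \<Longrightarrow> \<rho> (c *\<^sub>R x) = \<rho> x / \<bar>c\<bar>"
begin

lemma R_nonneg: "0 \<le> R"
proof -
  obtain b :: 'a where "b \<in> Basis" using nonempty_Basis by blast
  then show ?thesis using order_trans[OF nonneg le[of b]] by simp
qed

lemma integrable_weight_gaussian:
  assumes "\<tau> > 0"
  shows "integrable lborel (\<lambda>x. \<rho> x * exp (- \<tau>\<^sup>2 * (norm x)\<^sup>2 / 2))"
proof (rule Bochner_Integration.integrable_bound)
  show "integrable lborel (\<lambda>x::'a. R * \<tau> * (exp (- (norm (0 + \<tau> *\<^sub>R x))\<^sup>2 / 2) / norm (0 + \<tau> *\<^sub>R x)))"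
    using assms by (intro integrable_mult_right integrable_lborel_affine integrable_gaussian_div_norm DIM_ge_2) auto
  have "\<rho> x * exp (- \<tau>\<^sup>2 * (norm x)\<^sup>2 / 2) \<le> (R / norm x) * exp (- \<tau>\<^sup>2 * (norm x)\<^sup>2 / 2)" for x
    by (intro mult_right_mono le) auto
  then show "AE x in lborel. norm (\<rho> x * exp (- \<tau>\<^sup>2 * (norm x)\<^sup>2 / 2))
      \<le> norm (R * \<tau> * (exp (- (norm (0 + \<tau> *\<^sub>R x))\<^sup>2 / 2) / norm (0 + \<tau> *\<^sub>R x)))"
    using assms R_nonneg nonneg by (intro AE_I2) (simp add: power_mult_distrib abs_mult)
qed measurable

text \<open>The singularity at the origin has to be controlled uniformly in the centre v. In the
  unit ball the shifted Gaussian is at most 1, hence at most \<open>exp (1/2)\<close> times the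
  centred one; outside it \<rho> is at most R, and the integral of a shifted Gaussian does not
  depend on v.\<close>

lemma weight_gaussian_uniform_bound:
  obtains \<kappa> where "0 \<le> \<kappa>"
    "\<And>v. integrable lborel (\<lambda>x. \<rho> x * exp (- (norm (v - x))\<^sup>2 / 2))"
    "\<And>v. (\<integral>x. \<rho> x * exp (- (norm (v - x))\<^sup>2 / 2) \<partial>lborel) \<le> \<kappa>"
proof -
  define g where "g x = R * exp (1/2) * (exp (- (norm x)\<^sup>2 / 2) / norm x)" for x :: 'a
  define h where "h x = R * exp (- (norm x)\<^sup>2 / 2)" for x :: 'a
  have int_g: "integrable lborel g"
    unfolding g_def by (intro integrable_mult_right integrable_gaussian_div_norm DIM_ge_2)
  have int_h: "integrable lborel h"
    unfolding h_def using integrable_scaled_gaussian[of 1] by (intro integrable_mult_right) simp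
  have [measurable]: "h \<in> borel_measurable borel"
    using int_h by auto
  have int_h': "integrable lborel (\<lambda>x. h (v - x))" for v
    using integrable_lborel_affine[OF int_h, of "-1" v] by simp
  have bound: "\<rho> x * exp (- (norm (v - x))\<^sup>2 / 2) \<le> g x + h (v - x)" for v x
  proof (cases "norm x \<le> 1")
    case True
    have "R / norm x * exp (- (norm (v - x))\<^sup>2 / 2) \<le> R / norm x * exp (1/2 + - (norm x)\<^sup>2 / 2)"
    proof (intro mult_left_mono iffD2[OF exp_le_cancel_iff])
      have "(norm x)\<^sup>2 \<le> 1" using True by (simp add: power_le_one)
      then show "- (norm (v - x))\<^sup>2 / 2 \<le> 1/2 + - (norm x)\<^sup>2 / 2"
        using zero_le_power2[of "norm (v - x)"] by linarith
    qed (use R_nonneg in simp)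
    also have "\<dots> = g x"
      unfolding exp_add g_def by simp
    finally have "R / norm x * exp (- (norm (v - x))\<^sup>2 / 2) \<le> g x" .
    moreover have "0 \<le> h (v - x)" using R_nonneg by (simp add: h_def)
    moreover have "\<rho> x * exp (- (norm (v - x))\<^sup>2 / 2) \<le> R / norm x * exp (- (norm (v - x))\<^sup>2 / 2)"
      by (intro mult_right_mono le) auto
    ultimately show ?thesis by linarith
  next
    case False
    have "R / norm x \<le> R"
      using False R_nonneg divide_left_mono[of 1 "norm x" R] by (cases "x = 0") auto
    then have "\<rho> x * exp (- (norm (v - x))\<^sup>2 / 2) \<le> h (v - x)"
      unfolding h_def using le[of x] by (intro mult_right_mono) auto
    moreover have "0 \<le> g x" using R_nonneg by (simp add: g_def)
    ultimately show ?thesis by linarith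
  qed
  show thesis
  proof
    show int: "integrable lborel (\<lambda>x. \<rho> x * exp (- (norm (v - x))\<^sup>2 / 2))" for v
      by (rule Bochner_Integration.integrable_bound[OF Bochner_Integration.integrable_add[OF int_g int_h'[of v]]])
         (use order_trans[OF bound abs_ge_self] nonneg in \<open>auto intro!: AE_I2\<close>)
    show "(\<integral>x. \<rho> x * exp (- (norm (v - x))\<^sup>2 / 2) \<partial>lborel) \<le> integral\<^sup>L lborel g + integral\<^sup>L lborel h" for v
    proof -
      have "(\<integral>x. \<rho> x * exp (- (norm (v - x))\<^sup>2 / 2) \<partial>lborel) \<le> (\<integral>x. g x + h (v - x) \<partial>lborel)"
        by (intro integral_mono int Bochner_Integration.integrable_add int_g int_h' bound)
      also have "\<dots> = integral\<^sup>L lborel g + (\<integral>x. h (v - x) \<partial>lborel)"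
        by (intro Bochner_Integration.integral_add int_g int_h')
      also have "(\<integral>x. h (v - x) \<partial>lborel) = integral\<^sup>L lborel h"
        using integral_lborel_affine[of h "-1" v] by simp
      finally show ?thesis .
    qed
    show "0 \<le> integral\<^sup>L lborel g + integral\<^sup>L lborel h"
      using R_nonneg by (intro add_nonneg_nonneg Bochner_Integration.integral_nonneg) (auto simp: g_def h_def)
  qed
qed

end

locale weighted_test_function = homogeneous_weight \<rho> R
  for \<rho> :: "'a::euclidean_space \<Rightarrow> real" and R +
  fixes F :: "'a \<Rightarrow> real" and C :: real
  assumes cont: "continuous_on UNIV F"
    and F_bound: "\<And>x. \<bar>F x\<bar> \<le> C * exp (- (norm x)\<^sup>2 / 2)"
begin

lemma measurable_F[measurable]: "F \<in> borel_measurable borel"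
  using cont by (rule borel_measurable_continuous_onI)

lemma C_nonneg: "0 \<le> C"
  using order_trans[OF abs_ge_zero F_bound[of 0]] by simp

lemma integrable_F: "integrable lborel F"
proof (rule Bochner_Integration.integrable_bound)
  show "integrable lborel (\<lambda>x::'a. C * exp (- (1::real)\<^sup>2 * (norm x)\<^sup>2 / 2))"
    by (intro integrable_mult_right integrable_scaled_gaussian) simp
  show "AE x in lborel. norm (F x) \<le> norm (C * exp (- (1::real)\<^sup>2 * (norm x)\<^sup>2 / 2))"
    using order_trans[OF F_bound abs_ge_self] by simp
qed simp

abbreviation slab :: "'a \<Rightarrow> real" where
  "slab \<equiv> gaussian_slab F"

definition weight_ft :: "'a \<Rightarrow> complex" where
  "weight_ft \<xi> = (\<integral>x. of_real (\<rho> x * exp (- (norm x)\<^sup>2 / 2)) * iexp (- (\<xi> \<bullet> x)) \<partial>lborel)"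

text \<open>Writing \<open>exp (-(y \<bullet> \<xi>)\<^sup>2/2)\<close> as a Gaussian average of \<open>exp (\<i> s y \<bullet> \<xi>)\<close> over \<open>s\<close> turns the pairing of
  \<open>weight_ft\<close> with \<open>slab\<close> into the same average of \<open>line_kernel \<tau> s\<close>.\<close>

definition line_kernel :: "real \<Rightarrow> real \<Rightarrow> real" where
  "line_kernel \<tau> s = (\<integral>x. \<rho> x * exp (- (norm x)\<^sup>2 / 2) *
     (\<integral>y. F y * (exp (- (norm (s *\<^sub>R y - x))\<^sup>2 / (2 * \<tau>\<^sup>2)) / \<tau> ^ DIM('a)) \<partial>lborel) \<partial>lborel)"

text \<open>Convolution of F with a Gaussian of width \<sigma>, left unnormalised: for \<sigma> = 0
  it is \<open>sqrt (2 * pi) ^ DIM('a)\<close> times F.\<close>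

definition smoothing :: "real \<Rightarrow> 'a \<Rightarrow> real" where
  "smoothing \<sigma> x = (\<integral>z. F (x + \<sigma> *\<^sub>R z) * exp (- (norm z)\<^sup>2 / 2) \<partial>lborel)"

text \<open>What remains of \<open>line_kernel\<close> once x is rescaled by s and y is recentred at
  x. The parameters stay independent, because the width \<tau> / |s| that will be inserted for
  \<sigma> is not a function of s alone.\<close>

definition pairing :: "real \<Rightarrow> real \<Rightarrow> real" where
  "pairing s \<sigma> = (\<integral>x. \<rho> x * exp (- s\<^sup>2 * (norm x)\<^sup>2 / 2) * smoothing \<sigma> x \<partial>lborel)"

section \<open>Fubini: from the frequency integral to an integral over s\<close>

lemma integrable_weight: "integrable lborel (\<lambda>x. \<rho> x * exp (- (norm x)\<^sup>2 / 2))"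
  using integrable_weight_gaussian[of 1] by simp

lemma slab_eq: "complex_of_real (slab \<xi>) = (\<integral>y. of_real (F y) * of_real (exp (- (y \<bullet> \<xi>)\<^sup>2 / 2)) \<partial>lborel)"
  unfolding gaussian_slab_def of_real_mult[symmetric] by (rule integral_complex_of_real[symmetric])

lemma integrable_gaussian_slab:
  assumes "\<tau> > 0"
  shows "integrable lborel (\<lambda>\<xi>. complex_of_real (exp (- \<tau>\<^sup>2 * (norm \<xi>)\<^sup>2 / 2)) * of_real (slab \<xi>))"
  unfolding slab_eq
proof (rule integrable_bounded_kernel[where B = 1])
  show "integrable lborel (\<lambda>x::'a. complex_of_real (exp (- \<tau>\<^sup>2 * (norm x)\<^sup>2 / 2)))"
    using assms by (intro integrable_of_real integrable_scaled_gaussian)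
  show "integrable lborel (\<lambda>x. complex_of_real (F x))"
    by (intro integrable_of_real integrable_F)
  show "norm (complex_of_real (exp (- (y \<bullet> \<xi>)\<^sup>2 / 2))) \<le> 1" for y \<xi> :: 'a by simp
  show "(\<lambda>(\<xi>::'a, y). complex_of_real (exp (- (y \<bullet> \<xi>)\<^sup>2 / 2))) \<in> borel_measurable (lborel \<Otimes>\<^sub>M lborel)"
    by measurable
qed

text \<open>The integral over \<xi> becomes the Fourier transform of a Gaussian at s y - x, a bump
  of width \<tau> around s y. The power of \<open>sqrt (2 * pi)\<close> in the numerator comes from
  this transform, the denominator from the one-dimensional average over s.\<close>

lemma gaussian_slab_fourier:
  assumes "\<tau> > 0"
  shows "(\<integral>\<xi>. of_real (exp (- \<tau>\<^sup>2 * (norm \<xi>)\<^sup>2 / 2)) * of_real (slab \<xi>) * iexp (- (\<xi> \<bullet> x)) \<partial>lborel)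
    = of_real (sqrt (2 * pi) ^ DIM('a) / sqrt (2 * pi) *
        (\<integral>y. F y * (\<integral>s. exp (- s\<^sup>2 / 2) *
           (exp (- (norm (s *\<^sub>R y - x))\<^sup>2 / (2 * \<tau>\<^sup>2)) / \<tau> ^ DIM('a)) \<partial>lborel) \<partial>lborel))"
proof -
  let ?E = "\<lambda>\<xi>. complex_of_real (exp (- \<tau>\<^sup>2 * (norm \<xi>)\<^sup>2 / 2))"
  have int_E: "integrable lborel (\<lambda>\<xi>::'a. ?E \<xi> * iexp (- (\<xi> \<bullet> x)))" for x :: 'a
    using integrable_scaled_gaussian_iexp[OF assms, of "- x"] by (simp add: inner_commute)
  have inner: "(\<integral>\<xi>. ?E \<xi> * iexp (- (\<xi> \<bullet> x)) * of_real (exp (- (y \<bullet> \<xi>)\<^sup>2 / 2)) \<partial>lborel)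
     = of_real (sqrt (2 * pi) ^ DIM('a) / sqrt (2 * pi) *
        (\<integral>s. exp (- s\<^sup>2 / 2) * (exp (- (norm (s *\<^sub>R y - x))\<^sup>2 / (2 * \<tau>\<^sup>2)) / \<tau> ^ DIM('a)) \<partial>lborel))"
    for y
  proof -
    have "(\<integral>\<xi>. ?E \<xi> * iexp (- (\<xi> \<bullet> x)) * of_real (exp (- (y \<bullet> \<xi>)\<^sup>2 / 2)) \<partial>lborel)
      = (\<integral>\<xi>. (?E \<xi> * iexp (- (\<xi> \<bullet> x))) *
           (\<integral>s. of_real (exp (- s\<^sup>2 / 2)) * iexp ((y \<bullet> \<xi>) * s) \<partial>lborel) / of_real (sqrt (2 * pi)) \<partial>lborel)"
      unfolding integral_gaussian_iexp_real by (simp add: mult.assoc)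
    also have "\<dots> = (\<integral>\<xi>. (?E \<xi> * iexp (- (\<xi> \<bullet> x))) *
           (\<integral>s. of_real (exp (- s\<^sup>2 / 2)) * iexp ((y \<bullet> \<xi>) * s) \<partial>lborel) \<partial>lborel) / of_real (sqrt (2 * pi))"
      by (rule integral_divide_zero)
    also have "(\<integral>\<xi>. (?E \<xi> * iexp (- (\<xi> \<bullet> x))) *
           (\<integral>s. of_real (exp (- s\<^sup>2 / 2)) * iexp ((y \<bullet> \<xi>) * s) \<partial>lborel) \<partial>lborel)
      = (\<integral>s. of_real (exp (- s\<^sup>2 / 2)) *
           (\<integral>\<xi>. (?E \<xi> * iexp (- (\<xi> \<bullet> x))) * iexp ((y \<bullet> \<xi>) * s) \<partial>lborel) \<partial>lborel)"
    proof (rule integral_swap_bounded_kernel[where B = 1])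
      show "integrable lborel (\<lambda>s::real. complex_of_real (exp (- s\<^sup>2 / 2)))"
        using integrable_gaussian_iexp_real[of 0] by simp
      show "integrable lborel (\<lambda>\<xi>::'a. ?E \<xi> * iexp (- (\<xi> \<bullet> x)))"
        by (rule int_E)
      show "(\<lambda>(\<xi>, s). iexp (y \<bullet> \<xi> * s)) \<in> borel_measurable (lborel \<Otimes>\<^sub>M lborel)"
        by measurable
      show "norm (iexp (y \<bullet> \<xi> * s)) \<le> 1" for \<xi> s
        by simp
    qed
    also have "\<dots> = (\<integral>s. of_real (exp (- s\<^sup>2 / 2)) *
           (\<integral>\<xi>. ?E \<xi> * iexp ((s *\<^sub>R y - x) \<bullet> \<xi>) \<partial>lborel) \<partial>lborel)"
    proof -
      have "- (\<xi> \<bullet> x) + (y \<bullet> \<xi>) * s = (s *\<^sub>R y - x) \<bullet> \<xi>" for \<xi> s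
        by (simp add: inner_diff_left inner_commute[of x] mult.commute)
      then have "iexp (- (\<xi> \<bullet> x)) * iexp ((y \<bullet> \<xi>) * s) = iexp ((s *\<^sub>R y - x) \<bullet> \<xi>)" for \<xi> s
        by (metis exp_add distrib_left of_real_add)
      then show ?thesis
        by (simp only: mult.assoc)
    qed
    also have "\<dots> = (\<integral>s. of_real (exp (- s\<^sup>2 / 2) * (sqrt (2 * pi) ^ DIM('a) *
           (exp (- (norm (s *\<^sub>R y - x))\<^sup>2 / (2 * \<tau>\<^sup>2)) / \<tau> ^ DIM('a)))) \<partial>lborel)"
      unfolding integral_scaled_gaussian_iexp[OF assms] by simp
    also have "\<dots> = of_real (sqrt (2 * pi) ^ DIM('a) * (\<integral>s. exp (- s\<^sup>2 / 2) *
           (exp (- (norm (s *\<^sub>R y - x))\<^sup>2 / (2 * \<tau>\<^sup>2)) / \<tau> ^ DIM('a)) \<partial>lborel))"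
      by (simp only: integral_complex_of_real integral_mult_right_zero mult.left_commute[of "exp _"])
    finally show ?thesis by simp
  qed
  have "(\<integral>\<xi>. ?E \<xi> * of_real (slab \<xi>) * iexp (- (\<xi> \<bullet> x)) \<partial>lborel)
     = (\<integral>\<xi>. (?E \<xi> * iexp (- (\<xi> \<bullet> x))) *
          (\<integral>y. of_real (F y) * of_real (exp (- (y \<bullet> \<xi>)\<^sup>2 / 2)) \<partial>lborel) \<partial>lborel)"
    unfolding slab_eq by (simp only: mult_ac)
  also have "\<dots> = (\<integral>y. of_real (F y) *
          (\<integral>\<xi>. (?E \<xi> * iexp (- (\<xi> \<bullet> x))) * of_real (exp (- (y \<bullet> \<xi>)\<^sup>2 / 2)) \<partial>lborel) \<partial>lborel)"
  proof (rule integral_swap_bounded_kernel[where B = 1])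
    show "integrable lborel (\<lambda>x. complex_of_real (F x))"
      by (intro integrable_of_real integrable_F)
    show "integrable lborel (\<lambda>\<xi>::'a. ?E \<xi> * iexp (- (\<xi> \<bullet> x)))"
      by (rule int_E)
    show "norm (complex_of_real (exp (- (y \<bullet> \<xi>)\<^sup>2 / 2))) \<le> 1" for y \<xi> :: 'a by simp
    show "(\<lambda>(\<xi>::'a, y). complex_of_real (exp (- (y \<bullet> \<xi>)\<^sup>2 / 2))) \<in> borel_measurable (lborel \<Otimes>\<^sub>M lborel)"
      by measurable
  qed
  also have "\<dots> = (\<integral>y. of_real (sqrt (2 * pi) ^ DIM('a) / sqrt (2 * pi) * (F y *
       (\<integral>s. exp (- s\<^sup>2 / 2) * (exp (- (norm (s *\<^sub>R y - x))\<^sup>2 / (2 * \<tau>\<^sup>2)) / \<tau> ^ DIM('a)) \<partial>lborel))) \<partial>lborel)"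
    unfolding inner by (simp only: of_real_mult mult_ac)
  finally show ?thesis
    by (simp only: integral_complex_of_real integral_mult_right_zero)
qed

text \<open>For fixed \<tau> the bump is at most 1 / \<tau>^n, and integrating it against F leaves a
  bounded kernel in x and s. This lets s become the outermost variable.\<close>

lemma line_kernel_swap:
  assumes "\<tau> > 0"
  shows "(\<integral>x. \<rho> x * exp (- (norm x)\<^sup>2 / 2) *
      (\<integral>y. F y * (\<integral>s. exp (- s\<^sup>2 / 2) *
           (exp (- (norm (s *\<^sub>R y - x))\<^sup>2 / (2 * \<tau>\<^sup>2)) / \<tau> ^ DIM('a)) \<partial>lborel) \<partial>lborel) \<partial>lborel)
      = (\<integral>s. exp (- s\<^sup>2 / 2) * line_kernel \<tau> s \<partial>lborel)"
    and "integrable lborel (\<lambda>s. exp (- s\<^sup>2 / 2) * line_kernel \<tau> s)"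
proof -
  let ?k = "\<lambda>x y s. exp (- (norm (s *\<^sub>R y - x))\<^sup>2 / (2 * \<tau>\<^sup>2)) / \<tau> ^ DIM('a)"
  let ?w = "\<lambda>x. \<rho> x * exp (- (norm x)\<^sup>2 / 2)"
  have int_g: "integrable lborel (\<lambda>s::real. exp (- s\<^sup>2 / 2))"
    using integrable_scaled_gaussian[of 1, where 'a = real] by simp
  have k: "norm (?k x y s) \<le> 1 / \<tau> ^ DIM('a)" for x y :: 'a and s
    using assms by (simp add: divide_right_mono)
  have inner: "(\<integral>y. F y * (\<integral>s. exp (- s\<^sup>2 / 2) * ?k x y s \<partial>lborel) \<partial>lborel)
      = (\<integral>s. exp (- s\<^sup>2 / 2) * (\<integral>y. F y * ?k x y s \<partial>lborel) \<partial>lborel)" for x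
    by (rule integral_swap_bounded_kernel[OF integrable_F int_g _ k]) measurable
  have int_Fk: "integrable lborel (\<lambda>y. F y * ?k x y s)" for x s
    by (rule Bochner_Integration.integrable_bound[OF integrable_mult_right[OF integrable_F, of "1 / \<tau> ^ DIM('a)"]])
       (auto intro!: AE_I2 simp: abs_mult mult_left_le divide_right_mono assms less_imp_le)
  have kF: "norm (\<integral>y. F y * ?k x y s \<partial>lborel) \<le> (\<integral>y. \<bar>F y\<bar> * (1 / \<tau> ^ DIM('a)) \<partial>lborel)" for x s
  proof -
    have "norm (\<integral>y. F y * ?k x y s \<partial>lborel) \<le> (\<integral>y. norm (F y * ?k x y s) \<partial>lborel)"
      by (rule integral_norm_bound)
    also have "\<dots> \<le> (\<integral>y. \<bar>F y\<bar> * (1 / \<tau> ^ DIM('a)) \<partial>lborel)"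
    proof (intro integral_mono integrable_norm int_Fk integrable_mult_left)
      show "norm (F y * ?k x y s) \<le> \<bar>F y\<bar> * (1 / \<tau> ^ DIM('a))" for y
        unfolding norm_mult real_norm_def[of "F y"] by (intro mult_left_mono k) simp
    qed (use integrable_F in auto)
    finally show ?thesis .
  qed
  have meas: "(\<lambda>(x, s). \<integral>y. F y * ?k x y s \<partial>lborel) \<in> borel_measurable (lborel \<Otimes>\<^sub>M lborel)"
    by measurable
  show "(\<integral>x. ?w x * (\<integral>y. F y * (\<integral>s. exp (- s\<^sup>2 / 2) * ?k x y s \<partial>lborel) \<partial>lborel) \<partial>lborel)
      = (\<integral>s. exp (- s\<^sup>2 / 2) * line_kernel \<tau> s \<partial>lborel)"
    unfolding inner line_kernel_def
    by (rule integral_swap_bounded_kernel[OF integrable_weight int_g meas kF])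
  have meas': "(\<lambda>(s, x). \<integral>y. F y * ?k x y s \<partial>lborel) \<in> borel_measurable (lborel \<Otimes>\<^sub>M lborel)"
    by measurable
  show "integrable lborel (\<lambda>s. exp (- s\<^sup>2 / 2) * line_kernel \<tau> s)"
    unfolding line_kernel_def
    by (rule integrable_bounded_kernel[OF int_g integrable_weight meas' kF])
qed

text \<open>The Parseval identity of the argument: positivity of the transform is used on the left
  side, homogeneity of the weight on the right.\<close>

lemma weight_ft_slab_pairing:
  assumes "\<tau> > 0"
  shows "(\<integral>\<xi>. of_real (exp (- \<tau>\<^sup>2 * (norm \<xi>)\<^sup>2 / 2)) * of_real (slab \<xi>) * weight_ft \<xi> \<partial>lborel)
    = of_real (sqrt (2 * pi) ^ DIM('a) / sqrt (2 * pi) *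
        (\<integral>s. exp (- s\<^sup>2 / 2) * line_kernel \<tau> s \<partial>lborel))"
    and "integrable lborel (\<lambda>\<xi>. of_real (exp (- \<tau>\<^sup>2 * (norm \<xi>)\<^sup>2 / 2)) * of_real (slab \<xi>) * weight_ft \<xi>)"
proof -
  have k: "norm (iexp (- (\<xi> \<bullet> x))) \<le> 1" for \<xi> x :: 'a
    by simp
  have int_w: "integrable lborel (\<lambda>x. complex_of_real (\<rho> x * exp (- (norm x)\<^sup>2 / 2)))"
    by (intro integrable_of_real integrable_weight)
  have "(\<integral>\<xi>. of_real (exp (- \<tau>\<^sup>2 * (norm \<xi>)\<^sup>2 / 2)) * of_real (slab \<xi>) * weight_ft \<xi> \<partial>lborel)
     = (\<integral>x. of_real (\<rho> x * exp (- (norm x)\<^sup>2 / 2)) *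
      (\<integral>\<xi>. of_real (exp (- \<tau>\<^sup>2 * (norm \<xi>)\<^sup>2 / 2)) * of_real (slab \<xi>) * iexp (- (\<xi> \<bullet> x)) \<partial>lborel) \<partial>lborel)"
    unfolding weight_ft_def
    by (rule integral_swap_bounded_kernel[OF integrable_gaussian_slab[OF assms] int_w _ k]) measurable
  also have "\<dots> = (\<integral>x. of_real (sqrt (2 * pi) ^ DIM('a) / sqrt (2 * pi) * (\<rho> x * exp (- (norm x)\<^sup>2 / 2) *
      (\<integral>y. F y * (\<integral>s. exp (- s\<^sup>2 / 2) *
           (exp (- (norm (s *\<^sub>R y - x))\<^sup>2 / (2 * \<tau>\<^sup>2)) / \<tau> ^ DIM('a)) \<partial>lborel) \<partial>lborel))) \<partial>lborel)"
    unfolding gaussian_slab_fourier[OF assms] by (simp only: of_real_mult mult_ac)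
  finally show "(\<integral>\<xi>. of_real (exp (- \<tau>\<^sup>2 * (norm \<xi>)\<^sup>2 / 2)) * of_real (slab \<xi>) * weight_ft \<xi> \<partial>lborel)
    = of_real (sqrt (2 * pi) ^ DIM('a) / sqrt (2 * pi) *
        (\<integral>s. exp (- s\<^sup>2 / 2) * line_kernel \<tau> s \<partial>lborel))"
    by (simp only: integral_complex_of_real integral_mult_right_zero line_kernel_swap(1)[OF assms])
  show "integrable lborel (\<lambda>\<xi>. of_real (exp (- \<tau>\<^sup>2 * (norm \<xi>)\<^sup>2 / 2)) * of_real (slab \<xi>) * weight_ft \<xi>)"
    unfolding weight_ft_def
    by (rule integrable_bounded_kernel[OF integrable_gaussian_slab[OF assms] int_w _ k]) measurable
qed

section \<open>Homogeneity and the size of the line kernel\<close>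

lemma measurable_smoothing[measurable]: "smoothing \<sigma> \<in> borel_measurable borel"
  unfolding smoothing_def by measurable

text \<open>The factor \<open>1 / |s|\<close> produced here by homogeneity is the source of the logarithm.\<close>

lemma line_kernel_eq_pairing:
  assumes "\<tau> > 0" "s \<noteq> 0"
  shows "line_kernel \<tau> s = pairing \<bar>s\<bar> (\<tau> / \<bar>s\<bar>) / \<bar>s\<bar>"
proof -
  let ?n = "DIM('a)"
  let ?k = "\<lambda>x y. exp (- (norm (s *\<^sub>R y - x))\<^sup>2 / (2 * \<tau>\<^sup>2)) / \<tau> ^ ?n"
  \<comment> \<open>After x is replaced by s x and y by x + \<sigma> z, the distance from s y to s x
    is |s| \<sigma> |z|. This width makes it \<tau> |z|, so the bump becomes a standard Gaussian in
    z.\<close>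
  define \<sigma> where "\<sigma> = \<tau> / \<bar>s\<bar>"
  have \<sigma>: "\<sigma> > 0"
    using assms by (simp add: \<sigma>_def)
  have inner: "(\<integral>y. F y * ?k (s *\<^sub>R x) y \<partial>lborel) = smoothing \<sigma> x / \<bar>s\<bar> ^ ?n" for x
  proof -
    have "s *\<^sub>R (x + \<sigma> *\<^sub>R z) - s *\<^sub>R x = (s * \<sigma>) *\<^sub>R z" for z
      by (simp add: algebra_simps)
    then have "(norm (s *\<^sub>R (x + \<sigma> *\<^sub>R z) - s *\<^sub>R x))\<^sup>2 = \<tau>\<^sup>2 * (norm z)\<^sup>2" for z
      using assms by (simp add: abs_mult power_mult_distrib \<sigma>_def)
    then have "(norm (s *\<^sub>R (x + \<sigma> *\<^sub>R z) - s *\<^sub>R x))\<^sup>2 / (2 * \<tau>\<^sup>2) = (norm z)\<^sup>2 / 2" for z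
      using assms by simp
    then have k: "?k (s *\<^sub>R x) (x + \<sigma> *\<^sub>R z) = exp (- (norm z)\<^sup>2 / 2) / \<tau> ^ ?n" for z
      by (simp add: minus_divide_left[symmetric])
    have "(\<integral>y. F y * ?k (s *\<^sub>R x) y \<partial>lborel)
        = \<bar>\<sigma>\<bar> ^ ?n *\<^sub>R (\<integral>z. F (x + \<sigma> *\<^sub>R z) * ?k (s *\<^sub>R x) (x + \<sigma> *\<^sub>R z) \<partial>lborel)"
      using \<sigma> by (intro integral_lborel_affine) auto
    also have "\<dots> = \<bar>\<sigma>\<bar> ^ ?n * (smoothing \<sigma> x / \<tau> ^ ?n)"
      unfolding k smoothing_def by simp
    also have "\<dots> = smoothing \<sigma> x / \<bar>s\<bar> ^ ?n"
      using assms by (simp add: \<sigma>_def power_divide)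
    finally show ?thesis .
  qed
  have "line_kernel \<tau> s = \<bar>s\<bar> ^ ?n *\<^sub>R (\<integral>x. \<rho> (0 + s *\<^sub>R x) * exp (- (norm (0 + s *\<^sub>R x))\<^sup>2 / 2) *
     (\<integral>y. F y * ?k (0 + s *\<^sub>R x) y \<partial>lborel) \<partial>lborel)"
    unfolding line_kernel_def using assms by (intro integral_lborel_affine) measurable
  \<comment> \<open>The Jacobian |s|^n cancels the factor left by the inner integral; only the 1 /
    |s| of the weight survives.\<close>
  also have "\<dots> = \<bar>s\<bar> ^ ?n * (\<integral>x. (\<rho> x * exp (- s\<^sup>2 * (norm x)\<^sup>2 / 2) * smoothing \<sigma> x) / (\<bar>s\<bar> * \<bar>s\<bar> ^ ?n) \<partial>lborel)"
    unfolding add_0_left inner using assms by (simp add: scale power_mult_distrib)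
  also have "\<dots> = pairing \<bar>s\<bar> \<sigma> / \<bar>s\<bar>"
    unfolding integral_divide_zero pairing_def using assms by simp
  finally show ?thesis by (simp add: \<sigma>_def)
qed

text \<open>Complements the pairing formula, which is of no help when |s| is so small that \<tau> /
  |s| is large. Rescaling x by \<tau> turns the bump into a shifted Gaussian of width 1 and produces
  the factor 1 / \<tau>; the shift is harmless by the uniform bound. An s-interval of length of
  order \<tau> thus contributes O(1).\<close>

lemma line_kernel_bound:
  obtains K where "0 \<le> K" "\<And>\<tau> s. \<tau> > 0 \<Longrightarrow> \<bar>line_kernel \<tau> s\<bar> \<le> K / \<tau>"
proof -
  obtain \<kappa> where \<kappa>: "0 \<le> \<kappa>"
    "\<And>v. integrable lborel (\<lambda>x. \<rho> x * exp (- (norm (v - x))\<^sup>2 / 2))"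
    "\<And>v. (\<integral>x. \<rho> x * exp (- (norm (v - x))\<^sup>2 / 2) \<partial>lborel) \<le> \<kappa>"
    using weight_gaussian_uniform_bound by blast
  show thesis
  proof
    show "0 \<le> \<kappa> * (\<integral>y. \<bar>F y\<bar> \<partial>lborel)"
      using \<kappa> by simp
    fix \<tau> s :: real assume \<tau>: "\<tau> > 0"
    let ?n = "DIM('a)"
    let ?k = "\<lambda>x y. exp (- (norm (s *\<^sub>R y - x))\<^sup>2 / (2 * \<tau>\<^sup>2)) / \<tau> ^ ?n"
    let ?w = "\<lambda>x. \<rho> x * exp (- (norm x)\<^sup>2 / 2)"
    have k: "norm (?k x y) \<le> 1 / \<tau> ^ DIM('a)" for x y :: 'a
      using \<tau> by (simp add: divide_right_mono)
    have inner: "0 \<le> (\<integral>x. ?w x * ?k x y \<partial>lborel)" "(\<integral>x. ?w x * ?k x y \<partial>lborel) \<le> \<kappa> / \<tau>" for y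
    proof -
      show "0 \<le> (\<integral>x. ?w x * ?k x y \<partial>lborel)"
        using \<tau> nonneg by (intro Bochner_Integration.integral_nonneg) auto
      define h where "h x = \<rho> x * exp (- (norm ((s / \<tau>) *\<^sub>R y - x))\<^sup>2 / 2)" for x
      have int_h: "integrable lborel h"
        unfolding h_def by (rule \<kappa>)
      have [measurable]: "h \<in> borel_measurable borel"
        using int_h by auto
      have k_eq: "\<rho> x * ?k x y = h (0 + (1 / \<tau>) *\<^sub>R x) / (\<tau> * \<tau> ^ ?n)" for x
      proof -
        have "(s / \<tau>) *\<^sub>R y - (1 / \<tau>) *\<^sub>R x = (1 / \<tau>) *\<^sub>R (s *\<^sub>R y - x)"
          by (simp add: algebra_simps)
        then have "(norm ((s / \<tau>) *\<^sub>R y - (1 / \<tau>) *\<^sub>R x))\<^sup>2 / 2 = (norm (s *\<^sub>R y - x))\<^sup>2 / (2 * \<tau>\<^sup>2)"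
          by (simp add: power_divide)
        then show ?thesis
          unfolding h_def using \<tau> by (simp add: scale minus_divide_left[symmetric])
      qed
      \<comment> \<open>The factor \<open>exp (- (norm x)\<^sup>2 / 2)\<close> is dropped, because
        it would spoil the scaling in x.\<close>
      have "(\<integral>x. ?w x * ?k x y \<partial>lborel) \<le> (\<integral>x. \<rho> x * ?k x y \<partial>lborel)"
      proof (rule integral_mono')
        show "integrable lborel (\<lambda>x. \<rho> x * ?k x y)"
          unfolding k_eq using \<tau> by (intro integrable_divide integrable_lborel_affine int_h) simp
        show "?w x * ?k x y \<le> \<rho> x * ?k x y" for x
          using nonneg \<tau> by (intro mult_right_mono) (auto simp: mult_left_le)
        show "0 \<le> \<rho> x * ?k x y" for x
          using nonneg \<tau> by simp
      qed
      also have "\<dots> = (\<integral>x. h (0 + (1 / \<tau>) *\<^sub>R x) \<partial>lborel) / (\<tau> * \<tau> ^ ?n)"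
        unfolding k_eq by (rule integral_divide_zero)
      also have "(\<integral>x. h (0 + (1 / \<tau>) *\<^sub>R x) \<partial>lborel) = \<tau> ^ ?n * integral\<^sup>L lborel h"
        using \<tau> by (subst integral_lborel_affine[of h "1 / \<tau>" 0]) (auto simp: power_divide)
      also have "\<tau> ^ ?n * integral\<^sup>L lborel h / (\<tau> * \<tau> ^ ?n) = integral\<^sup>L lborel h / \<tau>"
        using \<tau> by simp
      also have "\<dots> \<le> \<kappa> / \<tau>"
        using \<tau> \<kappa>(3)[of "(s / \<tau>) *\<^sub>R y"] unfolding h_def by (intro divide_right_mono) auto
      finally show "(\<integral>x. ?w x * ?k x y \<partial>lborel) \<le> \<kappa> / \<tau>" .
    qed
    have eq: "line_kernel \<tau> s = (\<integral>y. F y * (\<integral>x. ?w x * ?k x y \<partial>lborel) \<partial>lborel)"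
      unfolding line_kernel_def
      by (rule integral_swap_bounded_kernel[OF integrable_weight integrable_F _ k]) measurable
    have "\<bar>line_kernel \<tau> s\<bar> \<le> (\<integral>y. \<bar>F y * (\<integral>x. ?w x * ?k x y \<partial>lborel)\<bar> \<partial>lborel)"
      unfolding eq by (rule integral_abs_bound)
    also have "\<dots> \<le> (\<integral>y. \<bar>F y\<bar> * (\<kappa> / \<tau>) \<partial>lborel)"
    proof (rule integral_mono')
      show "integrable lborel (\<lambda>y. \<bar>F y\<bar> * (\<kappa> / \<tau>))"
        by (intro integrable_mult_left integrable_abs integrable_F)
      show "\<bar>F y * (\<integral>x. ?w x * ?k x y \<partial>lborel)\<bar> \<le> \<bar>F y\<bar> * (\<kappa> / \<tau>)" for y
        unfolding abs_mult abs_of_nonneg[OF inner(1)] by (rule mult_left_mono[OF inner(2)]) simp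
      show "0 \<le> \<bar>F y\<bar> * (\<kappa> / \<tau>)" for y
        using \<kappa>(1) \<tau> by simp
    qed
    finally show "\<bar>line_kernel \<tau> s\<bar> \<le> \<kappa> * (\<integral>y. \<bar>F y\<bar> \<partial>lborel) / \<tau>"
      by (simp add: mult.commute)
  qed
qed

section \<open>The rescaled pairing and its limit\<close>

text \<open>A majorant free of \<sigma> that splits into Gaussians in x and z. For y = x + \<sigma>
  z and \<sigma> \<le> 1/2 one has |x| \<le> |y| + |z| / 2, so the Gaussians in y and z together
  control x. The rate is written \<open>(1/2)\<^sup>2\<close> to match the scaled Gaussian integral
  at width parameter 1/2.\<close>

lemma F_shift_bound:
  assumes "0 \<le> \<sigma>" "\<sigma> \<le> 1 / 2"
  shows "\<bar>F (x + \<sigma> *\<^sub>R z) * exp (- (norm z)\<^sup>2 / 2)\<bar>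
    \<le> C * exp (- (1/2)\<^sup>2 * (norm x)\<^sup>2 / 2) * exp (- (1/2)\<^sup>2 * (norm z)\<^sup>2 / 2)"
proof -
  let ?y = "x + \<sigma> *\<^sub>R z"
  have "norm x \<le> norm ?y + norm z / 2"
  proof -
    have "norm x \<le> norm ?y + norm (\<sigma> *\<^sub>R z)"
      using norm_triangle_ineq4[of ?y "\<sigma> *\<^sub>R z"] by simp
    also have "norm (\<sigma> *\<^sub>R z) \<le> norm z / 2"
      using assms mult_right_mono[of \<sigma> "1/2" "norm z"] by simp
    finally show ?thesis by simp
  qed
  then have "(norm x)\<^sup>2 \<le> (norm ?y + norm z / 2)\<^sup>2"
    by (intro power_mono) auto
  also have "\<dots> \<le> 2 * (norm ?y)\<^sup>2 + (norm z)\<^sup>2 / 2"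
    using sum_squares_ge_zero[of "norm ?y - norm z / 2" 0]
    by (simp add: power2_eq_square algebra_simps)
  finally have le: "(norm x)\<^sup>2 \<le> 2 * (norm ?y)\<^sup>2 + (norm z)\<^sup>2 / 2" .
  have quarter: "(1/2 :: real)\<^sup>2 = 1/4"
    by (simp add: power2_eq_square)
  have "- (norm ?y)\<^sup>2 / 2 + - (norm z)\<^sup>2 / 2 \<le> - (1/2)\<^sup>2 * (norm x)\<^sup>2 / 2 + - (1/2)\<^sup>2 * (norm z)\<^sup>2 / 2"
    using le zero_le_power2[of "norm ?y"] zero_le_power2[of "norm z"] unfolding quarter by linarith
  then have "exp (- (norm ?y)\<^sup>2 / 2) * exp (- (norm z)\<^sup>2 / 2)
     \<le> exp (- (1/2)\<^sup>2 * (norm x)\<^sup>2 / 2) * exp (- (1/2)\<^sup>2 * (norm z)\<^sup>2 / 2)"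
    unfolding exp_add[symmetric] exp_le_cancel_iff .
  then have "C * (exp (- (norm ?y)\<^sup>2 / 2) * exp (- (norm z)\<^sup>2 / 2))
     \<le> C * (exp (- (1/2)\<^sup>2 * (norm x)\<^sup>2 / 2) * exp (- (1/2)\<^sup>2 * (norm z)\<^sup>2 / 2))"
    using C_nonneg by (rule mult_left_mono)
  moreover have "\<bar>F ?y * exp (- (norm z)\<^sup>2 / 2)\<bar> \<le> C * exp (- (norm ?y)\<^sup>2 / 2) * exp (- (norm z)\<^sup>2 / 2)"
    unfolding abs_mult abs_exp_cancel by (intro mult_right_mono F_bound) simp
  ultimately show ?thesis by (simp only: mult.assoc)
qed

lemma smoothing_bound:
  assumes "0 \<le> \<sigma>" "\<sigma> \<le> 1 / 2"
  shows "\<bar>smoothing \<sigma> x\<bar> \<le> C * (sqrt (2 * pi) / (1/2)) ^ DIM('a) * exp (- (1/2)\<^sup>2 * (norm x)\<^sup>2 / 2)"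
proof -
  have "\<bar>smoothing \<sigma> x\<bar> \<le> (\<integral>z. \<bar>F (x + \<sigma> *\<^sub>R z) * exp (- (norm z)\<^sup>2 / 2)\<bar> \<partial>lborel)"
    unfolding smoothing_def by (rule integral_abs_bound)
  also have "\<dots> \<le> (\<integral>z. C * exp (- (1/2)\<^sup>2 * (norm x)\<^sup>2 / 2) * exp (- (1/2)\<^sup>2 * (norm (z::'a))\<^sup>2 / 2) \<partial>lborel)"
    using C_nonneg assms
    by (intro integral_mono' F_shift_bound integrable_mult_right integrable_scaled_gaussian) auto
  also have "\<dots> = C * exp (- (1/2)\<^sup>2 * (norm x)\<^sup>2 / 2) * (sqrt (2 * pi) / (1/2)) ^ DIM('a)"
    unfolding integral_mult_right_zero by (subst integral_scaled_gaussian) auto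
  finally show ?thesis by (simp only: mult_ac)
qed

text \<open>Discarding the Gaussian in s x makes the majorant independent of s as well, so it yields
  both a bound uniform in the parameters and dominated convergence as they tend to 0.\<close>

lemma pairing_integrand_bound:
  assumes "0 \<le> \<sigma>" "\<sigma> \<le> 1 / 2"
  shows "\<bar>\<rho> x * exp (- s\<^sup>2 * (norm x)\<^sup>2 / 2) * smoothing \<sigma> x\<bar>
    \<le> C * (sqrt (2 * pi) / (1/2)) ^ DIM('a) * (\<rho> x * exp (- (1/2)\<^sup>2 * (norm x)\<^sup>2 / 2))"
proof -
  have "\<bar>\<rho> x * exp (- s\<^sup>2 * (norm x)\<^sup>2 / 2) * smoothing \<sigma> x\<bar>
     = \<rho> x * (exp (- s\<^sup>2 * (norm x)\<^sup>2 / 2) * \<bar>smoothing \<sigma> x\<bar>)"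
    using nonneg by (simp add: abs_mult mult.assoc)
  also have "\<dots> \<le> \<rho> x * (1 * \<bar>smoothing \<sigma> x\<bar>)"
    using nonneg by (intro mult_left_mono mult_right_mono) auto
  also have "\<dots> \<le> \<rho> x * (C * (sqrt (2 * pi) / (1/2)) ^ DIM('a) * exp (- (1/2)\<^sup>2 * (norm x)\<^sup>2 / 2))"
    using smoothing_bound[OF assms, of x] nonneg by (intro mult_left_mono) auto
  finally show ?thesis by (simp only: mult_ac)
qed

lemma pairing_bound:
  obtains K where "0 \<le> K" "\<And>s \<sigma>. 0 \<le> \<sigma> \<Longrightarrow> \<sigma> \<le> 1 / 2 \<Longrightarrow> \<bar>pairing s \<sigma>\<bar> \<le> K"
proof
  let ?B = "\<lambda>x. C * (sqrt (2 * pi) / (1/2)) ^ DIM('a) * (\<rho> x * exp (- (1/2)\<^sup>2 * (norm x)\<^sup>2 / 2))"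
  show "0 \<le> (\<integral>x. ?B x \<partial>lborel)"
    using C_nonneg nonneg by (intro Bochner_Integration.integral_nonneg) auto
  fix s \<sigma> :: real assume "0 \<le> \<sigma>" "\<sigma> \<le> 1 / 2"
  then have "(\<integral>x. \<bar>\<rho> x * exp (- s\<^sup>2 * (norm x)\<^sup>2 / 2) * smoothing \<sigma> x\<bar> \<partial>lborel) \<le> (\<integral>x. ?B x \<partial>lborel)"
    using C_nonneg nonneg
    by (intro integral_mono' pairing_integrand_bound integrable_mult_right integrable_weight_gaussian) auto
  then show "\<bar>pairing s \<sigma>\<bar> \<le> (\<integral>x. ?B x \<partial>lborel)"
    unfolding pairing_def by (rule order_trans[OF integral_abs_bound])
qed

lemma smoothing_tendsto:
  assumes "\<sigma> \<longlonglongrightarrow> 0" "\<And>j. 0 \<le> \<sigma> j" "\<And>j. \<sigma> j \<le> 1 / 2"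
  shows "(\<lambda>j. smoothing (\<sigma> j) x) \<longlonglongrightarrow> sqrt (2 * pi) ^ DIM('a) * F x"
proof -
  have "(\<lambda>j. smoothing (\<sigma> j) x) \<longlonglongrightarrow> (\<integral>z. F x * exp (- (norm (z::'a))\<^sup>2 / 2) \<partial>lborel)"
    unfolding smoothing_def
  proof (rule integral_dominated_convergence)
    show "integrable lborel (\<lambda>z::'a. C * exp (- (1/2)\<^sup>2 * (norm x)\<^sup>2 / 2) * exp (- (1/2)\<^sup>2 * (norm z)\<^sup>2 / 2))"
      by (intro integrable_mult_right integrable_scaled_gaussian) simp
    show "AE z in lborel. norm (F (x + \<sigma> j *\<^sub>R z) * exp (- (norm z)\<^sup>2 / 2))
        \<le> C * exp (- (1/2)\<^sup>2 * (norm x)\<^sup>2 / 2) * exp (- (1/2)\<^sup>2 * (norm z)\<^sup>2 / 2)" for j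
      unfolding real_norm_def using assms by (intro AE_I2 F_shift_bound)
    show "AE z in lborel. (\<lambda>j. F (x + \<sigma> j *\<^sub>R z) * exp (- (norm z)\<^sup>2 / 2)) \<longlonglongrightarrow> F x * exp (- (norm z)\<^sup>2 / 2)"
    proof (intro AE_I2 tendsto_mult tendsto_const)
      fix z
      have "(\<lambda>j. x + \<sigma> j *\<^sub>R z) \<longlonglongrightarrow> x + 0 *\<^sub>R z"
        by (intro tendsto_intros assms)
      then show "(\<lambda>j. F (x + \<sigma> j *\<^sub>R z)) \<longlonglongrightarrow> F x"
        using continuous_on_tendsto_compose[OF cont, of "\<lambda>j. x + \<sigma> j *\<^sub>R z" x] by simp
    qed
  qed measurable
  also have "(\<integral>z. F x * exp (- (norm (z::'a))\<^sup>2 / 2) \<partial>lborel) = sqrt (2 * pi) ^ DIM('a) * F x"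
    using integral_scaled_gaussian[of 1, where 'a = 'a] by simp
  finally show ?thesis .
qed

lemma pairing_tendsto:
  assumes "\<sigma> \<longlonglongrightarrow> 0" "\<And>j. 0 \<le> \<sigma> j" "\<And>j. \<sigma> j \<le> 1 / 2" "s \<longlonglongrightarrow> 0"
  shows "(\<lambda>j. pairing (s j) (\<sigma> j)) \<longlonglongrightarrow> sqrt (2 * pi) ^ DIM('a) * (\<integral>x. \<rho> x * F x \<partial>lborel)"
proof -
  have "(\<lambda>j. pairing (s j) (\<sigma> j)) \<longlonglongrightarrow> (\<integral>x. \<rho> x * exp (- 0\<^sup>2 * (norm x)\<^sup>2 / 2) * (sqrt (2 * pi) ^ DIM('a) * F x) \<partial>lborel)"
    unfolding pairing_def
  proof (rule integral_dominated_convergence)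
    show "integrable lborel (\<lambda>x. C * (sqrt (2 * pi) / (1/2)) ^ DIM('a) * (\<rho> x * exp (- (1/2)\<^sup>2 * (norm x)\<^sup>2 / 2)))"
      by (intro integrable_mult_right integrable_weight_gaussian) simp
    show "AE x in lborel. norm (\<rho> x * exp (- (s j)\<^sup>2 * (norm x)\<^sup>2 / 2) * smoothing (\<sigma> j) x)
        \<le> C * (sqrt (2 * pi) / (1/2)) ^ DIM('a) * (\<rho> x * exp (- (1/2)\<^sup>2 * (norm x)\<^sup>2 / 2))" for j
      unfolding real_norm_def using assms by (intro AE_I2 pairing_integrand_bound)
    show "AE x in lborel. (\<lambda>j. \<rho> x * exp (- (s j)\<^sup>2 * (norm x)\<^sup>2 / 2) * smoothing (\<sigma> j) x)
       \<longlonglongrightarrow> \<rho> x * exp (- 0\<^sup>2 * (norm x)\<^sup>2 / 2) * (sqrt (2 * pi) ^ DIM('a) * F x)"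
      by (intro AE_I2 tendsto_intros smoothing_tendsto assms) auto
  qed measurable
  moreover
    have "\<rho> x * exp (- 0\<^sup>2 * (norm x)\<^sup>2 / 2) * (sqrt (2 * pi) ^ DIM('a) * F x)
        = sqrt (2 * pi) ^ DIM('a) * (\<rho> x * F x)" for x
      by simp
  ultimately show ?thesis
    by (simp only: integral_mult_right_zero)
qed

section \<open>Lower and upper estimates as \<tau> tends to 0\<close>

text \<open>The point is that K is free of \<tau>. In the ball of radius A the damping factor is at
  most 1, the slab average at most the L1 norm \<open>S\<close> of F, and the transform at most the
  integral \<open>P\<close> of the damped weight; outside the ball the integrand is nonnegative. The
  volume of the ball times \<open>S * P\<close>, divided by the Parseval constant, is a
  bound.\<close>

lemma line_integral_lower_bound:
  assumes pos: "\<And>\<xi>. weight_ft \<xi> \<in> \<real>\<^sub>\<ge>\<^sub>0" and slab: "\<And>\<xi>. A \<le> norm \<xi> \<Longrightarrow> 0 \<le> slab \<xi>"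
  obtains K where "\<And>\<tau>. \<tau> > 0 \<Longrightarrow> - K \<le> (\<integral>s. exp (- s\<^sup>2 / 2) * line_kernel \<tau> s \<partial>lborel)"
proof -
  define P where "P = (\<integral>x. \<rho> x * exp (- (norm x)\<^sup>2 / 2) \<partial>lborel)"
  define S where "S = (\<integral>y. \<bar>F y\<bar> \<partial>lborel)"
  define c where "c = sqrt (2 * pi) ^ DIM('a) / sqrt (2 * pi)"
  have c: "c > 0" by (simp add: c_def)
  have P: "0 \<le> P" and S: "0 \<le> S"
    unfolding P_def S_def using nonneg by (auto intro!: Bochner_Integration.integral_nonneg)
  have weight_le: "Re (weight_ft \<xi>) \<le> P" for \<xi>
  proof -
    have "Re (weight_ft \<xi>) \<le> norm (weight_ft \<xi>)"
      by (rule complex_Re_le_cmod)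
    also have "\<dots> \<le> (\<integral>x. norm (of_real (\<rho> x * exp (- (norm x)\<^sup>2 / 2)) * iexp (- (\<xi> \<bullet> x))) \<partial>lborel)"
      unfolding weight_ft_def by (rule integral_norm_bound)
    also have "\<dots> = P"
      unfolding P_def using nonneg by (simp add: norm_mult)
    finally show ?thesis .
  qed
  have slab_le: "\<bar>slab \<xi>\<bar> \<le> S" for \<xi>
  proof -
    have "\<bar>slab \<xi>\<bar> \<le> (\<integral>y. \<bar>F y * exp (- (y \<bullet> \<xi>)\<^sup>2 / 2)\<bar> \<partial>lborel)"
      unfolding gaussian_slab_def by (rule integral_abs_bound)
    also have "\<dots> \<le> S"
      unfolding S_def
      by (intro integral_mono' integrable_abs integrable_F) (auto simp: abs_mult mult_left_le)
    finally show ?thesis .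
  qed
  show thesis
  proof
    fix \<tau> :: real assume \<tau>: "\<tau> > 0"
    \<comment> \<open>Membership of \<open>weight_ft \<xi>\<close> in the nonnegative reals makes
      the complex integrand real.\<close>
    define r where "r \<xi> = exp (- \<tau>\<^sup>2 * (norm \<xi>)\<^sup>2 / 2) * slab \<xi> * Re (weight_ft \<xi>)" for \<xi>
    have r: "of_real (exp (- \<tau>\<^sup>2 * (norm \<xi>)\<^sup>2 / 2)) * of_real (slab \<xi>) * weight_ft \<xi> = complex_of_real (r \<xi>)" for \<xi>
      using pos[of \<xi>] unfolding r_def by (auto simp: nonneg_Reals_def)
    have int_r: "integrable lborel r"
      using weight_ft_slab_pairing(2)[OF \<tau>] unfolding r complex_of_real_integrable_eq .
    have "complex_of_real (integral\<^sup>L lborel r) = of_real (c * (\<integral>s. exp (- s\<^sup>2 / 2) * line_kernel \<tau> s \<partial>lborel))"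
      using weight_ft_slab_pairing(1)[OF \<tau>] unfolding r integral_complex_of_real c_def .
    then have eq: "integral\<^sup>L lborel r = c * (\<integral>s. exp (- s\<^sup>2 / 2) * line_kernel \<tau> s \<partial>lborel)"
      unfolding of_real_eq_iff .
    have r_ge: "indicator (ball 0 A) \<xi> * (- (S * P)) \<le> r \<xi>" for \<xi>
    proof -
      have w: "0 \<le> Re (weight_ft \<xi>)"
        using pos[of \<xi>] by (auto simp: nonneg_Reals_def)
      show ?thesis
      proof (cases "A \<le> norm \<xi>")
        case True
        then show ?thesis using slab w by (simp add: r_def)
      next
        case False
        have "\<bar>r \<xi>\<bar> = exp (- \<tau>\<^sup>2 * (norm \<xi>)\<^sup>2 / 2) * (\<bar>slab \<xi>\<bar> * Re (weight_ft \<xi>))"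
          using w by (simp add: r_def abs_mult mult.assoc)
        also have "\<dots> \<le> 1 * (S * P)"
          using w slab_le weight_le S by (intro mult_mono) auto
        finally show ?thesis using False by simp
      qed
    qed
    have "measure lborel (ball 0 A :: 'a set) * (- (S * P)) = (\<integral>\<xi>. indicator (ball (0::'a) A) \<xi> * (- (S * P)) \<partial>lborel)"
      by simp
    also have "\<dots> \<le> integral\<^sup>L lborel r"
      by (intro integral_mono int_r r_ge integrable_mult_left integrable_real_indicator)
         (use emeasure_bounded_finite[OF bounded_ball] in auto)
    finally show "- (measure lborel (ball 0 A :: 'a set) * (S * P) / c)
        \<le> (\<integral>s. exp (- s\<^sup>2 / 2) * line_kernel \<tau> s \<partial>lborel)"
      unfolding eq using c by (simp add: field_simps)
  qed
qed

text \<open>The sequential limit is upgraded to a bound on a whole square of parameters: otherwise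
  sequences tending to 0 would violate it. Half of the negative limit serves as the bound.\<close>

lemma pairing_eventually_negative:
  assumes "(\<integral>x. \<rho> x * F x \<partial>lborel) < 0"
  obtains D \<sigma>\<^sub>0 where "0 < D" "0 < \<sigma>\<^sub>0" "\<sigma>\<^sub>0 \<le> 1 / 2"
    "\<And>s \<sigma>. 0 < s \<Longrightarrow> s \<le> \<sigma>\<^sub>0 \<Longrightarrow> 0 < \<sigma> \<Longrightarrow> \<sigma> \<le> \<sigma>\<^sub>0 \<Longrightarrow> pairing s \<sigma> \<le> - D"
proof -
  define L where "L = sqrt (2 * pi) ^ DIM('a) * (\<integral>x. \<rho> x * F x \<partial>lborel)"
  have L: "L < 0"
    using assms by (simp add: L_def mult_less_0_iff)
  have "\<exists>\<sigma>\<^sub>0>0. \<sigma>\<^sub>0 \<le> 1 / 2 \<and> (\<forall>s \<sigma>. 0 < s \<longrightarrow> s \<le> \<sigma>\<^sub>0 \<longrightarrow> 0 < \<sigma> \<longrightarrow> \<sigma> \<le> \<sigma>\<^sub>0 \<longrightarrow> pairing s \<sigma> \<le> L / 2)"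
  proof (rule ccontr)
    assume *: "\<not> ?thesis"
    \<comment> \<open>Starts at 1/2, since the limit of the pairing is available only for \<sigma>
      \<le> 1/2.\<close>
    define e :: "nat \<Rightarrow> real" where "e j = inverse (of_nat (Suc (Suc j)))" for j
    have e: "e j > 0" "e j \<le> 1 / 2" for j
      unfolding e_def by (auto simp: field_simps)
    have "\<exists>s \<sigma>. 0 < s \<and> s \<le> e j \<and> 0 < \<sigma> \<and> \<sigma> \<le> e j \<and> L / 2 < pairing s \<sigma>" for j
      using * e[of j] by (meson not_le)
    then obtain s \<sigma> where s\<sigma>: "\<And>j. 0 < s j" "\<And>j. s j \<le> e j" "\<And>j. 0 < \<sigma> j" "\<And>j. \<sigma> j \<le> e j"
      "\<And>j. L / 2 < pairing (s j) (\<sigma> j)"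
      by metis
    have lim_e: "e \<longlonglongrightarrow> 0"
      unfolding e_def by (rule LIMSEQ_Suc[OF LIMSEQ_inverse_real_of_nat])
    have "s \<longlonglongrightarrow> 0" "\<sigma> \<longlonglongrightarrow> 0"
      using s\<sigma> by (auto intro!: tendsto_sandwich[OF _ _ tendsto_const lim_e] simp: less_imp_le)
    then have "(\<lambda>j. pairing (s j) (\<sigma> j)) \<longlonglongrightarrow> L"
      unfolding L_def using s\<sigma>(3) order_trans[OF s\<sigma>(4) e(2)] by (intro pairing_tendsto) (auto simp: less_imp_le)
    then have "L / 2 \<le> L"
      by (rule LIMSEQ_le_const) (use s\<sigma>(5) in \<open>auto simp: less_imp_le\<close>)
    then show False using L by simp
  qed
  then obtain \<sigma>\<^sub>0 where "\<sigma>\<^sub>0 > 0" "\<sigma>\<^sub>0 \<le> 1 / 2"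
    "\<And>s \<sigma>. 0 < s \<Longrightarrow> s \<le> \<sigma>\<^sub>0 \<Longrightarrow> 0 < \<sigma> \<Longrightarrow> \<sigma> \<le> \<sigma>\<^sub>0 \<Longrightarrow> pairing s \<sigma> \<le> L / 2"
    by blast
  then show thesis
    using L that[of "- (L / 2)" \<sigma>\<^sub>0] by auto
qed

text \<open>The s-axis splits into three ranges. For |s| below \<tau> /
  \<open>\<sigma>\<^sub>0\<close> the bound K / \<tau> on an interval of length 2 \<tau> /
  \<open>\<sigma>\<^sub>0\<close> costs O(1). From there to \<open>\<sigma>\<^sub>0\<close>, both
  |s| and \<tau> / |s| are at most \<open>\<sigma>\<^sub>0\<close>, so the kernel is at most -D /
  |s|; this range produces the logarithm. Beyond \<open>\<sigma>\<^sub>0\<close> the pairing is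
  merely bounded and the Gaussian in s makes it integrable.\<close>

lemma line_integral_upper_bound:
  assumes "(\<integral>x. \<rho> x * F x \<partial>lborel) < 0"
  obtains d \<tau>\<^sub>0 c where "0 < d" "0 < \<tau>\<^sub>0"
    "\<And>\<tau>. 0 < \<tau> \<Longrightarrow> \<tau> \<le> \<tau>\<^sub>0 \<Longrightarrow> (\<integral>s. exp (- s\<^sup>2 / 2) * line_kernel \<tau> s \<partial>lborel) \<le> c + d * ln \<tau>"
proof -
  obtain D \<sigma>\<^sub>0 where D: "0 < D" "0 < \<sigma>\<^sub>0" "\<sigma>\<^sub>0 \<le> 1 / 2"
    and neg: "\<And>s \<sigma>. 0 < s \<Longrightarrow> s \<le> \<sigma>\<^sub>0 \<Longrightarrow> 0 < \<sigma> \<Longrightarrow> \<sigma> \<le> \<sigma>\<^sub>0 \<Longrightarrow> pairing s \<sigma> \<le> - D"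
    using pairing_eventually_negative[OF assms] by blast
  obtain K where K: "0 \<le> K" "\<And>\<tau> s. \<tau> > 0 \<Longrightarrow> \<bar>line_kernel \<tau> s\<bar> \<le> K / \<tau>"
    using line_kernel_bound by blast
  obtain K' where K': "0 \<le> K'" "\<And>s \<sigma>. 0 \<le> \<sigma> \<Longrightarrow> \<sigma> \<le> 1 / 2 \<Longrightarrow> \<bar>pairing s \<sigma>\<bar> \<le> K'"
    using pairing_bound by blast
  \<comment> \<open>The exponential is the least value of \<open>exp (- s\<^sup>2 / 2)\<close> for
    |s| \<le> 1, a range that contains |s| \<le> \<open>\<sigma>\<^sub>0\<close>.\<close>
  define d where "d = D * exp (- 1 / 2)"
  have d: "d > 0" using D by (simp add: d_def)
  show thesis
  proof (rule that[of d "\<sigma>\<^sub>0\<^sup>2" "2 * K / \<sigma>\<^sub>0 + K' / \<sigma>\<^sub>0 * sqrt (2 * pi) - d * (2 * ln \<sigma>\<^sub>0)"])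
    show "0 < \<sigma>\<^sub>0\<^sup>2" using D by simp
    fix \<tau> :: real assume \<tau>: "0 < \<tau>" "\<tau> \<le> \<sigma>\<^sub>0\<^sup>2"
    \<comment> \<open>For |s| \<ge> a the smoothing width \<tau> / |s| is at most
      \<open>\<sigma>\<^sub>0\<close>; the restriction on \<tau> ensures a \<le>
      \<open>\<sigma>\<^sub>0\<close>.\<close>
    define a where "a = \<tau> / \<sigma>\<^sub>0"
    have a: "0 < a" "a \<le> \<sigma>\<^sub>0"
      using \<tau> D by (auto simp: a_def field_simps power2_eq_square)
    \<comment> \<open>One summand for each range. The logarithm is collected on the positive half
      only; for negative s in the middle range it is enough that the kernel is nonpositive.\<close>
    define U where "U s = K / \<tau> * indicator {-a..a} s + K' / \<sigma>\<^sub>0 * exp (- s\<^sup>2 / 2)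
        - d * (1 / s * indicator {a..\<sigma>\<^sub>0} s)" for s :: real
    have log: "has_bochner_integral lborel (\<lambda>s. 1 / s * indicator {a..\<sigma>\<^sub>0} s) (ln \<sigma>\<^sub>0 - ln a)"
      using a by (intro has_bochner_integral_FTC_Icc_real) (auto intro!: derivative_eq_intros continuous_intros)
    have int_gauss: "has_bochner_integral lborel (\<lambda>s::real. exp (- s\<^sup>2 / 2)) (sqrt (2 * pi))"
      using integrable_scaled_gaussian[of 1, where 'a = real] integral_scaled_gaussian[of 1, where 'a = real]
      by (simp add: has_bochner_integral_iff)
    have int_U: "has_bochner_integral lborel U (K / \<tau> * (2 * a) + K' / \<sigma>\<^sub>0 * sqrt (2 * pi) - d * (ln \<sigma>\<^sub>0 - ln a))"
      unfolding U_def
      using a has_bochner_integral_real_indicator[of "{-a..a}" lborel]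
      by (intro has_bochner_integral_diff has_bochner_integral_add has_bochner_integral_mult_right log int_gauss) auto
    have bound: "exp (- s\<^sup>2 / 2) * line_kernel \<tau> s \<le> U s" for s
    proof (cases "\<bar>s\<bar> < a")
      case True
      have "exp (- s\<^sup>2 / 2) * line_kernel \<tau> s \<le> 1 * (K / \<tau>)"
        using order_trans[OF abs_ge_self K(2)[OF \<tau>(1), of s]] K(1) \<tau>
        by (intro order_trans[OF mult_left_mono mult_right_mono]) auto
      also have "\<dots> \<le> U s"
        using True K' D by (simp add: U_def abs_less_iff)
      finally show ?thesis .
    next
      case False
      then have s: "s \<noteq> 0" "a \<le> \<bar>s\<bar>" using a by auto
      have \<sigma>: "0 < \<tau> / \<bar>s\<bar>" "\<tau> / \<bar>s\<bar> \<le> \<sigma>\<^sub>0"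
        using s \<tau> D by (auto simp: a_def field_simps)
      have eq: "line_kernel \<tau> s = pairing \<bar>s\<bar> (\<tau> / \<bar>s\<bar>) / \<bar>s\<bar>"
        using \<tau> s by (intro line_kernel_eq_pairing) auto
      have nonneg': "0 \<le> K / \<tau> * indicator {-a..a} s" "0 \<le> K' / \<sigma>\<^sub>0 * exp (- s\<^sup>2 / 2)"
        using K K' D \<tau> by auto
      show ?thesis
      proof (cases "\<bar>s\<bar> \<le> \<sigma>\<^sub>0")
        case True
        have le: "line_kernel \<tau> s \<le> - D / \<bar>s\<bar>"
          unfolding eq using neg[of "\<bar>s\<bar>" "\<tau> / \<bar>s\<bar>"] s \<sigma> True by (intro divide_right_mono) auto
        have "exp (- s\<^sup>2 / 2) * line_kernel \<tau> s \<le> - (d * (1 / s * indicator {a..\<sigma>\<^sub>0} s))"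
        proof (cases "s > 0")
          case pos: True
          have "s\<^sup>2 \<le> 1" using pos True D by (intro power_le_one) auto
          then have "exp (- 1 / 2) \<le> exp (- s\<^sup>2 / 2)" by simp
          then have "exp (- s\<^sup>2 / 2) * (D / s) \<ge> exp (- 1 / 2) * (D / s)"
            using D pos by (intro mult_right_mono) auto
          moreover have "exp (- s\<^sup>2 / 2) * line_kernel \<tau> s \<le> exp (- s\<^sup>2 / 2) * (- D / s)"
            using le pos by (intro mult_left_mono) auto
          ultimately show ?thesis
            using pos s True by (simp add: d_def mult.commute)
        next
          case False
          have "line_kernel \<tau> s \<le> 0"
            using le D by (meson abs_ge_zero divide_nonpos_nonneg less_imp_le neg_le_0_iff_le order_trans)
          then have "exp (- s\<^sup>2 / 2) * line_kernel \<tau> s \<le> 0"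
            by (intro mult_nonneg_nonpos) auto
          then show ?thesis using False a by simp
        qed
        then show ?thesis
          using nonneg' unfolding U_def by linarith
      next
        case False
        have "line_kernel \<tau> s \<le> K' / \<bar>s\<bar>"
          unfolding eq
          by (intro divide_right_mono order_trans[OF abs_ge_self K'(2)]) (use \<sigma> D in linarith)+
        also have "\<dots> \<le> K' / \<sigma>\<^sub>0"
          using False D K' by (intro divide_left_mono) auto
        finally have "exp (- s\<^sup>2 / 2) * line_kernel \<tau> s \<le> exp (- s\<^sup>2 / 2) * (K' / \<sigma>\<^sub>0)"
          by (intro mult_left_mono) auto
        moreover have "indicator {a..\<sigma>\<^sub>0} s = (0 :: real)"
          using False a by (auto simp: indicator_def)
        ultimately show ?thesis
          using nonneg'(1) unfolding U_def mult.commute[of "K' / \<sigma>\<^sub>0"]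
          by (simp only: mult_zero_right diff_zero)
      qed
    qed
    have "(\<integral>s. exp (- s\<^sup>2 / 2) * line_kernel \<tau> s \<partial>lborel) \<le> integral\<^sup>L lborel U"
    proof (rule integral_mono)
      show "integrable lborel (\<lambda>s. exp (- s\<^sup>2 / 2) * line_kernel \<tau> s)"
        by (rule line_kernel_swap(2)[OF \<tau>(1)])
      show "integrable lborel U"
        using int_U by (simp add: has_bochner_integral_iff)
    qed (rule bound)
    also have "\<dots> = K / \<tau> * (2 * a) + K' / \<sigma>\<^sub>0 * sqrt (2 * pi) - d * (ln \<sigma>\<^sub>0 - ln a)"
      using int_U by (simp add: has_bochner_integral_iff)
    also have "\<dots> = (2 * K / \<sigma>\<^sub>0 + K' / \<sigma>\<^sub>0 * sqrt (2 * pi) - d * (2 * ln \<sigma>\<^sub>0)) + d * ln \<tau>"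
      using \<tau> D by (simp add: a_def ln_div algebra_simps)
    finally show "(\<integral>s. exp (- s\<^sup>2 / 2) * line_kernel \<tau> s \<partial>lborel)
      \<le> (2 * K / \<sigma>\<^sub>0 + K' / \<sigma>\<^sub>0 * sqrt (2 * pi) - d * (2 * ln \<sigma>\<^sub>0)) + d * ln \<tau>" .
  qed (rule d)
qed

lemma weighted_integral_nonneg:
  assumes "\<And>\<xi>. weight_ft \<xi> \<in> \<real>\<^sub>\<ge>\<^sub>0" and "\<And>\<xi>. A \<le> norm \<xi> \<Longrightarrow> 0 \<le> slab \<xi>"
  shows "0 \<le> (\<integral>x. \<rho> x * F x \<partial>lborel)"
proof (rule ccontr)
  assume "\<not> ?thesis"
  then have "(\<integral>x. \<rho> x * F x \<partial>lborel) < 0"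
    by simp
  then obtain d \<tau>\<^sub>0 c where d: "0 < d" "0 < \<tau>\<^sub>0"
    and upper: "\<And>\<tau>. 0 < \<tau> \<Longrightarrow> \<tau> \<le> \<tau>\<^sub>0 \<Longrightarrow> (\<integral>s. exp (- s\<^sup>2 / 2) * line_kernel \<tau> s \<partial>lborel) \<le> c + d * ln \<tau>"
    by (rule line_integral_upper_bound) (rule that)
  obtain K where lower: "\<And>\<tau>. \<tau> > 0 \<Longrightarrow> - K \<le> (\<integral>s. exp (- s\<^sup>2 / 2) * line_kernel \<tau> s \<partial>lborel)"
    by (rule line_integral_lower_bound[of A]) (use assms that in auto)
  \<comment> \<open>t plays the role of ln \<tau>, with \<tau> so small that the upper bound c + d t
    is at most -K - 1, below the lower bound -K.\<close>
  define t where "t = min (ln \<tau>\<^sub>0) ((- K - c - 1) / d)"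
  have "exp t \<le> \<tau>\<^sub>0"
    using d by (metis exp_le_cancel_iff exp_ln min.cobounded1 t_def)
  then have "- K \<le> c + d * t"
    using upper[of "exp t"] lower[of "exp t"] by simp
  moreover have "d * t \<le> - K - c - 1"
    using d by (simp add: t_def min_def field_simps)
  ultimately show False by linarith
qed

end

subsection \<open>Gaussians as Schwartz test functions\<close>

text \<open>The derivative is recorded direction by direction: for fixed v it is again polynomial in
  x, as the induction over iterated partials needs.\<close>

lemma real_polynomial_function_has_derivative:
  fixes p :: "'a::real_normed_vector \<Rightarrow> real"
  assumes "real_polynomial_function p"
  obtains p' where "\<And>v. real_polynomial_function (\<lambda>x. p' x v)" "\<And>x. (p has_derivative p' x) (at x)"
proof -
  from assms have "\<exists>p'. (\<forall>v. real_polynomial_function (\<lambda>x. p' x v)) \<and> (\<forall>x. (p has_derivative p' x) (at x))"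
  proof (induction rule: real_polynomial_function.induct)
    case (linear f)
    then show ?case
      by (intro exI[of _ "\<lambda>x. f"]) (auto intro: real_polynomial_function.intros(2) bounded_linear_imp_has_derivative)
  next
    case (const c)
    then show ?case
      by (intro exI[of _ "\<lambda>x h. 0"]) (auto intro: real_polynomial_function.intros(2))
  next
    case (add f g)
    then obtain f' g' where "\<And>v. real_polynomial_function (\<lambda>x. f' x v)" "\<And>x. (f has_derivative f' x) (at x)"
      "\<And>v. real_polynomial_function (\<lambda>x. g' x v)" "\<And>x. (g has_derivative g' x) (at x)"
      by blast
    then show ?case
      by (intro exI[of _ "\<lambda>x h. f' x h + g' x h"])
         (auto intro: real_polynomial_function.intros(3) has_derivative_add)
  next
    case (mult f g)
    then obtain f' g' where "\<And>v. real_polynomial_function (\<lambda>x. f' x v)" "\<And>x. (f has_derivative f' x) (at x)"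
      "\<And>v. real_polynomial_function (\<lambda>x. g' x v)" "\<And>x. (g has_derivative g' x) (at x)"
      by blast
    with mult show ?case
      by (intro exI[of _ "\<lambda>x h. f x * g' x h + f' x h * g x"])
         (auto intro!: real_polynomial_function.intros(3) real_polynomial_function.intros(4) has_derivative_mult)
  qed
  then show thesis using that by blast
qed

lemma real_polynomial_function_bound:
  fixes p :: "'a::real_normed_vector \<Rightarrow> real"
  assumes "real_polynomial_function p"
  obtains C m where "0 \<le> C" "\<And>x. \<bar>p x\<bar> \<le> C * (1 + norm x) ^ m"
proof -
  from assms have "\<exists>C m. 0 \<le> C \<and> (\<forall>x. \<bar>p x\<bar> \<le> C * (1 + norm x) ^ m)"
  proof (induction rule: real_polynomial_function.induct)
    case (linear f)
    then obtain K where K: "0 < K" "\<And>x. norm (f x) \<le> norm x * K"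
      using bounded_linear.pos_bounded by blast
    have "\<bar>f x\<bar> \<le> K * (1 + norm x) ^ 1" for x
      using K(1) K(2)[of x] by (simp add: distrib_left mult.commute)
    then show ?case using K(1) less_imp_le by blast
  next
    case (const c)
    then show ?case by (intro exI[of _ "\<bar>c\<bar>"] exI[of _ 0]) simp
  next
    case (add f g)
    then obtain C m D k where *: "0 \<le> C" "\<And>x. \<bar>f x\<bar> \<le> C * (1 + norm x) ^ m"
      "0 \<le> D" "\<And>x. \<bar>g x\<bar> \<le> D * (1 + norm x) ^ k"
      by blast
    have "\<bar>f x + g x\<bar> \<le> (C + D) * (1 + norm x) ^ max m k" for x
    proof -
      have "(1 + norm x) ^ m \<le> (1 + norm x) ^ max m k" "(1 + norm x) ^ k \<le> (1 + norm x) ^ max m k"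
        by (auto intro!: power_increasing)
      then have "C * (1 + norm x) ^ m \<le> C * (1 + norm x) ^ max m k"
        "D * (1 + norm x) ^ k \<le> D * (1 + norm x) ^ max m k"
        using * by (auto intro!: mult_left_mono)
      then show ?thesis
        using *(2)[of x] *(4)[of x] abs_triangle_ineq[of "f x" "g x"] by (simp add: distrib_right)
    qed
    then show ?case using * by (intro exI[of _ "C + D"] exI[of _ "max m k"]) auto
  next
    case (mult f g)
    then obtain C m D k where *: "0 \<le> C" "\<And>x. \<bar>f x\<bar> \<le> C * (1 + norm x) ^ m"
      "0 \<le> D" "\<And>x. \<bar>g x\<bar> \<le> D * (1 + norm x) ^ k"
      by blast
    have "\<bar>f x * g x\<bar> \<le> (C * D) * (1 + norm x) ^ (m + k)" for x
      using mult_mono[OF *(2)[of x] *(4)[of x]] * by (simp add: abs_mult power_add mult_ac)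
    then show ?case using * by (intro exI[of _ "C * D"] exI[of _ "m + k"]) auto
  qed
  then show thesis using that by blast
qed

text \<open>With r = |x - a|: 1 + |x| \<le> (1 + |a|) (1 + r), then 1 + r \<le> e^r, and m r - r^2 /
  2 \<le> m^2 / 2 by completing the square.\<close>

lemma polynomial_gaussian_bounded:
  fixes a :: "'a::real_normed_vector"
  shows "(1 + norm x) ^ m * exp (- (norm (x - a))\<^sup>2 / 2) \<le> (1 + norm a) ^ m * exp ((real m)\<^sup>2 / 2)"
proof -
  define r where "r = norm (x - a)"
  have "1 + norm x \<le> (1 + norm a) * (1 + r)"
  proof -
    have "norm x \<le> r + norm a"
      unfolding r_def using norm_triangle_ineq[of "x - a" a] by simp
    moreover have "0 \<le> norm a * r" by (simp add: r_def)
    ultimately show ?thesis by (simp add: algebra_simps)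
  qed
  then have "(1 + norm x) ^ m \<le> ((1 + norm a) * (1 + r)) ^ m"
    by (intro power_mono) auto
  also have "\<dots> = (1 + norm a) ^ m * (1 + r) ^ m"
    by (rule power_mult_distrib)
  also have "\<dots> \<le> (1 + norm a) ^ m * exp r ^ m"
    by (intro mult_left_mono power_mono) (auto simp: r_def)
  also have "exp r ^ m = exp (real m * r)"
    by (rule exp_of_nat_mult[symmetric])
  finally have "(1 + norm x) ^ m * exp (- r\<^sup>2 / 2) \<le> (1 + norm a) ^ m * exp (real m * r) * exp (- r\<^sup>2 / 2)"
    by (rule mult_right_mono) simp
  also have "\<dots> = (1 + norm a) ^ m * exp (real m * r + - r\<^sup>2 / 2)"
    unfolding exp_add by (simp only: mult_ac)
  also have "\<dots> \<le> (1 + norm a) ^ m * exp ((real m)\<^sup>2 / 2)"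
  proof (intro mult_left_mono iffD2[OF exp_le_cancel_iff])
    show "real m * r + - r\<^sup>2 / 2 \<le> (real m)\<^sup>2 / 2"
      using zero_le_power2[of "r - real m"] by (simp add: power2_diff field_simps)
  qed simp
  finally show ?thesis by (simp add: r_def)
qed

lemma gaussian_has_derivative:
  fixes a :: "'a::euclidean_space"
  shows "((\<lambda>x. exp (- (norm (x - a))\<^sup>2 / 2)) has_derivative
    (\<lambda>h. - ((x - a) \<bullet> h) * exp (- (norm (x - a))\<^sup>2 / 2))) (at x)"
  unfolding power2_norm_eq_inner
  by (auto intro!: derivative_eq_intros simp: inner_commute)

text \<open>Differentiating a polynomial times the Gaussian gives another such product. The
  polynomials are of Hermite type, but only their existence is kept.\<close>

lemma partials_gaussian:
  fixes a :: "'a::euclidean_space"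
  obtains p where "real_polynomial_function p"
    "partials vs (\<lambda>x. of_real (exp (- (norm (x - a))\<^sup>2 / 2)))
      = (\<lambda>x. of_real (p x * exp (- (norm (x - a))\<^sup>2 / 2)))"
proof -
  let ?g = "\<lambda>x. exp (- (norm (x - a))\<^sup>2 / 2)"
  have "\<exists>p. real_polynomial_function p \<and> partials vs (\<lambda>x. of_real (?g x)) = (\<lambda>x. of_real (p x * ?g x))"
  proof (induction vs)
    case Nil
    then show ?case by (intro exI[of _ "\<lambda>x. 1"]) (auto intro: real_polynomial_function.intros(2))
  next
    case (Cons v vs)
    then obtain p where p: "real_polynomial_function p"
      "partials vs (\<lambda>x. of_real (?g x)) = (\<lambda>x. of_real (p x * ?g x))" by blast
    obtain p' where p': "\<And>v. real_polynomial_function (\<lambda>x. p' x v)" "\<And>x. (p has_derivative p' x) (at x)"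
      using real_polynomial_function_has_derivative[OF p(1)] by blast
    have "((\<lambda>x. complex_of_real (p x * ?g x)) has_derivative
       (\<lambda>h. of_real (p x * (- ((x - a) \<bullet> h) * ?g x) + p' x h * ?g x))) (at x)" for x
      by (intro has_derivative_of_real has_derivative_mult p' gaussian_has_derivative)
    from fun_cong[OF frechet_derivative_at[OF this]]
    have fr: "frechet_derivative (\<lambda>x. complex_of_real (p x * ?g x)) (at x) v
        = of_real (p x * (- ((x - a) \<bullet> v) * ?g x) + p' x v * ?g x)" for x
      by (rule sym)
    have "p x * (- ((x - a) \<bullet> v) * ?g x) + p' x v * ?g x = (p x * (a \<bullet> v - x \<bullet> v) + p' x v) * ?g x" for x
      by (simp add: inner_diff_left algebra_simps)
    then have "partials (v # vs) (\<lambda>x. of_real (?g x))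
        = (\<lambda>x. of_real ((p x * (a \<bullet> v - x \<bullet> v) + p' x v) * ?g x))"
      by (simp only: partials.simps p(2) fr)
    moreover have "real_polynomial_function (\<lambda>x. p x * (a \<bullet> v - x \<bullet> v) + p' x v)"
      by (intro real_polynomial_function.intros(3) real_polynomial_function.intros(4) p p'
          real_polynomial_function_diff real_polynomial_function.intros(2)
          real_polynomial_function.intros(1) bounded_linear_inner_left)
    ultimately show ?case by blast
  qed
  then show thesis using that by blast
qed

lemma schwartz_gaussian:
  fixes a :: "'a::euclidean_space"
  shows "schwartz (\<lambda>x. of_real (exp (- (norm (x - a))\<^sup>2 / 2)))"
  unfolding schwartz_def
proof (intro allI impI conjI)
  let ?g = "\<lambda>x. exp (- (norm (x - a))\<^sup>2 / 2)"
  fix vs :: "'a list"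
  obtain p where p: "real_polynomial_function p"
    "partials vs (\<lambda>x. of_real (?g x)) = (\<lambda>x. of_real (p x * ?g x))"
    using partials_gaussian by blast
  obtain p' where p': "\<And>x. (p has_derivative p' x) (at x)"
    using real_polynomial_function_has_derivative[OF p(1)] by blast
  show "partials vs (\<lambda>x. of_real (?g x)) differentiable (at x)" for x
    unfolding p(2)
    by (rule differentiableI, rule has_derivative_of_real, rule has_derivative_mult)
       (rule p' gaussian_has_derivative)+
  fix k
  obtain C m where C: "0 \<le> C" "\<And>x. \<bar>p x\<bar> \<le> C * (1 + norm x) ^ m"
    using real_polynomial_function_bound[OF p(1)] by blast
  have "norm ((norm x ^ k) *\<^sub>R complex_of_real (p x * ?g x))
      \<le> C * ((1 + norm a) ^ (k + m) * exp ((real (k + m))\<^sup>2 / 2))" for x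
  proof -
    have "norm ((norm x ^ k) *\<^sub>R complex_of_real (p x * ?g x)) = norm x ^ k * (\<bar>p x\<bar> * ?g x)"
      by (simp add: norm_mult norm_power)
    also have "\<dots> \<le> (1 + norm x) ^ k * (C * (1 + norm x) ^ m * ?g x)"
      using C by (intro mult_mono mult_right_mono power_mono) auto
    also have "\<dots> = C * ((1 + norm x) ^ (k + m) * ?g x)"
      by (simp add: power_add mult_ac)
    also have "\<dots> \<le> C * ((1 + norm a) ^ (k + m) * exp ((real (k + m))\<^sup>2 / 2))"
      using C by (intro mult_left_mono polynomial_gaussian_bounded)
    finally show ?thesis .
  qed
  then show "bounded (range (\<lambda>x. (norm x ^ k) *\<^sub>R partials vs (\<lambda>x. of_real (?g x)) x))"
    unfolding p(2) by (intro boundedI) auto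
qed

lemma fourier_gaussian:
  fixes a :: "'a::euclidean_space"
  shows "fourier (\<lambda>x. of_real (exp (- (norm (x - a))\<^sup>2 / 2))) \<xi>
    = of_real (sqrt (2 * pi) ^ DIM('a)) * (of_real (exp (- (norm \<xi>)\<^sup>2 / 2)) * iexp (- (a \<bullet> \<xi>)))"
proof -
  have shift: "exp (- \<i> * of_real ((a + 1 *\<^sub>R x) \<bullet> \<xi>)) = iexp (- (a \<bullet> \<xi>)) * iexp ((- \<xi>) \<bullet> x)" for x
    by (simp add: exp_add[symmetric] algebra_simps inner_add_left inner_commute)
  have "fourier (\<lambda>x. of_real (exp (- (norm (x - a))\<^sup>2 / 2))) \<xi>
      = (\<integral>x. of_real (exp (- (norm (a + 1 *\<^sub>R x - a))\<^sup>2 / 2)) * exp (- \<i> * of_real ((a + 1 *\<^sub>R x) \<bullet> \<xi>)) \<partial>lborel)"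
    unfolding fourier_def by (subst integral_lborel_affine[of _ 1 a]) auto
  also have "\<dots> = (\<integral>x. iexp (- (a \<bullet> \<xi>)) * (of_real (exp (- (norm x)\<^sup>2 / 2)) * iexp ((- \<xi>) \<bullet> x)) \<partial>lborel)"
    unfolding shift by (simp only: scaleR_one add_diff_cancel_left' mult.left_commute)
  also have "\<dots> = iexp (- (a \<bullet> \<xi>)) * of_real (sqrt (2 * pi) ^ DIM('a) * exp (- (norm (- \<xi>))\<^sup>2 / 2))"
    unfolding integral_mult_right_zero integral_gaussian_iexp ..
  finally show ?thesis by (simp only: norm_minus_cancel of_real_mult mult_ac)
qed

text \<open>The Fourier transform of a Gaussian centred at \<xi> is the centred Gaussian times a
  character of frequency \<xi>. Pairing the transform of f with this nonnegative test function
  therefore gives, up to a positive constant, the transform of the damped f at the single point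
  \<xi>.\<close>

lemma positive_definite_gaussian_transform:
  fixes f :: "'a::euclidean_space \<Rightarrow> real"
  assumes "positive_definite_distribution (distribution_of f)"
  shows "(\<integral>x. of_real (f x * exp (- (norm x)\<^sup>2 / 2)) * iexp (- (\<xi> \<bullet> x)) \<partial>lborel) \<in> \<real>\<^sub>\<ge>\<^sub>0"
proof -
  let ?c = "sqrt (2 * pi) ^ DIM('a)"
  let ?I = "\<integral>x. of_real (f x * exp (- (norm x)\<^sup>2 / 2)) * iexp (- (\<xi> \<bullet> x)) \<partial>lborel"
  have "fourier_distribution (distribution_of f) (\<lambda>x. of_real (exp (- (norm (x - \<xi>))\<^sup>2 / 2))) \<in> \<real>\<^sub>\<ge>\<^sub>0"
    using assms schwartz_gaussian[of \<xi>] unfolding positive_definite_distribution_def by auto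
  also have "fourier_distribution (distribution_of f) (\<lambda>x. of_real (exp (- (norm (x - \<xi>))\<^sup>2 / 2)))
     = (\<integral>x. of_real ?c * (of_real (f x * exp (- (norm x)\<^sup>2 / 2)) * iexp (- (\<xi> \<bullet> x))) \<partial>lborel)"
    unfolding fourier_distribution_def distribution_of_def fourier_gaussian
    by (simp only: of_real_mult mult_ac)
  also have "\<dots> = of_real ?c * ?I"
    by (rule integral_mult_right_zero)
  finally have "of_real (inverse ?c) * (of_real ?c * ?I) \<in> \<real>\<^sub>\<ge>\<^sub>0"
    by (rule nonneg_Reals_mult_I[rotated]) simp
  moreover have "of_real (inverse ?c) * (of_real ?c * ?I) = ?I"
    by (simp del: of_real_mult)
  ultimately show ?thesis by (simp only:)
qed

subsection \<open>Lebesgue measure on hyperplanes\<close>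

lemma nn_integral_lborel_translate:
  fixes f :: "'a::euclidean_space \<Rightarrow> ennreal"
  assumes [measurable]: "f \<in> borel_measurable borel"
  shows "(\<integral>\<^sup>+x. f (a + x) \<partial>lborel) = (\<integral>\<^sup>+x. f x \<partial>lborel)"
  by (subst (2) lborel_distr_plus[of a, symmetric]) (simp add: nn_integral_distr)

text \<open>Uniqueness of Haar measure, specialised: integrating \<open>f (T x) g (y - T x)\<close> over \<open>x\<close> and \<open>y\<close>,
  where \<open>g\<close> is the indicator of the unit ball, in both orders.\<close>

lemma nn_integral_orthogonal_transformation:
  fixes T :: "'a::euclidean_space \<Rightarrow> 'a"
  assumes T: "orthogonal_transformation T" and f[measurable]: "f \<in> borel_measurable borel"
  shows "(\<integral>\<^sup>+x. f (T x) \<partial>lborel) = (\<integral>\<^sup>+x. f x \<partial>lborel)"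
proof -
  define g :: "'a \<Rightarrow> ennreal" where "g = indicator (ball 0 1)"
  have [measurable]: "g \<in> borel_measurable borel"
    unfolding g_def by (intro borel_measurable_indicator) simp
  have lin: "linear T"
    using T by (rule orthogonal_transformation_linear)
  have [measurable]: "T \<in> borel_measurable borel"
    using lin by (intro borel_measurable_continuous_onI linear_continuous_on linear_conv_bounded_linear[THEN iffD1])
  define V where "V = (\<integral>\<^sup>+y. g y \<partial>lborel)"
  have V: "V \<noteq> 0" "V \<noteq> \<infinity>"
    using emeasure_lborel_ball_finite[of "0::'a" 1] content_ball_pos[of 1 "0::'a"]
    by (auto simp: V_def g_def measure_def)
  have g_T: "g (- T x) = g x" for x
    using orthogonal_transformation_norm[OF T, of x] by (simp add: g_def indicator_def)
  have "(\<integral>\<^sup>+x. f (T x) \<partial>lborel) * V = (\<integral>\<^sup>+x. f (T x) * V \<partial>lborel)"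
    by (simp add: nn_integral_multc)
  also have "\<dots> = (\<integral>\<^sup>+x. \<integral>\<^sup>+y. f (T x) * g (- T x + y) \<partial>lborel \<partial>lborel)"
  proof (rule nn_integral_cong)
    fix x
    have "(\<integral>\<^sup>+y. f (T x) * g (- T x + y) \<partial>lborel) = f (T x) * (\<integral>\<^sup>+y. g (- T x + y) \<partial>lborel)"
      by (rule nn_integral_cmult) measurable
    also have "(\<integral>\<^sup>+y. g (- T x + y) \<partial>lborel) = V"
      unfolding V_def by (rule nn_integral_lborel_translate) measurable
    finally show "f (T x) * V = (\<integral>\<^sup>+y. f (T x) * g (- T x + y) \<partial>lborel)" ..
  qed
  also have "\<dots> = (\<integral>\<^sup>+y. \<integral>\<^sup>+x. f (T x) * g (- T x + y) \<partial>lborel \<partial>lborel)"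
    by (rule lborel_pair.Fubini'[symmetric]) measurable
  \<comment> \<open>With y = T z, translating x by z moves y from the argument of g to that of
    f.\<close>
  also have "\<dots> = (\<integral>\<^sup>+y. \<integral>\<^sup>+x. f (T x + y) * g (- T x) \<partial>lborel \<partial>lborel)"
  proof (rule nn_integral_cong)
    fix y
    obtain z where z: "y = T z"
      using orthogonal_transformation_surj[OF T] by (metis surjD)
    have "(\<integral>\<^sup>+x. f (T x) * g (- T x + y) \<partial>lborel) = (\<integral>\<^sup>+x. f (T (z + x)) * g (- T (z + x) + y) \<partial>lborel)"
      by (rule nn_integral_lborel_translate[symmetric]) measurable
    then show "(\<integral>\<^sup>+x. f (T x) * g (- T x + y) \<partial>lborel) = (\<integral>\<^sup>+x. f (T x + y) * g (- T x) \<partial>lborel)"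
      by (simp add: z linear_add[OF lin] add.commute)
  qed
  also have "\<dots> = (\<integral>\<^sup>+x. \<integral>\<^sup>+y. f (T x + y) * g (- T x) \<partial>lborel \<partial>lborel)"
    by (rule lborel_pair.Fubini') measurable
  also have "\<dots> = (\<integral>\<^sup>+x. (\<integral>\<^sup>+y. f y \<partial>lborel) * g x \<partial>lborel)"
    by (simp add: nn_integral_multc nn_integral_lborel_translate g_T)
  also have "\<dots> = (\<integral>\<^sup>+y. f y \<partial>lborel) * V"
    by (simp add: nn_integral_cmult V_def)
  finally show ?thesis
    using V unfolding mult.commute[of _ V] ennreal_mult_cancel_left by auto
qed

lemma lborel_distr_orthogonal_transformation:
  fixes T :: "'a::euclidean_space \<Rightarrow> 'a"
  assumes T: "orthogonal_transformation T"
  shows "distr lborel borel T = lborel"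
proof (rule measure_eqI)
  have T_meas: "T \<in> borel_measurable borel"
    using orthogonal_transformation_linear[OF T]
    by (intro borel_measurable_continuous_onI linear_continuous_on linear_conv_bounded_linear[THEN iffD1])
  fix A assume "A \<in> sets (distr lborel borel T)"
  then have A: "A \<in> sets borel" by simp
  have "emeasure (distr lborel borel T) A = (\<integral>\<^sup>+x. indicator A x \<partial>distr lborel borel T)"
    using A by simp
  also have "\<dots> = (\<integral>\<^sup>+x. indicator A (T x) \<partial>lborel)"
    using A T_meas by (intro nn_integral_distr) auto
  also have "\<dots> = (\<integral>\<^sup>+x. indicator A x \<partial>lborel)"
    using A by (intro nn_integral_orthogonal_transformation[OF T]) auto
  finally show "emeasure (distr lborel borel T) A = emeasure lborel A"
    using A by simp
qed simp

section \<open>Orthonormal coordinates on the whole space and on a hyperplane\<close>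

text \<open>Coordinates are indexed by the basis vectors themselves, so passing from one basis to
  another changes the index set of the product measure.\<close>

lemma distr_PiM_lborel_reindex:
  assumes f: "bij_betw f I J" and I: "finite I"
  shows "(\<Pi>\<^sub>M j\<in>J. lborel :: real measure)
    = distr (\<Pi>\<^sub>M i\<in>I. lborel) (\<Pi>\<^sub>M j\<in>J. lborel) (\<lambda>t. \<lambda>j\<in>J. t (the_inv_into I f j))"
proof -
  let ?g = "the_inv_into I f"
  have g: "bij_betw ?g J I"
    by (rule bij_betw_the_inv_into[OF f])
  have J: "finite J"
    using I f bij_betw_finite by blast
  interpret I: product_sigma_finite "\<lambda>_. lborel :: real measure" by standard
  have meas: "(\<lambda>t. \<lambda>j\<in>J. t (?g j)) \<in> (\<Pi>\<^sub>M i\<in>I. lborel) \<rightarrow>\<^sub>M (\<Pi>\<^sub>M j\<in>J. lborel)"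
    using bij_betwE[OF g] by (intro measurable_restrict measurable_component_singleton) auto
  show ?thesis
  proof (rule I.PiM_eqI[symmetric, OF J])
    fix A :: "'b \<Rightarrow> real set" assume A: "\<And>j. j \<in> J \<Longrightarrow> A j \<in> sets lborel"
    have "(\<lambda>t. \<lambda>j\<in>J. t (?g j)) -` Pi\<^sub>E J A \<inter> space (\<Pi>\<^sub>M i\<in>I. lborel :: real measure) = Pi\<^sub>E I (\<lambda>i. A (f i))"
    proof -
      have "(\<lambda>j\<in>J. t (?g j)) \<in> Pi\<^sub>E J A \<longleftrightarrow> (\<forall>i\<in>I. t i \<in> A (f i))" for t :: "'a \<Rightarrow> real"
        using bij_betwE[OF f] bij_betwE[OF g] the_inv_into_f_f[of f I] f_the_inv_into_f_bij_betw[OF f] f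
        by (auto simp: PiE_iff bij_betw_def)
      then show ?thesis
        by (auto simp: space_PiM PiE_iff)
    qed
    then have "emeasure (distr (\<Pi>\<^sub>M i\<in>I. lborel) (\<Pi>\<^sub>M j\<in>J. lborel) (\<lambda>t. \<lambda>j\<in>J. t (?g j))) (Pi\<^sub>E J A)
       = emeasure (\<Pi>\<^sub>M i\<in>I. lborel :: real measure) (Pi\<^sub>E I (\<lambda>i. A (f i)))"
      using A J by (subst emeasure_distr[OF meas]) (auto intro!: sets_PiM_I_finite)
    also have "\<dots> = (\<Prod>i\<in>I. emeasure lborel (A (f i)))"
      using A I bij_betwE[OF f] by (subst I.emeasure_PiM) auto
    also have "\<dots> = (\<Prod>j\<in>J. emeasure lborel (A j))"
      by (rule prod.reindex_bij_betw[OF f])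
    finally show "emeasure (distr (\<Pi>\<^sub>M i\<in>I. lborel) (\<Pi>\<^sub>M j\<in>J. lborel) (\<lambda>t. \<lambda>j\<in>J. t (?g j))) (Pi\<^sub>E J A)
       = (\<Prod>j\<in>J. emeasure lborel (A j))" .
  qed simp
qed

lemma orthonormal_basis_of_finite:
  assumes "orthonormal_basis_of S B"
  shows "finite B" "independent B"
proof -
  have "0 \<notin> B"
    using assms by (auto simp: orthonormal_basis_of_def)
  then show "independent B"
    using assms pairwise_orthogonal_independent by (auto simp: orthonormal_basis_of_def)
  then show "finite B"
    by (rule independent_imp_finite)
qed

lemma lborel_eq_orthonormal_coordinates:
  fixes B :: "'a::euclidean_space set"
  assumes B: "orthonormal_basis_of UNIV B"
  shows "lborel = distr (\<Pi>\<^sub>M b\<in>B. lborel) borel (\<lambda>t. \<Sum>b\<in>B. t b *\<^sub>R b)"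
proof -
  have fin: "finite B" and "independent B"
    using orthonormal_basis_of_finite[OF B] by auto
  have "card B = card (Basis :: 'a set)"
    using basis_card_eq_dim[of B UNIV] B \<open>independent B\<close> by (simp add: orthonormal_basis_of_def)
  then obtain f where f: "bij_betw f (Basis :: 'a set) B"
    using finite_same_card_bij[OF finite_Basis fin] by metis
  define T where "T x = (\<Sum>e\<in>Basis. (x \<bullet> e) *\<^sub>R f e)" for x :: "'a"
  have fB: "e \<in> Basis \<Longrightarrow> f e \<in> B" for e
    using f by (auto simp: bij_betw_def)
  have inner_f: "f e \<bullet> f e' = (if e = e' then 1 else 0)" if "e \<in> Basis" "e' \<in> Basis" for e e'
  proof (cases "e = e'")
    case True
    then show ?thesis
      using B fB[OF that(1)] by (simp add: orthonormal_basis_of_def dot_square_norm)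
  next
    case False
    then have "f e \<noteq> f e'"
      using f that by (auto simp: bij_betw_def inj_on_def)
    then show ?thesis
      using B fB that False by (auto simp: orthonormal_basis_of_def pairwise_def orthogonal_def)
  qed
  have lin: "linear T"
    unfolding T_def by (intro linearI) (auto simp: inner_add_left scaleR_add_left sum.distrib scaleR_right.sum)
  have "T x \<bullet> T y = x \<bullet> y" for x y
  proof -
    have "T x \<bullet> T y = (\<Sum>e\<in>Basis. \<Sum>e'\<in>Basis. (x \<bullet> e) * ((y \<bullet> e') * (f e \<bullet> f e')))"
      unfolding T_def inner_sum_left by (simp add: inner_sum_right sum_distrib_left mult_ac)
    also have "\<dots> = (\<Sum>e\<in>Basis. (x \<bullet> e) * (y \<bullet> e))"
      by (intro sum.cong refl) (simp add: inner_f if_distrib sum.delta cong: if_cong)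
    finally show ?thesis by (simp add: euclidean_inner[of x y])
  qed
  then have orth: "orthogonal_transformation T"
    using lin by (simp add: orthogonal_transformation_def)
  have [measurable]: "T \<in> borel_measurable borel"
    unfolding T_def by measurable
  let ?g = "the_inv_into Basis f"
  have "distr (\<Pi>\<^sub>M b\<in>B. lborel) borel (\<lambda>t. \<Sum>b\<in>B. t b *\<^sub>R b)
      = distr (\<Pi>\<^sub>M e\<in>Basis. lborel) borel ((\<lambda>t. \<Sum>b\<in>B. t b *\<^sub>R b) \<circ> (\<lambda>t. \<lambda>b\<in>B. t (?g b)))"
  proof (subst distr_PiM_lborel_reindex[OF f finite_Basis], rule distr_distr)
    show "(\<lambda>t. \<lambda>b\<in>B. t (?g b)) \<in> (\<Pi>\<^sub>M e\<in>Basis. lborel) \<rightarrow>\<^sub>M (\<Pi>\<^sub>M b\<in>B. lborel :: real measure)"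
      using bij_betwE[OF bij_betw_the_inv_into[OF f]] by (intro measurable_restrict measurable_component_singleton) auto
  qed measurable
  also have "(\<lambda>t. \<Sum>b\<in>B. t b *\<^sub>R b) \<circ> (\<lambda>t. \<lambda>b\<in>B. t (?g b)) = (\<lambda>t. T (\<Sum>e\<in>Basis. t e *\<^sub>R e))"
  proof
    fix t :: "'a \<Rightarrow> real"
    have "(\<Sum>b\<in>B. t (?g b) *\<^sub>R b) = (\<Sum>e\<in>Basis. t (?g (f e)) *\<^sub>R f e)"
      by (rule sum.reindex_bij_betw[OF f, symmetric])
    also have "\<dots> = (\<Sum>e\<in>Basis. t e *\<^sub>R f e)"
      using f by (intro sum.cong refl) (simp add: bij_betw_def the_inv_into_f_f)
    also have "\<dots> = T (\<Sum>e\<in>Basis. t e *\<^sub>R e)"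
      unfolding T_def by (intro sum.cong refl) simp
    finally show "((\<lambda>t. \<Sum>b\<in>B. t b *\<^sub>R b) \<circ> (\<lambda>t. \<lambda>b\<in>B. t (?g b))) t = T (\<Sum>e\<in>Basis. t e *\<^sub>R e)"
      by simp
  qed
  also have "distr (\<Pi>\<^sub>M e\<in>Basis. lborel) borel (\<lambda>t. T (\<Sum>e\<in>Basis. t e *\<^sub>R e)) = distr lborel borel T"
    by (subst (2) lborel_eq, subst distr_distr) (auto simp: comp_def)
  also have "\<dots> = lborel"
    by (rule lborel_distr_orthogonal_transformation[OF orth])
  finally show ?thesis ..
qed

text \<open>Prepares Fubini with n - 1 coordinates along the hyperplane and one across it.\<close>

lemma orthonormal_basis_of_insert_normal:
  fixes \<xi> :: "'a::euclidean_space"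
  assumes B: "orthonormal_basis_of ({\<xi>}\<^sup>\<bottom>) B" and \<xi>: "norm \<xi> = 1"
  shows "orthonormal_basis_of UNIV (insert \<xi> B)" "\<xi> \<notin> B" "\<And>b. b \<in> B \<Longrightarrow> b \<bullet> \<xi> = 0"
proof -
  show orth: "b \<bullet> \<xi> = 0" if "b \<in> B" for b
    using that B by (auto simp: orthonormal_basis_of_def orthogonal_comp_def orthogonal_def inner_commute)
  have \<xi>\<xi>: "\<xi> \<bullet> \<xi> = 1"
    using \<xi> by (simp add: dot_square_norm)
  then show "\<xi> \<notin> B"
    using orth by force
  have "x \<in> span (insert \<xi> B)" for x
  proof -
    have "x - (x \<bullet> \<xi>) *\<^sub>R \<xi> \<in> {\<xi>}\<^sup>\<bottom>"
      by (simp add: orthogonal_comp_def orthogonal_def inner_diff_right \<xi>\<xi> inner_commute)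
    then have "x - (x \<bullet> \<xi>) *\<^sub>R \<xi> \<in> span B"
      using B by (simp add: orthonormal_basis_of_def)
    then show ?thesis
      by (auto simp: span_insert)
  qed
  then show "orthonormal_basis_of UNIV (insert \<xi> B)"
    using B \<xi> orth by (auto simp: orthonormal_basis_of_def pairwise_insert orthogonal_def inner_commute)
qed

lemma lborel_subspace_coordinates:
  fixes S :: "'a::euclidean_space set"
  assumes "subspace S"
  obtains B where "orthonormal_basis_of S B"
    "lborel_subspace S = distr (\<Pi>\<^sub>M b\<in>B. lborel) borel (\<lambda>t. \<Sum>b\<in>B. t b *\<^sub>R b)"
  using someI_ex[OF orthonormal_basis_of_exists[OF assms]] that
  unfolding lborel_subspace_def Let_def by metis

text \<open>B is arbitrary, so that it can be instantiated with the basis chosen inside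
  \<open>lborel_subspace\<close>; the map \<open>pt\<close> below then pushes the product measure
  forward to the hyperplane measure.\<close>

locale hyperplane_coordinates =
  fixes \<xi> :: "'a::euclidean_space" and B :: "'a set"
  assumes norm_normal: "norm \<xi> = 1" and basis: "orthonormal_basis_of ({\<xi>}\<^sup>\<bottom>) B"
begin

definition pt :: "('a \<Rightarrow> real) \<Rightarrow> 'a" where
  "pt t = (\<Sum>b\<in>B. t b *\<^sub>R b)"

abbreviation MB :: "('a \<Rightarrow> real) measure" where
  "MB \<equiv> \<Pi>\<^sub>M b\<in>B. lborel"

sublocale product_sigma_finite "\<lambda>_::'a. lborel :: real measure"
  by standard

lemma finite_B: "finite B"
  by (rule orthonormal_basis_of_finite[OF basis])

sublocale finite_product_sigma_finite "\<lambda>_::'a. lborel :: real measure" B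
  by standard (rule finite_B)

lemma measurable_pt[measurable]: "pt \<in> MB \<rightarrow>\<^sub>M borel"
  unfolding pt_def by measurable

lemma pt_inner_normal[simp]: "pt t \<bullet> \<xi> = 0"
  unfolding pt_def inner_sum_left
  by (intro sum.neutral) (simp add: orthonormal_basis_of_insert_normal(3)[OF basis norm_normal])

lemma norm_pt_add: "(norm (pt t + s *\<^sub>R \<xi>))\<^sup>2 = (norm (pt t))\<^sup>2 + s\<^sup>2"
proof -
  have "orthogonal (pt t) (s *\<^sub>R \<xi>)"
    by (simp add: orthogonal_def)
  from norm_add_Pythagorean[OF this] show ?thesis
    using norm_normal by simp
qed

lemma norm_pt_le: "norm (pt t) \<le> norm (pt t + s *\<^sub>R \<xi>)"
  by (rule power2_le_imp_le) (simp_all add: norm_pt_add)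

lemma lborel_eq_coordinates:
  "lborel = distr (\<Pi>\<^sub>M b\<in>insert \<xi> B. lborel) borel (\<lambda>t. pt t + t \<xi> *\<^sub>R \<xi>)"
proof -
  have "(\<Sum>b\<in>insert \<xi> B. t b *\<^sub>R b) = pt t + t \<xi> *\<^sub>R \<xi>" for t
    using orthonormal_basis_of_insert_normal(2)[OF basis norm_normal] finite_B
    by (simp add: pt_def add.commute)
  then show ?thesis
    using lborel_eq_orthonormal_coordinates[OF orthonormal_basis_of_insert_normal(1)[OF basis norm_normal]]
    by (simp only:)
qed

lemma measurable_insert_coordinates[measurable]:
  "(\<lambda>t. pt t + t \<xi> *\<^sub>R \<xi>) \<in> (\<Pi>\<^sub>M b\<in>insert \<xi> B. lborel) \<rightarrow>\<^sub>M borel"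
  unfolding pt_def by measurable

lemma pt_upd: "pt (t(\<xi> := s)) = pt t"
  using orthonormal_basis_of_insert_normal(2)[OF basis norm_normal]
  unfolding pt_def by (intro sum.cong) auto

lemma nn_integral_lborel_coordinates:
  assumes [measurable]: "f \<in> borel_measurable borel"
  shows "(\<integral>\<^sup>+x. f x \<partial>lborel) = (\<integral>\<^sup>+t. \<integral>\<^sup>+s. f (pt t + s *\<^sub>R \<xi>) \<partial>lborel \<partial>MB)"
proof -
  have "(\<integral>\<^sup>+x. f x \<partial>lborel) = (\<integral>\<^sup>+t. f (pt t + t \<xi> *\<^sub>R \<xi>) \<partial>(\<Pi>\<^sub>M b\<in>insert \<xi> B. lborel))"
    unfolding lborel_eq_coordinates by (rule nn_integral_distr) measurable
  also have "\<dots> = (\<integral>\<^sup>+t. \<integral>\<^sup>+s. f (pt (t(\<xi> := s)) + (t(\<xi> := s)) \<xi> *\<^sub>R \<xi>) \<partial>lborel \<partial>MB)"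
    using finite_B orthonormal_basis_of_insert_normal(2)[OF basis norm_normal]
    by (rule product_nn_integral_insert) measurable
  finally show ?thesis
    by (simp add: pt_upd)
qed

lemma integral_lborel_coordinates:
  fixes f :: "'a \<Rightarrow> real"
  assumes f: "integrable lborel f"
  shows "(\<integral>x. f x \<partial>lborel) = (\<integral>t. \<integral>s. f (pt t + s *\<^sub>R \<xi>) \<partial>lborel \<partial>MB)"
proof -
  have [measurable]: "f \<in> borel_measurable borel"
    using f by auto
  have "integrable (\<Pi>\<^sub>M b\<in>insert \<xi> B. lborel) (\<lambda>t. f (pt t + t \<xi> *\<^sub>R \<xi>))"
    using f by (subst (asm) lborel_eq_coordinates) (simp add: integrable_distr_eq)
  then have "(\<integral>t. f (pt t + t \<xi> *\<^sub>R \<xi>) \<partial>(\<Pi>\<^sub>M b\<in>insert \<xi> B. lborel))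
      = (\<integral>t. \<integral>s. f (pt (t(\<xi> := s)) + (t(\<xi> := s)) \<xi> *\<^sub>R \<xi>) \<partial>lborel \<partial>MB)"
    by (rule product_integral_insert[OF finite_B orthonormal_basis_of_insert_normal(2)[OF basis norm_normal]])
  moreover have "(\<integral>x. f x \<partial>lborel) = (\<integral>t. f (pt t + t \<xi> *\<^sub>R \<xi>) \<partial>(\<Pi>\<^sub>M b\<in>insert \<xi> B. lborel))"
    by (subst lborel_eq_coordinates, rule integral_distr) measurable
  ultimately show ?thesis
    by (simp add: pt_upd)
qed

text \<open>The Gaussian on the whole space factors into this one and a one-dimensional one across
  the hyperplane; the product has finite integral and the second factor a positive one.\<close>

lemma integrable_gaussian_pt: "integrable MB (\<lambda>t. exp (- (norm (pt t))\<^sup>2 / 2))"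
proof (rule integrableI_nonneg)
  have gauss: "(\<integral>\<^sup>+s. ennreal (exp (- s\<^sup>2 / 2)) \<partial>lborel) = ennreal (sqrt (2 * pi))"
    using integrable_scaled_gaussian[of 1, where 'a = real] integral_scaled_gaussian[of 1, where 'a = real]
    by (subst nn_integral_eq_integral) auto
  have "(\<integral>\<^sup>+t. ennreal (exp (- (norm (pt t))\<^sup>2 / 2)) \<partial>MB) * ennreal (sqrt (2 * pi))
      = (\<integral>\<^sup>+t. ennreal (exp (- (norm (pt t))\<^sup>2 / 2)) * (\<integral>\<^sup>+s. ennreal (exp (- s\<^sup>2 / 2)) \<partial>lborel) \<partial>MB)"
    unfolding gauss by (rule nn_integral_multc[symmetric]) measurable
  also have "\<dots> = (\<integral>\<^sup>+t. \<integral>\<^sup>+s. ennreal (exp (- (norm (pt t + s *\<^sub>R \<xi>))\<^sup>2 / 2)) \<partial>lborel \<partial>MB)"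
  proof -
    have "ennreal (exp (- (norm (pt t + s *\<^sub>R \<xi>))\<^sup>2 / 2))
        = ennreal (exp (- (norm (pt t))\<^sup>2 / 2)) * ennreal (exp (- s\<^sup>2 / 2))" for t s
      unfolding norm_pt_add by (simp add: ennreal_mult[symmetric] exp_add[symmetric] field_simps)
    then show ?thesis
      by (simp only:) (intro nn_integral_cong nn_integral_cmult[symmetric], measurable)
  qed
  also have "\<dots> = (\<integral>\<^sup>+x. ennreal (exp (- (norm (x::'a))\<^sup>2 / 2)) \<partial>lborel)"
    by (rule nn_integral_lborel_coordinates[symmetric]) measurable
  also have "\<dots> < \<infinity>"
    using integrable_scaled_gaussian[of 1, where 'a = 'a] by (subst nn_integral_eq_integral) auto
  finally show "(\<integral>\<^sup>+t. ennreal (exp (- (norm (pt t))\<^sup>2 / 2)) \<partial>MB) < \<infinity>"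
    by (auto simp: ennreal_mult_less_top)
qed auto

text \<open>The slab direction u may differ from the normal \<xi> of the coordinates. Putting
  \<open>w / R - (pt t \<bullet> u) / (u \<bullet> \<xi>)\<close> for the coordinate along \<xi>
  turns the inner product with R u into \<open>(u \<bullet> \<xi>) * w\<close>; the factor R
  compensates the Jacobian 1 / R.\<close>

lemma gaussian_slab_coordinates:
  fixes F :: "'a \<Rightarrow> real"
  assumes int: "integrable lborel F" and R: "R > 0" and u: "u \<bullet> \<xi> > 0"
  shows "R * gaussian_slab F (R *\<^sub>R u) = (\<integral>t. \<integral>w. F (pt t + (w / R - (pt t \<bullet> u) / (u \<bullet> \<xi>)) *\<^sub>R \<xi>)
    * exp (- (u \<bullet> \<xi>)\<^sup>2 * w\<^sup>2 / 2) \<partial>lborel \<partial>MB)"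
proof -
  have [measurable]: "F \<in> borel_measurable borel"
    using int by auto
  have "gaussian_slab F (R *\<^sub>R u) = (\<integral>t. \<integral>s. F (pt t + s *\<^sub>R \<xi>) *
      exp (- ((pt t + s *\<^sub>R \<xi>) \<bullet> (R *\<^sub>R u))\<^sup>2 / 2) \<partial>lborel \<partial>MB)"
    unfolding gaussian_slab_def
  proof (rule integral_lborel_coordinates, rule Bochner_Integration.integrable_bound[OF int])
    show "AE x in lborel. norm (F x * exp (- (x \<bullet> (R *\<^sub>R u))\<^sup>2 / 2)) \<le> norm (F x)"
      by (intro AE_I2) (simp add: abs_mult mult_left_le)
  qed measurable
  also have "\<dots> = (\<integral>t. (1 / R) * (\<integral>w. F (pt t + (w / R - (pt t \<bullet> u) / (u \<bullet> \<xi>)) *\<^sub>R \<xi>)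
    * exp (- (u \<bullet> \<xi>)\<^sup>2 * w\<^sup>2 / 2) \<partial>lborel) \<partial>MB)"
  proof (rule Bochner_Integration.integral_cong[OF refl])
    fix t
    let ?f = "\<lambda>s. F (pt t + s *\<^sub>R \<xi>) * exp (- ((pt t + s *\<^sub>R \<xi>) \<bullet> (R *\<^sub>R u))\<^sup>2 / 2)"
    let ?c = "- (pt t \<bullet> u) / (u \<bullet> \<xi>)"
    have "(pt t + (?c + (1 / R) * w) *\<^sub>R \<xi>) \<bullet> (R *\<^sub>R u) = (u \<bullet> \<xi>) * w" for w
      using R u by (simp add: inner_add_left inner_commute[of \<xi>] field_simps)
    then have f: "?f (?c + (1 / R) * w) = F (pt t + (w / R - (pt t \<bullet> u) / (u \<bullet> \<xi>)) *\<^sub>R \<xi>)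
        * exp (- (u \<bullet> \<xi>)\<^sup>2 * w\<^sup>2 / 2)" for w
      by (simp add: power_mult_distrib)
    have "(\<integral>s. ?f s \<partial>lborel) = \<bar>1 / R\<bar> ^ DIM(real) *\<^sub>R (\<integral>w. ?f (?c + (1 / R) *\<^sub>R w) \<partial>lborel)"
      using R by (intro integral_lborel_affine) auto
    then show "(\<integral>s. ?f s \<partial>lborel) = (1 / R) * (\<integral>w. F (pt t + (w / R - (pt t \<bullet> u) / (u \<bullet> \<xi>)) *\<^sub>R \<xi>)
        * exp (- (u \<bullet> \<xi>)\<^sup>2 * w\<^sup>2 / 2) \<partial>lborel)"
      using R by (simp only: f real_scaleR_def) simp
  qed
  finally show ?thesis
    using R by simp
qed

text \<open>Dominated convergence in w and then in t. A component along \<xi> only increases the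
  norm, so F is dominated by a Gaussian in \<open>pt t\<close>, and the lower bound 1/2 keeps the
  Gaussian in w from spreading. The shift vanishes in the limit because \<open>pt t\<close> is
  orthogonal to \<xi>.\<close>

lemma gaussian_slab_tendsto_coordinates:
  fixes F :: "'a \<Rightarrow> real"
  assumes cont: "continuous_on UNIV F" and bound: "\<And>x. \<bar>F x\<bar> \<le> C * exp (- (norm x)\<^sup>2 / 2)"
    and int: "integrable lborel F"
    and R: "filterlim R at_top sequentially" "\<And>j. R j > 0"
    and u: "u \<longlonglongrightarrow> \<xi>" "\<And>j. 1 / 2 \<le> u j \<bullet> \<xi>"
  shows "(\<lambda>j. R j * gaussian_slab F (R j *\<^sub>R u j)) \<longlonglongrightarrow> sqrt (2 * pi) * (\<integral>t. F (pt t) \<partial>MB)"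
proof -
  have [measurable]: "F \<in> borel_measurable borel"
    using int by auto
  have C: "0 \<le> C"
    using order_trans[OF abs_ge_zero bound[of 0]] by simp
  have u_pos: "u j \<bullet> \<xi> > 0" for j
    using u(2)[of j] by linarith
  define G where "G j t w = F (pt t + (w / R j - (pt t \<bullet> u j) / (u j \<bullet> \<xi>)) *\<^sub>R \<xi>) * exp (- (u j \<bullet> \<xi>)\<^sup>2 * w\<^sup>2 / 2)"
    for j t w
  have eq: "R j * gaussian_slab F (R j *\<^sub>R u j) = (\<integral>t. \<integral>w. G j t w \<partial>lborel \<partial>MB)" for j
    unfolding G_def by (rule gaussian_slab_coordinates[OF int R(2) u_pos])
  have G_bound: "\<bar>G j t w\<bar> \<le> C * exp (- (norm (pt t))\<^sup>2 / 2) * exp (- (1/2)\<^sup>2 * (norm w)\<^sup>2 / 2)" for j t w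
  proof -
    let ?x = "pt t + (w / R j - (pt t \<bullet> u j) / (u j \<bullet> \<xi>)) *\<^sub>R \<xi>"
    have "(norm (pt t))\<^sup>2 \<le> (norm ?x)\<^sup>2"
      by (intro power_mono norm_pt_le) simp
    then have "C * exp (- (norm ?x)\<^sup>2 / 2) \<le> C * exp (- (norm (pt t))\<^sup>2 / 2)"
      using C by (intro mult_left_mono) auto
    then have 1: "\<bar>F ?x\<bar> \<le> C * exp (- (norm (pt t))\<^sup>2 / 2)"
      using bound[of ?x] by linarith
    have "(1/2)\<^sup>2 * (norm w)\<^sup>2 \<le> (u j \<bullet> \<xi>)\<^sup>2 * w\<^sup>2"
      unfolding real_norm_def power2_abs using u(2)[of j] by (intro mult_right_mono power_mono) auto
    then have 2: "exp (- (u j \<bullet> \<xi>)\<^sup>2 * w\<^sup>2 / 2) \<le> exp (- (1/2)\<^sup>2 * (norm w)\<^sup>2 / 2)"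
      by simp
    show ?thesis
      unfolding G_def abs_mult abs_exp_cancel using C by (intro mult_mono 1 2) auto
  qed
  have int_w: "integrable lborel (\<lambda>w::real. C * exp (- (norm (pt t))\<^sup>2 / 2) * exp (- (1/2)\<^sup>2 * (norm w)\<^sup>2 / 2))" for t
    by (intro integrable_mult_right integrable_scaled_gaussian) simp
  have lim_u: "(\<lambda>j. u j \<bullet> \<xi>) \<longlonglongrightarrow> 1"
  proof -
    have "(\<lambda>j. u j \<bullet> \<xi>) \<longlonglongrightarrow> \<xi> \<bullet> \<xi>"
      by (intro tendsto_intros u)
    then show ?thesis using norm_normal by (simp add: dot_square_norm)
  qed
  have inner_lim: "(\<lambda>j. \<integral>w. G j t w \<partial>lborel) \<longlonglongrightarrow> sqrt (2 * pi) * F (pt t)" for t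
  proof -
    have "(\<lambda>j. \<integral>w. G j t w \<partial>lborel) \<longlonglongrightarrow> (\<integral>w. F (pt t) * exp (- w\<^sup>2 / 2) \<partial>lborel)"
    proof (rule integral_dominated_convergence[OF _ _ int_w[of t]])
      show "AE w in lborel. norm (G j t w) \<le> C * exp (- (norm (pt t))\<^sup>2 / 2) * exp (- (1/2)\<^sup>2 * (norm w)\<^sup>2 / 2)" for j
        unfolding real_norm_def by (intro AE_I2 G_bound[unfolded real_norm_def])
      show "AE w in lborel. (\<lambda>j. G j t w) \<longlonglongrightarrow> F (pt t) * exp (- w\<^sup>2 / 2)"
      proof (rule AE_I2)
        fix w
        have "(\<lambda>j. w / R j) \<longlonglongrightarrow> 0"
          by (rule tendsto_divide_0[OF tendsto_const filterlim_at_top_imp_at_infinity[OF R(1)]])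
        then have "(\<lambda>j. pt t + (w / R j - (pt t \<bullet> u j) / (u j \<bullet> \<xi>)) *\<^sub>R \<xi>) \<longlonglongrightarrow> pt t + (0 - (pt t \<bullet> \<xi>) / 1) *\<^sub>R \<xi>"
          by (intro tendsto_intros u lim_u) auto
        then have "(\<lambda>j. pt t + (w / R j - (pt t \<bullet> u j) / (u j \<bullet> \<xi>)) *\<^sub>R \<xi>) \<longlonglongrightarrow> pt t"
          by simp
        then have 1: "(\<lambda>j. F (pt t + (w / R j - (pt t \<bullet> u j) / (u j \<bullet> \<xi>)) *\<^sub>R \<xi>)) \<longlonglongrightarrow> F (pt t)"
          by (intro continuous_on_tendsto_compose[OF cont]) auto
        have "(\<lambda>j. exp (- (u j \<bullet> \<xi>)\<^sup>2 * w\<^sup>2 / 2)) \<longlonglongrightarrow> exp (- 1\<^sup>2 * w\<^sup>2 / 2)"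
          by (intro tendsto_intros lim_u) auto
        then show "(\<lambda>j. G j t w) \<longlonglongrightarrow> F (pt t) * exp (- w\<^sup>2 / 2)"
          unfolding G_def using 1 by (intro tendsto_mult) auto
      qed
    qed (unfold G_def, measurable)
    also have "(\<integral>w. F (pt t) * exp (- w\<^sup>2 / 2) \<partial>lborel) = sqrt (2 * pi) * F (pt t)"
      using integral_scaled_gaussian[of 1, where 'a = real] by simp
    finally show ?thesis .
  qed
  have "(\<lambda>j. \<integral>t. \<integral>w. G j t w \<partial>lborel \<partial>MB) \<longlonglongrightarrow> (\<integral>t. sqrt (2 * pi) * F (pt t) \<partial>MB)"
  proof (rule integral_dominated_convergence)
    show "integrable MB (\<lambda>t. C * (sqrt (2 * pi) / (1 / 2)) * exp (- (norm (pt t))\<^sup>2 / 2))"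
      by (intro integrable_mult_right integrable_gaussian_pt)
    show "AE t in MB. norm (\<integral>w. G j t w \<partial>lborel) \<le> C * (sqrt (2 * pi) / (1 / 2)) * exp (- (norm (pt t))\<^sup>2 / 2)" for j
    proof (rule AE_I2)
      fix t
      have "norm (\<integral>w. G j t w \<partial>lborel) \<le> (\<integral>w. norm (G j t w) \<partial>lborel)"
        by (rule integral_norm_bound)
      also have "\<dots> \<le> (\<integral>w. C * exp (- (norm (pt t))\<^sup>2 / 2) * exp (- (1/2)\<^sup>2 * (norm (w::real))\<^sup>2 / 2) \<partial>lborel)"
        using C by (intro integral_mono' int_w) (use G_bound in auto)
      also have "\<dots> = C * exp (- (norm (pt t))\<^sup>2 / 2) * (sqrt (2 * pi) / (1 / 2)) ^ DIM(real)"
        unfolding integral_mult_right_zero by (subst integral_scaled_gaussian) simp_all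
      finally show "norm (\<integral>w. G j t w \<partial>lborel) \<le> C * (sqrt (2 * pi) / (1 / 2)) * exp (- (norm (pt t))\<^sup>2 / 2)"
        by (simp add: mult_ac)
    qed
    show "AE t in MB. (\<lambda>j. \<integral>w. G j t w \<partial>lborel) \<longlonglongrightarrow> sqrt (2 * pi) * F (pt t)"
      by (intro AE_I2 inner_lim)
  qed (unfold G_def, measurable)
  then show ?thesis
    unfolding eq by simp
qed

end

text \<open>The directions converge instead of being fixed, since a compactness argument on the
  sphere supplies only a convergent sequence of them. The bounds required in coordinates hold from
  some index on, hence the passage to a tail.\<close>

lemma gaussian_slab_tendsto:
  fixes F :: "'a::euclidean_space \<Rightarrow> real"
  assumes cont: "continuous_on UNIV F" and bound: "\<And>x. \<bar>F x\<bar> \<le> C * exp (- (norm x)\<^sup>2 / 2)"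
    and int: "integrable lborel F"
    and R: "filterlim R at_top sequentially" and u: "u \<longlonglongrightarrow> \<xi>" and \<xi>: "norm \<xi> = 1"
  shows "(\<lambda>j. R j * gaussian_slab F (R j *\<^sub>R u j)) \<longlonglongrightarrow> sqrt (2 * pi) * (\<integral>x. F x \<partial>lborel_subspace ({\<xi>}\<^sup>\<bottom>))"
    and "integrable (lborel_subspace ({\<xi>}\<^sup>\<bottom>)) F"
proof -
  obtain B where B: "orthonormal_basis_of ({\<xi>}\<^sup>\<bottom>) B"
    "lborel_subspace ({\<xi>}\<^sup>\<bottom>) = distr (\<Pi>\<^sub>M b\<in>B. lborel) borel (\<lambda>t. \<Sum>b\<in>B. t b *\<^sub>R b)"
    by (rule lborel_subspace_coordinates[OF subspace_orthogonal_comp])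
  interpret hyperplane_coordinates \<xi> B
    by standard (use \<xi> B in auto)
  have [measurable]: "F \<in> borel_measurable borel"
    using int by auto
  have subspace_eq: "lborel_subspace ({\<xi>}\<^sup>\<bottom>) = distr MB borel pt"
    unfolding B(2) pt_def[abs_def] ..
  have "integrable MB (\<lambda>t. F (pt t))"
    by (rule Bochner_Integration.integrable_bound[OF integrable_mult_right[OF integrable_gaussian_pt, of C]])
       (use order_trans[OF bound abs_ge_self] in auto)
  then show "integrable (lborel_subspace ({\<xi>}\<^sup>\<bottom>)) F"
    unfolding subspace_eq by (subst integrable_distr_eq) auto
  have "(\<lambda>j. u j \<bullet> \<xi>) \<longlonglongrightarrow> \<xi> \<bullet> \<xi>"
    by (intro tendsto_intros u)
  then have "(\<lambda>j. u j \<bullet> \<xi>) \<longlonglongrightarrow> 1"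
    using \<xi> by (simp add: dot_square_norm)
  then have "eventually (\<lambda>j. 1 / 2 < u j \<bullet> \<xi>) sequentially"
    by (rule order_tendstoD) simp
  moreover have "eventually (\<lambda>j. 0 < R j) sequentially"
    using R by (simp add: filterlim_at_top_dense)
  ultimately have "eventually (\<lambda>j. 1 / 2 < u j \<bullet> \<xi> \<and> 0 < R j) sequentially"
    by (rule eventually_conj)
  then obtain N where N: "\<And>j. N \<le> j \<Longrightarrow> 1 / 2 < u j \<bullet> \<xi> \<and> 0 < R j"
    by (auto simp: eventually_sequentially)
  have "(\<lambda>j. R (j + N) * gaussian_slab F (R (j + N) *\<^sub>R u (j + N))) \<longlonglongrightarrow> sqrt (2 * pi) * (\<integral>t. F (pt t) \<partial>MB)"
  proof (rule gaussian_slab_tendsto_coordinates[OF cont bound int])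
    show "filterlim (\<lambda>j. R (j + N)) at_top sequentially"
      using filterlim_compose[OF R filterlim_add_const_nat_at_top] .
    show "(\<lambda>j. u (j + N)) \<longlonglongrightarrow> \<xi>"
      using u by (rule LIMSEQ_ignore_initial_segment)
    show "1 / 2 \<le> u (j + N) \<bullet> \<xi>" for j
      using N[of "j + N"] by simp
    show "0 < R (j + N)" for j
      using N[of "j + N"] by simp
  qed
  then have "(\<lambda>j. R j * gaussian_slab F (R j *\<^sub>R u j)) \<longlonglongrightarrow> sqrt (2 * pi) * (\<integral>t. F (pt t) \<partial>MB)"
    by (rule LIMSEQ_offset)
  also have "(\<integral>t. F (pt t) \<partial>MB) = (\<integral>x. F x \<partial>lborel_subspace ({\<xi>}\<^sup>\<bottom>))"
    unfolding subspace_eq by (subst integral_distr) auto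
  finally show "(\<lambda>j. R j * gaussian_slab F (R j *\<^sub>R u j)) \<longlonglongrightarrow> sqrt (2 * pi) * (\<integral>x. F x \<partial>lborel_subspace ({\<xi>}\<^sup>\<bottom>))" .
qed

subsection \<open>Semicontinuous approximation\<close>

text \<open>The Pasch-Hausdorff envelope: infimal convolution of f with i times the
  distance.\<close>

definition lipschitz_minorant :: "('a::metric_space \<Rightarrow> real) \<Rightarrow> nat \<Rightarrow> 'a \<Rightarrow> real" where
  "lipschitz_minorant f i x = (INF y. f y + real i * dist x y)"

context
  fixes f :: "'a::metric_space \<Rightarrow> real"
  assumes nonneg: "\<And>x. 0 \<le> f x"
begin

lemma lipschitz_minorant_le_add: "lipschitz_minorant f i x \<le> f y + real i * dist x y"
  unfolding lipschitz_minorant_def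
  by (rule cINF_lower) (auto intro!: bdd_belowI[of _ 0] nonneg add_nonneg_nonneg)

lemma lipschitz_minorant_ge: "(\<And>y. c \<le> f y + real i * dist x y) \<Longrightarrow> c \<le> lipschitz_minorant f i x"
  unfolding lipschitz_minorant_def by (rule cINF_greatest) auto

lemma lipschitz_minorant_nonneg: "0 \<le> lipschitz_minorant f i x"
  by (rule lipschitz_minorant_ge) (simp add: nonneg)

lemma lipschitz_minorant_le: "lipschitz_minorant f i x \<le> f x"
  using lipschitz_minorant_le_add[of i x x] by simp

lemma lipschitz_minorant_mono:
  assumes "i \<le> j"
  shows "lipschitz_minorant f i x \<le> lipschitz_minorant f j x"
proof (rule lipschitz_minorant_ge)
  fix y
  have "real i * dist x y \<le> real j * dist x y"
    using assms by (intro mult_right_mono) auto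
  then show "lipschitz_minorant f i x \<le> f y + real j * dist x y"
    using lipschitz_minorant_le_add[of i x y] by linarith
qed

lemma continuous_on_lipschitz_minorant: "continuous_on UNIV (lipschitz_minorant f i)"
proof -
  have *: "lipschitz_minorant f i x \<le> lipschitz_minorant f i x' + real i * dist x x'" for x x'
  proof -
    have "lipschitz_minorant f i x - real i * dist x x' \<le> f y + real i * dist x' y" for y
      using lipschitz_minorant_le_add[of i x y] mult_left_mono[OF dist_triangle[of x y x'], of "real i"]
      by (simp add: distrib_left)
    then show ?thesis
      using lipschitz_minorant_ge[of "lipschitz_minorant f i x - real i * dist x x'" i x'] by simp
  qed
  have "(real i)-lipschitz_on UNIV (lipschitz_minorant f i)"
  proof (rule lipschitz_onI)
    show "dist (lipschitz_minorant f i x) (lipschitz_minorant f i x') \<le> real i * dist x x'" for x x'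
      using *[of x x'] *[of x' x] by (simp add: dist_real_def dist_commute abs_le_iff)
  qed simp
  then show ?thesis
    by (rule lipschitz_on_continuous_on)
qed

text \<open>For d < f x, lower semicontinuity keeps f above d near x, and away from x the penalty
  exceeds d once i is large. Levels a > 0 suffice because f is nonnegative.\<close>

lemma lipschitz_minorant_tendsto:
  assumes lsc: "\<And>a. 0 < a \<Longrightarrow> closed {x. f x \<le> a}"
  shows "(\<lambda>i. lipschitz_minorant f i x) \<longlonglongrightarrow> f x"
proof (rule order_tendstoI)
  fix c assume "f x < c"
  then show "\<forall>\<^sub>F i in sequentially. lipschitz_minorant f i x < c"
    using lipschitz_minorant_le le_less_trans by (intro always_eventually allI) blast
next
  fix c assume c: "c < f x"
  show "\<forall>\<^sub>F i in sequentially. c < lipschitz_minorant f i x"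
  proof (cases "c < 0")
    case True
    then show ?thesis
      using lipschitz_minorant_nonneg less_le_trans by (intro always_eventually allI) blast
  next
    case False
    define d where "d = (c + f x) / 2"
    have d: "0 < d" "c < d" "d < f x"
      using c False by (auto simp: d_def)
    have "open (- {y. f y \<le> d})"
      using lsc[OF d(1)] by (simp add: open_Compl)
    then obtain r where r: "r > 0" "\<And>y. dist y x < r \<Longrightarrow> d < f y"
      using d by (simp add: open_dist not_le Compl_eq) (metis mem_Collect_eq)
    obtain k :: nat where k: "d / r \<le> real k"
      using real_arch_simple by blast
    have "d \<le> lipschitz_minorant f i x" if "k \<le> i" for i
    proof (rule lipschitz_minorant_ge)
      fix y
      show "d \<le> f y + real i * dist x y"
      proof (cases "dist y x < r")
        case True
        then show ?thesis
          using r(2)[OF True] by (simp add: add_increasing2)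
      next
        case False
        have "d \<le> real k * r"
          using k r by (simp add: field_simps)
        also have "\<dots> \<le> real i * dist x y"
          using that False r by (intro mult_mono) (auto simp: dist_commute)
        finally show ?thesis
          using nonneg[of y] by simp
      qed
    qed
    then show ?thesis
      using d(2) by (auto simp: eventually_sequentially intro: less_le_trans)
  qed
qed

end

section \<open>Continuous majorants of indicators and Gaussian domination\<close>

text \<open>With \<open>Suc i\<close> even the first collar vanishes at distance 1 from a nonempty A
  and can serve as a common majorant. For empty A, \<open>infdist\<close> is 0 and every collar is
  constantly 1, hence the nonemptiness assumptions below.\<close>

definition collar :: "'a::metric_space set \<Rightarrow> nat \<Rightarrow> 'a \<Rightarrow> real" where
  "collar A i x = max 0 (1 - real (Suc i) * infdist x A)"

lemma collar_nonneg: "0 \<le> collar A i x" and collar_le_1: "collar A i x \<le> 1"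
  using infdist_nonneg[of x A] by (auto simp: collar_def)

lemma collar_eq_1: "x \<in> A \<Longrightarrow> collar A i x = 1"
  by (simp add: collar_def)

lemma continuous_on_collar: "continuous_on UNIV (collar A i)"
  unfolding collar_def by (intro continuous_intros)

lemma collar_antimono: "i \<le> j \<Longrightarrow> collar A j x \<le> collar A i x"
  using mult_right_mono[of "real (Suc i)" "real (Suc j)" "infdist x A"] infdist_nonneg[of x A]
  by (auto simp: collar_def)

lemma indicator_le_collar: "indicator A x \<le> collar A i x"
  by (auto simp: indicator_def collar_eq_1 collar_nonneg)

lemma collar_tendsto:
  assumes "closed A" "A \<noteq> {}"
  shows "(\<lambda>i. collar A i x) \<longlonglongrightarrow> indicator A x"
proof (cases "x \<in> A")
  case False
  then have pos: "infdist x A > 0"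
    using in_closed_iff_infdist_zero[OF assms] infdist_nonneg[of x A] by (metis less_eq_real_def)
  obtain k :: nat where k: "1 / infdist x A \<le> real k"
    using real_arch_simple by blast
  have "collar A i x = 0" if "k \<le> i" for i
  proof -
    have "1 \<le> real k * infdist x A"
      using k pos by (simp add: field_simps)
    also have "\<dots> \<le> real (Suc i) * infdist x A"
      using that pos by (intro mult_right_mono) auto
    finally show ?thesis by (simp add: collar_def)
  qed
  then have "eventually (\<lambda>i. collar A i x = 0) sequentially"
    by (auto simp: eventually_sequentially)
  then show ?thesis
    using False by (simp add: tendsto_eventually)
qed (simp add: collar_eq_1)

text \<open>The conditions on F in \<open>weighted_test_function\<close> with the constant hidden,
  so that they pass through linear combinations.\<close>

definition gaussian_dominated :: "('a::euclidean_space \<Rightarrow> real) \<Rightarrow> bool" where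
  "gaussian_dominated f \<longleftrightarrow>
     continuous_on UNIV f \<and> (\<exists>C. \<forall>x. \<bar>f x\<bar> \<le> C * exp (- (norm x)\<^sup>2 / 2))"

lemma gaussian_dominated_measurable:
  "gaussian_dominated f \<Longrightarrow> f \<in> borel_measurable borel"
  unfolding gaussian_dominated_def by (auto intro: borel_measurable_continuous_onI)

lemma gaussian_dominated_gaussian: "gaussian_dominated (\<lambda>x. exp (- (norm x)\<^sup>2 / 2))"
  unfolding gaussian_dominated_def by (auto intro!: continuous_intros exI[of _ 1])

lemma gaussian_dominated_add:
  assumes "gaussian_dominated f" "gaussian_dominated g"
  shows "gaussian_dominated (\<lambda>x. f x + g x)"
proof -
  obtain C D where "\<And>x. \<bar>f x\<bar> \<le> C * exp (- (norm x)\<^sup>2 / 2)" "\<And>x. \<bar>g x\<bar> \<le> D * exp (- (norm x)\<^sup>2 / 2)"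
    using assms by (auto simp: gaussian_dominated_def)
  then have "\<bar>f x + g x\<bar> \<le> (C + D) * exp (- (norm x)\<^sup>2 / 2)" for x
    using abs_triangle_ineq[of "f x" "g x"] by (simp add: distrib_right) (meson add_mono order_trans)
  then show ?thesis
    using assms unfolding gaussian_dominated_def by (auto intro!: continuous_intros)
qed

lemma gaussian_dominated_cmult:
  assumes "gaussian_dominated f"
  shows "gaussian_dominated (\<lambda>x. c * f x)"
proof -
  obtain C where "\<And>x. \<bar>f x\<bar> \<le> C * exp (- (norm x)\<^sup>2 / 2)"
    using assms by (auto simp: gaussian_dominated_def)
  then have "\<bar>c * f x\<bar> \<le> (\<bar>c\<bar> * C) * exp (- (norm x)\<^sup>2 / 2)" for x
    using mult_left_mono[of "\<bar>f x\<bar>" _ "\<bar>c\<bar>"] by (simp add: abs_mult mult.assoc)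
  then show ?thesis
    using assms unfolding gaussian_dominated_def by (auto intro!: continuous_intros)
qed

lemma gaussian_dominated_diff:
  assumes "gaussian_dominated f" "gaussian_dominated g"
  shows "gaussian_dominated (\<lambda>x. f x - g x)"
  using gaussian_dominated_add[OF assms(1) gaussian_dominated_cmult[OF assms(2), of "-1"]] by simp

lemma gaussian_dominated_integrable:
  assumes "gaussian_dominated f"
  shows "integrable lborel f"
proof -
  obtain C where C: "\<And>x. \<bar>f x\<bar> \<le> C * exp (- (norm x)\<^sup>2 / 2)"
    using assms by (auto simp: gaussian_dominated_def)
  have "integrable lborel (\<lambda>x::'a. C * exp (- 1\<^sup>2 * (norm x)\<^sup>2 / 2))"
    by (intro integrable_mult_right integrable_scaled_gaussian) simp
  then show ?thesis
    by (rule Bochner_Integration.integrable_bound)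
       (use order_trans[OF C abs_ge_self] gaussian_dominated_measurable[OF assms] in auto)
qed

text \<open>The collar vanishes outside the ball of radius r + 1; inside it f is bounded and the
  Gaussian is bounded away from 0.\<close>

lemma gaussian_dominated_times_collar:
  fixes A :: "'a::euclidean_space set"
  assumes f: "continuous_on UNIV f" and A: "bounded A" "A \<noteq> {}"
  shows "gaussian_dominated (\<lambda>x. f x * collar A i x)"
proof -
  obtain r where r: "\<And>x. x \<in> A \<Longrightarrow> norm x \<le> r"
    using A by (auto simp: bounded_iff)
  have "compact (f ` cball 0 (r + 1))"
    using f by (intro compact_continuous_image) (auto intro: continuous_on_subset)
  then obtain D where D: "\<And>x. norm x \<le> r + 1 \<Longrightarrow> \<bar>f x\<bar> \<le> D"
    using compact_imp_bounded by (force simp: bounded_iff)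
  have "\<bar>f x * collar A i x\<bar> \<le> (\<bar>D\<bar> * exp ((r + 1)\<^sup>2 / 2)) * exp (- (norm x)\<^sup>2 / 2)" for x
  proof (cases "norm x \<le> r + 1")
    case True
    have "\<bar>f x * collar A i x\<bar> \<le> \<bar>D\<bar> * 1"
      unfolding abs_mult using D[OF True] collar_nonneg[of A i x] collar_le_1[of A i x]
      by (intro mult_mono) auto
    also have "\<dots> \<le> \<bar>D\<bar> * exp ((r + 1)\<^sup>2 / 2 + - (norm x)\<^sup>2 / 2)"
      using power_mono[OF True norm_ge_zero, of 2] by (intro mult_left_mono) auto
    finally show ?thesis
      unfolding exp_add by (simp only: mult.assoc)
  next
    case False
    have "1 \<le> infdist x A"
      unfolding infdist_notempty[OF A(2)]
    proof (rule cINF_greatest[OF A(2)])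
      fix y assume "y \<in> A"
      then show "1 \<le> dist x y"
        using r[of y] False norm_triangle_sub[of x y] by (simp add: dist_norm)
    qed
    moreover have "1 * infdist x A \<le> real (Suc i) * infdist x A"
      by (intro mult_right_mono infdist_nonneg) simp
    ultimately have "1 \<le> real (Suc i) * infdist x A"
      by linarith
    then have "collar A i x = 0"
      by (simp add: collar_def)
    then show ?thesis by simp
  qed
  then show ?thesis
    unfolding gaussian_dominated_def
    by (intro conjI continuous_on_mult f continuous_on_collar) blast
qed

subsection \<open>Comparison of volumes\<close>

text \<open>The condition \<open>absorbing\<close> makes the infimum a minimum in every direction.
  It does not make the origin an interior point, so the functional need not be bounded on the unit
  sphere.\<close>

locale symmetric_star_body =
  fixes M :: "'a::euclidean_space set"
  assumes star: "star_shaped_body M" and sym: "origin_symmetric M"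
    and absorbing: "\<And>x. x \<noteq> 0 \<Longrightarrow> \<exists>a>0. x \<in> (*\<^sub>R) a ` M"
begin

abbreviation N :: "'a \<Rightarrow> real" where
  "N \<equiv> minkowski_functional M"

lemma compact_M: "compact M"
  using star by (simp add: star_shaped_body_def)

lemma zero_in_M: "0 \<in> M"
proof -
  have "interior M \<noteq> {}" and segment: "\<And>x. x \<in> M \<Longrightarrow> closed_segment 0 x \<subseteq> M"
    using star by (auto simp: star_shaped_body_def)
  then obtain x where "x \<in> M"
    using interior_subset[of M] by blast
  then show ?thesis
    using segment[of x] by auto
qed

lemma in_scaled_iff: "0 < a \<Longrightarrow> x \<in> (*\<^sub>R) a ` M \<longleftrightarrow> inverse a *\<^sub>R x \<in> M"
  by (force simp: image_iff intro: bexI[of _ "inverse a *\<^sub>R x"])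

lemma minkowski_zero: "N 0 = 0"
proof -
  have "{a. 0 < a \<and> 0 \<in> (*\<^sub>R) a ` M} = {0<..}"
    using zero_in_M by (auto simp: image_iff)
  then show ?thesis
    by (simp add: minkowski_functional_def)
qed

lemma minkowski_pos: "x \<noteq> 0 \<Longrightarrow> 0 < N x"
  using minkowski_functional_is_min(1)[OF compact_M _ absorbing] by simp

lemma minkowski_nonneg: "0 \<le> N x"
  using minkowski_pos[of x] minkowski_zero by (cases "x = 0") auto

text \<open>Here star-shapedness enters: the factors a with x in a M form an upward closed set.
  Homogeneity and lower semicontinuity of \<open>N\<close> are both derived from this description of
  its sublevel sets.\<close>

lemma minkowski_le_iff:
  assumes "0 < a"
  shows "N x \<le> a \<longleftrightarrow> x \<in> (*\<^sub>R) a ` M"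
proof (cases "x = 0")
  case True
  then show ?thesis
    using assms zero_in_M by (auto simp: minkowski_zero image_iff)
next
  case False
  show ?thesis
  proof
    assume "x \<in> (*\<^sub>R) a ` M"
    then show "N x \<le> a"
      using minkowski_functional_is_min(2)[OF compact_M False absorbing[OF False] assms] by simp
  next
    assume le: "N x \<le> a"
    have pos: "0 < N x" and "x \<in> (*\<^sub>R) (N x) ` M"
      using minkowski_functional_is_min(1)[OF compact_M False absorbing[OF False]] by auto
    then have "inverse (N x) *\<^sub>R x \<in> M"
      by (simp add: in_scaled_iff)
    then have "closed_segment 0 (inverse (N x) *\<^sub>R x) \<subseteq> M"
      using star by (auto simp: star_shaped_body_def)
    moreover have "inverse a *\<^sub>R x = (N x / a) *\<^sub>R (inverse (N x) *\<^sub>R x)"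
      using pos by (simp add: divide_inverse)
    then have "inverse a *\<^sub>R x \<in> closed_segment 0 (inverse (N x) *\<^sub>R x)"
      using pos le assms by (auto simp: closed_segment_def intro!: exI[of _ "N x / a"])
    ultimately show "x \<in> (*\<^sub>R) a ` M"
      using assms by (auto simp: in_scaled_iff)
  qed
qed

lemma minkowski_scaleR:
  assumes c: "c \<noteq> 0"
  shows "N (c *\<^sub>R x) = \<bar>c\<bar> * N x"
proof -
  have sym': "inverse a *\<^sub>R (c *\<^sub>R x) \<in> M \<longleftrightarrow> inverse a *\<^sub>R (\<bar>c\<bar> *\<^sub>R x) \<in> M" for a
  proof -
    have "- y \<in> M \<longleftrightarrow> y \<in> M" for y
      using sym unfolding origin_symmetric_def by (metis minus_minus)
    from this[of "inverse a *\<^sub>R (c *\<^sub>R x)"] show ?thesis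
      by (cases "0 \<le> c") auto
  qed
  have iff: "N (c *\<^sub>R x) \<le> a \<longleftrightarrow> \<bar>c\<bar> * N x \<le> a" if a: "0 < a" for a
  proof -
    have "N (c *\<^sub>R x) \<le> a \<longleftrightarrow> inverse (a / \<bar>c\<bar>) *\<^sub>R x \<in> M"
      using a c sym'[of a] by (simp add: minkowski_le_iff in_scaled_iff divide_inverse mult.commute)
    also have "\<dots> \<longleftrightarrow> N x \<le> a / \<bar>c\<bar>"
      using a c by (simp add: minkowski_le_iff in_scaled_iff)
    finally show ?thesis
      using c by (simp add: field_simps)
  qed
  \<comment> \<open>Two nonnegative numbers with the same positive upper bounds are equal; otherwise
    their midpoint would separate them.\<close>
  have "\<not> p < q" if "0 \<le> p" "\<And>a. 0 < a \<Longrightarrow> p \<le> a \<longleftrightarrow> q \<le> a" for p q :: real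
    using that(1) that(2)[of "(p + q) / 2"] by auto
  from this[of "N (c *\<^sub>R x)" "\<bar>c\<bar> * N x"] this[of "\<bar>c\<bar> * N x" "N (c *\<^sub>R x)"]
  show ?thesis
    using iff minkowski_nonneg by (simp add: antisym_conv3)
qed

lemma closed_minkowski_sublevel: "0 < a \<Longrightarrow> closed {x. N x \<le> a}"
  using compact_imp_closed[OF compact_scaling[OF compact_M, of a]] by (simp add: minkowski_le_iff)

lemma minorant_tendsto: "(\<lambda>i. lipschitz_minorant N i x) \<longlonglongrightarrow> N x"
  by (rule lipschitz_minorant_tendsto[OF minkowski_nonneg closed_minkowski_sublevel])

lemma measurable_minkowski[measurable]: "N \<in> borel_measurable borel"
  by (rule borel_measurable_LIMSEQ_real[OF minorant_tendsto])
     (intro borel_measurable_continuous_onI continuous_on_lipschitz_minorant minkowski_nonneg)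

text \<open>The point x / N x lies in the bounded set M, whence |x| \<le> R N x; at the origin both
  sides of the required bound are 0 by the convention on division.\<close>

lemma homogeneous_weight_inverse_minkowski:
  assumes "2 \<le> DIM('a)"
  obtains R where "homogeneous_weight (\<lambda>x. inverse (N x)) R"
proof -
  obtain R where R: "R > 0" "\<And>y. y \<in> M \<Longrightarrow> norm y \<le> R"
    using compact_imp_bounded[OF compact_M] by (auto simp: bounded_pos)
  have "inverse (N x) \<le> R / norm x" for x
  proof (cases "x = 0")
    case False
    have "inverse (N x) *\<^sub>R x \<in> M"
      using minkowski_le_iff[of "N x" x] minkowski_pos[OF False] by (simp add: in_scaled_iff)
    then have "norm (inverse (N x) *\<^sub>R x) \<le> R"
      by (rule R)
    then show ?thesis
      using False minkowski_pos[OF False] by (simp add: pos_le_divide_eq)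
  qed (simp add: minkowski_zero)
  then have "homogeneous_weight (\<lambda>x. inverse (N x)) R"
    using assms by unfold_locales (auto simp: minkowski_nonneg minkowski_scaleR field_simps)
  then show thesis by (rule that)
qed

end

section \<open>From hyperplane integrals to slab averages\<close>

lemma sets_lborel_subspace[simp, measurable_cong]: "sets (lborel_subspace S) = sets borel"
  and space_lborel_subspace[simp]: "space (lborel_subspace S) = UNIV"
  by (simp_all add: lborel_subspace_def Let_def)

text \<open>Allows integrals over a set and over its section to be exchanged.\<close>

lemma AE_lborel_subspace:
  fixes S :: "'a::euclidean_space set"
  assumes S: "subspace S"
  shows "AE x in lborel_subspace S. x \<in> S"
proof -
  obtain B where B: "orthonormal_basis_of S B"
    "lborel_subspace S = distr (\<Pi>\<^sub>M b\<in>B. lborel) borel (\<lambda>t. \<Sum>b\<in>B. t b *\<^sub>R b)"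
    by (rule lborel_subspace_coordinates[OF S])
  have "(\<Sum>b\<in>B. t b *\<^sub>R b) \<in> S" for t
    using B(1) by (intro subspace_sum subspace_scale S) (auto simp: orthonormal_basis_of_def)
  moreover have "{x. x \<in> S} \<in> sets borel"
    using closed_subspace[OF S] by simp
  ultimately show ?thesis
    unfolding B(2) by (subst AE_distr_iff) auto
qed

text \<open>Read off from the product formula: the integral over the whole space is positive, and so
  is the one-dimensional factor.\<close>

lemma integral_gaussian_lborel_hyperplane_pos:
  fixes \<xi> :: "'a::euclidean_space"
  assumes \<xi>: "norm \<xi> = 1"
  shows "0 < (\<integral>x. exp (- (norm x)\<^sup>2 / 2) \<partial>lborel_subspace ({\<xi>}\<^sup>\<bottom>))"
proof -
  obtain B where B: "orthonormal_basis_of ({\<xi>}\<^sup>\<bottom>) B"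
    "lborel_subspace ({\<xi>}\<^sup>\<bottom>) = distr (\<Pi>\<^sub>M b\<in>B. lborel) borel (\<lambda>t. \<Sum>b\<in>B. t b *\<^sub>R b)"
    by (rule lborel_subspace_coordinates[OF subspace_orthogonal_comp])
  interpret hyperplane_coordinates \<xi> B
    by standard (use \<xi> B in auto)
  have eq: "(\<integral>x. exp (- (norm x)\<^sup>2 / 2) \<partial>lborel_subspace ({\<xi>}\<^sup>\<bottom>)) = (\<integral>t. exp (- (norm (pt t))\<^sup>2 / 2) \<partial>MB)"
    unfolding B(2) pt_def[abs_def, symmetric] by (rule integral_distr) auto
  have "(sqrt (2 * pi)) ^ DIM('a) = (\<integral>x. exp (- (norm (x::'a))\<^sup>2 / 2) \<partial>lborel)"
    using integral_scaled_gaussian[of 1, where 'a = 'a] by simp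
  also have "\<dots> = (\<integral>t. \<integral>s. exp (- (norm (pt t + s *\<^sub>R \<xi>))\<^sup>2 / 2) \<partial>lborel \<partial>MB)"
    using integrable_scaled_gaussian[of 1, where 'a = 'a] by (intro integral_lborel_coordinates) simp
  also have "\<dots> = (\<integral>t. exp (- (norm (pt t))\<^sup>2 / 2) * sqrt (2 * pi) \<partial>MB)"
  proof (rule Bochner_Integration.integral_cong[OF refl])
    fix t
    have "exp (- (norm (pt t + s *\<^sub>R \<xi>))\<^sup>2 / 2) = exp (- (norm (pt t))\<^sup>2 / 2) * exp (- s\<^sup>2 / 2)" for s
      unfolding norm_pt_add by (simp add: exp_add[symmetric] field_simps)
    then show "(\<integral>s. exp (- (norm (pt t + s *\<^sub>R \<xi>))\<^sup>2 / 2) \<partial>lborel) = exp (- (norm (pt t))\<^sup>2 / 2) * sqrt (2 * pi)"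
      using integral_scaled_gaussian[of 1, where 'a = real] by simp
  qed
  also have "\<dots> = (\<integral>t. exp (- (norm (pt t))\<^sup>2 / 2) \<partial>MB) * sqrt (2 * pi)"
    by (rule integral_mult_left_zero)
  finally have "(\<integral>t. exp (- (norm (pt t))\<^sup>2 / 2) \<partial>MB) * sqrt (2 * pi) > 0"
    by (metis pi_gt_zero real_sqrt_gt_0_iff zero_less_mult_iff zero_less_numeral zero_less_power)
  then show ?thesis
    unfolding eq by (simp add: zero_less_mult_iff)
qed

text \<open>The Fourier side only sees \<open>F\<close> through Gaussian averages over thin slabs, so a strict
  inequality between hyperplane integrals has to be made uniform over all thin slabs; this is a
  Dini argument on the sphere.\<close>

lemma gaussian_slab_eventually_nonneg:
  fixes F :: "nat \<Rightarrow> 'a::euclidean_space \<Rightarrow> real"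
  assumes dom: "\<And>i. gaussian_dominated (F i)" and mono: "\<And>i j x. i \<le> j \<Longrightarrow> F i x \<le> F j x"
    and pos: "\<And>\<xi>. norm \<xi> = 1 \<Longrightarrow> \<exists>i. 0 < (\<integral>x. F i x \<partial>lborel_subspace ({\<xi>}\<^sup>\<bottom>))"
  shows "\<exists>j. \<forall>\<xi>. real j \<le> norm \<xi> \<longrightarrow> 0 \<le> gaussian_slab (F j) \<xi>"
proof (rule ccontr)
  assume "\<not> ?thesis"
  then have "\<forall>j. \<exists>\<xi>. real j \<le> norm \<xi> \<and> gaussian_slab (F j) \<xi> < 0"
    by (simp add: not_le)
  then obtain X where X: "\<And>j. real j \<le> norm (X j)" "\<And>j. gaussian_slab (F j) (X j) < 0"
    by metis
  \<comment> \<open>Shifted by one since \<open>X 0\<close> may vanish; from index 1 on the norm is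
    at least 1 and the direction is defined.\<close>
  define u where "u j = X (Suc j) /\<^sub>R norm (X (Suc j))" for j
  have X_pos: "0 < norm (X (Suc j))" for j
    using X(1)[of "Suc j"] by linarith
  have "u j \<in> sphere 0 1" for j
    using X_pos[of j] by (simp add: u_def)
  then obtain \<xi> r where \<xi>: "\<xi> \<in> sphere 0 1" and r: "strict_mono r" "(u \<circ> r) \<longlonglongrightarrow> \<xi>"
    using compact_sphere unfolding compact_def by metis
  define R where "R j = norm (X (Suc (r j)))" for j
  have R: "filterlim R at_top sequentially"
  proof (rule filterlim_at_top_mono[OF filterlim_real_sequentially])
    show "\<forall>\<^sub>F j in sequentially. real j \<le> R j"
    proof (intro always_eventually allI)
      fix j
      have "real j \<le> real (Suc (r j))"
        using seq_suble[OF r(1), of j] by simp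
      also have "\<dots> \<le> R j"
        unfolding R_def by (rule X(1))
      finally show "real j \<le> R j" .
    qed
  qed
  have X_eq: "R j *\<^sub>R (u \<circ> r) j = X (Suc (r j))" for j
    using X_pos[of "r j"] by (simp add: R_def u_def)
  obtain i where i: "0 < (\<integral>x. F i x \<partial>lborel_subspace ({\<xi>}\<^sup>\<bottom>))"
    using pos \<xi> by auto
  obtain C where "continuous_on UNIV (F i)" "\<And>x. \<bar>F i x\<bar> \<le> C * exp (- (norm x)\<^sup>2 / 2)"
    using dom[of i] by (auto simp: gaussian_dominated_def)
  then have lim: "(\<lambda>j. R j * gaussian_slab (F i) (X (Suc (r j)))) \<longlonglongrightarrow>
      sqrt (2 * pi) * (\<integral>x. F i x \<partial>lborel_subspace ({\<xi>}\<^sup>\<bottom>))"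
    using gaussian_slab_tendsto(1)[OF _ _ gaussian_dominated_integrable[OF dom] R r(2)] \<xi>
    unfolding X_eq by auto
  have int: "integrable lborel (\<lambda>y. F j y * exp (- (y \<bullet> \<xi>')\<^sup>2 / 2))" for j \<xi>'
  proof (rule Bochner_Integration.integrable_bound[OF gaussian_dominated_integrable[OF dom[of j]]])
    show "(\<lambda>y. F j y * exp (- (y \<bullet> \<xi>')\<^sup>2 / 2)) \<in> borel_measurable lborel"
      using gaussian_dominated_measurable[OF dom[of j]] by simp
    show "AE y in lborel. norm (F j y * exp (- (y \<bullet> \<xi>')\<^sup>2 / 2)) \<le> norm (F j y)"
      by (intro AE_I2) (simp add: abs_mult mult_left_le)
  qed
  \<comment> \<open>At stage \<open>Suc (r j)\<close> the slab average is negative; by monotonicity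
    the one for the fixed index i lies below it, and this sign survives in the limit.\<close>
  have "R j * gaussian_slab (F i) (X (Suc (r j))) \<le> 0" if "i \<le> j" for j
  proof -
    have "i \<le> Suc (r j)"
      using that seq_suble[OF r(1), of j] by simp
    then have "gaussian_slab (F i) (X (Suc (r j))) \<le> gaussian_slab (F (Suc (r j))) (X (Suc (r j)))"
      unfolding gaussian_slab_def by (intro integral_mono int mult_right_mono mono) auto
    then show ?thesis
      using X(2)[of "Suc (r j)"] by (intro mult_nonneg_nonpos) (auto simp: R_def)
  qed
  then have "sqrt (2 * pi) * (\<integral>x. F i x \<partial>lborel_subspace ({\<xi>}\<^sup>\<bottom>)) \<le> 0"
    by (intro LIMSEQ_le_const2[OF lim]) auto
  moreover have "0 < sqrt (2 * pi) * (\<integral>x. F i x \<partial>lborel_subspace ({\<xi>}\<^sup>\<bottom>))"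
    using i by simp
  ultimately show False by linarith
qed

lemma gaussian_dominated_integrable_hyperplane:
  assumes "gaussian_dominated f" and "norm \<xi> = 1"
  shows "integrable (lborel_subspace ({\<xi>}\<^sup>\<bottom>)) f"
proof -
  obtain C where C: "\<And>x. \<bar>f x\<bar> \<le> C * exp (- (norm x)\<^sup>2 / 2)" and cont: "continuous_on UNIV f"
    using assms by (auto simp: gaussian_dominated_def)
  \<comment> \<open>Integrability does not involve the sequences of
    \<open>gaussian_slab_tendsto\<close>, so any admissible ones will do.\<close>
  show ?thesis
    by (rule gaussian_slab_tendsto(2)[OF cont C gaussian_dominated_integrable[OF assms(1)]
          filterlim_real_sequentially tendsto_const assms(2)])
qed

lemma (in homogeneous_weight) integrable_weight_mult:
  assumes "gaussian_dominated f"
  shows "integrable lborel (\<lambda>x. \<rho> x * f x)"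
proof -
  obtain C where C: "\<And>x. \<bar>f x\<bar> \<le> C * exp (- (norm x)\<^sup>2 / 2)"
    using assms by (auto simp: gaussian_dominated_def)
  have "integrable lborel (\<lambda>x. C * (\<rho> x * exp (- 1\<^sup>2 * (norm x)\<^sup>2 / 2)))"
    by (intro integrable_mult_right integrable_weight_gaussian) simp
  then show ?thesis
  proof (rule Bochner_Integration.integrable_bound)
    show "(\<lambda>x. \<rho> x * f x) \<in> borel_measurable lborel"
      using gaussian_dominated_measurable[OF assms] by simp
    show "AE x in lborel. norm (\<rho> x * f x) \<le> norm (C * (\<rho> x * exp (- 1\<^sup>2 * (norm x)\<^sup>2 / 2)))"
    proof (rule AE_I2)
      fix x
      have "\<bar>\<rho> x * f x\<bar> \<le> \<rho> x * (C * exp (- (norm x)\<^sup>2 / 2))"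
        unfolding abs_mult abs_of_nonneg[OF nonneg] by (intro mult_left_mono C nonneg)
      then show "norm (\<rho> x * f x) \<le> norm (C * (\<rho> x * exp (- 1\<^sup>2 * (norm x)\<^sup>2 / 2)))"
        by (simp add: mult.left_commute)
    qed
  qed
qed

section \<open>The comparison functions and the passage to the limit\<close>

context symmetric_star_body
begin

text \<open>The Gaussian term makes the hyperplane integrals strictly positive for large \<open>j\<close>.\<close>

definition comparison_function :: "'a set \<Rightarrow> 'a set \<Rightarrow> nat \<Rightarrow> nat \<Rightarrow> 'a \<Rightarrow> real" where
  "comparison_function K L k j x =
     lipschitz_minorant N j x * collar L k x - lipschitz_minorant N k x * collar K j x
     + inverse (real (Suc k)) * exp (- (norm x)\<^sup>2 / 2)"

lemma minorant_bounds:
  "0 \<le> lipschitz_minorant N i x"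
  "lipschitz_minorant N i x \<le> N x"
  "i \<le> j \<Longrightarrow> lipschitz_minorant N i x \<le> lipschitz_minorant N j x"
  by (rule lipschitz_minorant_nonneg lipschitz_minorant_le lipschitz_minorant_mono;
      use minkowski_nonneg in simp)+

lemma gaussian_dominated_minorant_collar:
  assumes "compact A" "A \<noteq> {}"
  shows "gaussian_dominated (\<lambda>x. lipschitz_minorant N i x * collar A j x)"
  using assms
  by (intro gaussian_dominated_times_collar continuous_on_lipschitz_minorant minkowski_nonneg)
     (auto intro: compact_imp_bounded)

lemma gaussian_dominated_comparison_function:
  assumes "compact K" "K \<noteq> {}" "compact L" "L \<noteq> {}"
  shows "gaussian_dominated (comparison_function K L k j)"
  unfolding comparison_function_def[abs_def] using assms
  by (intro gaussian_dominated_add gaussian_dominated_diff gaussian_dominated_cmult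
      gaussian_dominated_gaussian gaussian_dominated_minorant_collar)

text \<open>The two indices are crossed for this purpose: j sharpens the minorant in the L term and
  the collar in the K term, and both changes increase the function, as the compactness argument
  requires. Raising k has the opposite effect, so k stays fixed while j grows and is sent to
  infinity last.\<close>

lemma comparison_function_mono:
  "i \<le> j \<Longrightarrow> comparison_function K L k i x \<le> comparison_function K L k j x"
  unfolding comparison_function_def
  by (intro add_right_mono diff_mono mult_right_mono mult_left_mono minorant_bounds(3) minorant_bounds(1)
      collar_antimono collar_nonneg)

lemma measurable_minorant[measurable]: "lipschitz_minorant N i \<in> borel_measurable borel"
  by (intro borel_measurable_continuous_onI continuous_on_lipschitz_minorant minkowski_nonneg)

text \<open>If all integrals were nonpositive, the limit in j would give
  \<open>a' + e \<le> b'\<close>, whereas the section inequality gives \<open>b' \<le> a'\<close>.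
  The L side is computed in \<open>ennreal\<close>, since its limit could be infinite a priori; the
  K side is real, because its minorant is continuous and has fixed index k. So \<open>a'\<close>
  turns out finite, and the positive \<open>e\<close> from the Gaussian term cannot be
  absorbed.\<close>

lemma comparison_function_hyperplane_pos:
  assumes K: "compact K" "K \<noteq> {}" and L: "compact L" "L \<noteq> {}" and \<xi>: "norm \<xi> = 1"
    and le: "(\<integral>\<^sup>+x\<in>K \<inter> {\<xi>}\<^sup>\<bottom>. ennreal (N x) \<partial>lborel_subspace ({\<xi>}\<^sup>\<bottom>))
         \<le> (\<integral>\<^sup>+x\<in>L \<inter> {\<xi>}\<^sup>\<bottom>. ennreal (N x) \<partial>lborel_subspace ({\<xi>}\<^sup>\<bottom>))"
  shows "\<exists>j. 0 < (\<integral>x. comparison_function K L k j x \<partial>lborel_subspace ({\<xi>}\<^sup>\<bottom>))"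
proof (rule ccontr)
  let ?S = "lborel_subspace ({\<xi>}\<^sup>\<bottom>)"
  let ?m = "lipschitz_minorant N"
  let ?g = "\<lambda>x::'a. exp (- (norm x)\<^sup>2 / 2)"
  assume "\<not> ?thesis"
  then have neg: "(\<integral>x. comparison_function K L k j x \<partial>?S) \<le> 0" for j
    by (simp add: not_less)
  have [measurable]: "K \<in> sets borel" "L \<in> sets borel"
    using K L by (auto intro: borel_compact)
  define e where "e = inverse (real (Suc k)) * (\<integral>x. ?g x \<partial>?S)"
  have e: "0 < e"
    using integral_gaussian_lborel_hyperplane_pos[OF \<xi>] by (simp add: e_def)
  define b where "b j = (\<integral>x. ?m k x * collar K j x \<partial>?S)" for j
  define b' where "b' = (\<integral>x. ?m k x * indicator K x \<partial>?S)"
  have int: "integrable ?S (\<lambda>x. ?m i x * collar A j x)" if "compact A" "A \<noteq> {}" for i j A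
    using that \<xi> by (intro gaussian_dominated_integrable_hyperplane gaussian_dominated_minorant_collar)
  have int_g: "integrable ?S ?g"
    by (rule gaussian_dominated_integrable_hyperplane[OF gaussian_dominated_gaussian \<xi>])
  have int_b': "integrable ?S (\<lambda>x. ?m k x * indicator K x)"
  proof (rule Bochner_Integration.integrable_bound[OF int[OF K, of k 0]])
    show "AE x in ?S. norm (?m k x * indicator K x) \<le> norm (?m k x * collar K 0 x)"
      using minorant_bounds(1) indicator_le_collar[of K] collar_nonneg[of K]
      by (intro AE_I2) (simp add: abs_mult mult_left_mono)
  qed measurable
  have real_le: "(\<integral>x. ?m j x * collar L k x \<partial>?S) + e \<le> b j" for j
  proof -
    have "(\<integral>x. comparison_function K L k j x \<partial>?S) = (\<integral>x. ?m j x * collar L k x \<partial>?S) - b j + e"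
      unfolding comparison_function_def e_def b_def
      using int[OF K] int[OF L] int_g by simp
    then show ?thesis using neg[of j] by simp
  qed
  define a where "a j = (\<integral>\<^sup>+x. ennreal (?m j x) * indicator L x \<partial>?S)" for j
  define a' where "a' = (\<integral>\<^sup>+x. ennreal (N x) * indicator L x \<partial>?S)"
  \<comment> \<open>The collar of L is lowered to the indicator, so that the limit in j is the
    integral of \<open>N\<close> over L itself.\<close>
  have ab: "a j + ennreal e \<le> ennreal (b j)" for j
  proof -
    have "a j \<le> (\<integral>\<^sup>+x. ennreal (?m j x * collar L k x) \<partial>?S)"
      unfolding a_def using minorant_bounds(1)
      by (intro nn_integral_mono) (auto simp: indicator_def collar_eq_1)
    also have "\<dots> = ennreal (\<integral>x. ?m j x * collar L k x \<partial>?S)"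
      using minorant_bounds(1) collar_nonneg by (intro nn_integral_eq_integral int[OF L] AE_I2 mult_nonneg_nonneg)
    finally have "a j + ennreal e \<le> ennreal (\<integral>x. ?m j x * collar L k x \<partial>?S) + ennreal e"
      by (rule add_right_mono)
    also have "\<dots> = ennreal ((\<integral>x. ?m j x * collar L k x \<partial>?S) + e)"
      using e by (intro ennreal_plus[symmetric] Bochner_Integration.integral_nonneg
          mult_nonneg_nonneg minorant_bounds(1) collar_nonneg) simp
    also have "\<dots> \<le> ennreal (b j)"
      by (intro ennreal_leI real_le)
    finally show ?thesis .
  qed
  have lim_a: "a \<longlonglongrightarrow> a'"
    unfolding a_def a'_def
  proof (rule nn_integral_LIMSEQ)
    show "incseq (\<lambda>j x. ennreal (?m j x) * indicator L x)"
      by (auto simp: incseq_def le_fun_def intro!: mult_right_mono ennreal_leI minorant_bounds(3))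
    show "(\<lambda>j. ennreal (?m j x) * indicator L x) \<longlonglongrightarrow> ennreal (N x) * indicator L x" for x
    proof (cases "x \<in> L")
      case True
      then show ?thesis using minorant_tendsto by (simp add: tendsto_ennrealI)
    qed simp
  qed measurable
  have lim_b: "b \<longlonglongrightarrow> b'"
    unfolding b_def b'_def
  proof (rule integral_dominated_convergence[OF _ _ int[OF K, of k 0]])
    show "AE x in ?S. (\<lambda>j. ?m k x * collar K j x) \<longlonglongrightarrow> ?m k x * indicator K x"
      using K by (intro AE_I2 tendsto_mult tendsto_const collar_tendsto) (auto intro: compact_imp_closed)
    show "AE x in ?S. norm (?m k x * collar K j x) \<le> ?m k x * collar K 0 x" for j
      using minorant_bounds(1) collar_nonneg[of K] collar_antimono[of 0 j K]
      by (intro AE_I2) (simp add: abs_mult mult_left_mono)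
    show "(\<lambda>x. ?m k x * collar K j x) \<in> borel_measurable ?S" for j
      using int[OF K] by auto
  qed measurable
  have upper: "a' + ennreal e \<le> ennreal b'"
    using ab by (intro LIMSEQ_le[OF tendsto_add[OF lim_a tendsto_const] tendsto_ennrealI[OF lim_b]]) auto
  have "ennreal b' \<le> a'"
  proof -
    have "ennreal b' = (\<integral>\<^sup>+x. ennreal (?m k x * indicator K x) \<partial>?S)"
      unfolding b'_def using int_b' minorant_bounds(1) by (intro nn_integral_eq_integral[symmetric]) auto
    also have "\<dots> \<le> (\<integral>\<^sup>+x\<in>K \<inter> {\<xi>}\<^sup>\<bottom>. ennreal (N x) \<partial>?S)"
    proof (rule nn_integral_mono_AE)
      show "AE x in ?S. ennreal (?m k x * indicator K x) \<le> ennreal (N x) * indicator (K \<inter> {\<xi>}\<^sup>\<bottom>) x"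
        using AE_lborel_subspace[OF subspace_orthogonal_comp[of "{\<xi>}"]]
        by eventually_elim (auto simp: indicator_def intro!: ennreal_leI minorant_bounds(2))
    qed
    also have "\<dots> \<le> (\<integral>\<^sup>+x\<in>L \<inter> {\<xi>}\<^sup>\<bottom>. ennreal (N x) \<partial>?S)"
      by (rule le)
    also have "\<dots> \<le> a'"
      unfolding a'_def by (intro nn_integral_mono) (auto simp: indicator_def)
    finally show ?thesis .
  qed
  from order_trans[OF upper this] have "a' + ennreal e \<le> a' + 0"
    by (simp only: add_0_right)
  moreover have "a' \<noteq> \<infinity>"
    using upper by (auto simp: top_unique)
  ultimately show False
    using e by (simp add: ennreal_add_left_cancel_le)
qed

lemma volume_le_of_weighted_sections_le:
  assumes DIM: "2 \<le> DIM('a)"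
    and pd: "positive_definite_distribution (distribution_of (\<lambda>x. inverse (N x)))"
    and K: "compact K" "K \<noteq> {}" and L: "compact L" "L \<noteq> {}"
    and sections: "\<And>\<xi>. norm \<xi> = 1 \<Longrightarrow>
           (\<integral>\<^sup>+x\<in>K \<inter> {\<xi>}\<^sup>\<bottom>. ennreal (N x) \<partial>lborel_subspace ({\<xi>}\<^sup>\<bottom>))
         \<le> (\<integral>\<^sup>+x\<in>L \<inter> {\<xi>}\<^sup>\<bottom>. ennreal (N x) \<partial>lborel_subspace ({\<xi>}\<^sup>\<bottom>))"
  shows "measure lborel K \<le> measure lborel L"
proof -
  let ?m = "lipschitz_minorant N"
  let ?\<rho> = "\<lambda>x. inverse (N x)"
  let ?g = "\<lambda>x::'a. exp (- (norm x)\<^sup>2 / 2)"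
  obtain R where hw: "homogeneous_weight ?\<rho> R"
    using DIM by (rule homogeneous_weight_inverse_minkowski)
  interpret homogeneous_weight ?\<rho> R
    by (rule hw)
  have [measurable]: "K \<in> sets borel" "L \<in> sets borel"
    using K L by (auto intro: borel_compact)
  have \<rho>_minorant: "?\<rho> x * ?m i x \<le> 1" for x i
  proof (cases "x = 0")
    case False
    then show ?thesis
      using minorant_bounds(2)[of i x] minkowski_pos[of x] by (simp add: field_simps)
  qed (simp add: minkowski_zero)
  have \<rho>_minorant_nonneg: "0 \<le> ?\<rho> x * ?m i x" for x i
    using nonneg minorant_bounds(1) by simp
  have int_collar: "integrable lborel (collar L i)" for i
    using gaussian_dominated_integrable[OF gaussian_dominated_times_collar[of "\<lambda>_. 1" L i]] L
    by (auto intro: compact_imp_bounded)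
  have int_K: "integrable lborel (indicator K :: 'a \<Rightarrow> real)"
    using emeasure_compact_finite[OF K(1)] by (auto intro!: integrable_real_indicator)
  have int_\<rho>K: "integrable lborel (\<lambda>x. ?\<rho> x * (?m k x * indicator K x))" for k
  proof (rule Bochner_Integration.integrable_bound[OF int_K])
    show "AE x in lborel. norm (?\<rho> x * (?m k x * indicator K x)) \<le> norm (indicator K x :: real)"
      using \<rho>_minorant[of _ k] \<rho>_minorant_nonneg[of _ k] by (intro AE_I2) (auto simp: indicator_def)
  qed measurable
  define P where "P = (\<integral>x. ?\<rho> x * ?g x \<partial>lborel)"
  \<comment> \<open>The index j depends on k and is removed from both sides: on the L side the
    weight times a minorant is at most 1, on the K side the collar is at least the indicator. Only k
    is left for the limit.\<close>
  have main: "(\<integral>x. ?\<rho> x * (?m k x * indicator K x) \<partial>lborel)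
      \<le> (\<integral>x. collar L k x \<partial>lborel) + inverse (real (Suc k)) * P" for k
  proof -
    obtain j where j: "\<And>\<xi>. real j \<le> norm \<xi> \<Longrightarrow> 0 \<le> gaussian_slab (comparison_function K L k j) \<xi>"
      using gaussian_slab_eventually_nonneg[of "comparison_function K L k",
          OF gaussian_dominated_comparison_function[OF K L] comparison_function_mono
             comparison_function_hyperplane_pos[OF K L _ sections]]
      by auto
    have C_ex: "continuous_on UNIV (comparison_function K L k j)"
      "\<exists>C. \<forall>x. \<bar>comparison_function K L k j x\<bar> \<le> C * ?g x"
      using gaussian_dominated_comparison_function[OF K L, of k j] unfolding gaussian_dominated_def by auto
    then obtain C where C: "continuous_on UNIV (comparison_function K L k j)"
      "\<And>x. \<bar>comparison_function K L k j x\<bar> \<le> C * ?g x"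
      by blast
    interpret weighted_test_function ?\<rho> R "comparison_function K L k j" C
      by unfold_locales (use C in auto)
    have "0 \<le> (\<integral>x. ?\<rho> x * comparison_function K L k j x \<partial>lborel)"
      by (rule weighted_integral_nonneg[of "real j"])
         (use positive_definite_gaussian_transform[OF pd] j in \<open>auto simp: weight_ft_def\<close>)
    also have "\<dots> = (\<integral>x. ?\<rho> x * (?m j x * collar L k x) - ?\<rho> x * (?m k x * collar K j x)
        + inverse (real (Suc k)) * (?\<rho> x * ?g x) \<partial>lborel)"
      by (simp add: comparison_function_def algebra_simps)
    also have "\<dots> = (\<integral>x. ?\<rho> x * (?m j x * collar L k x) \<partial>lborel)
        - (\<integral>x. ?\<rho> x * (?m k x * collar K j x) \<partial>lborel) + inverse (real (Suc k)) * P"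
      unfolding P_def
      using integrable_weight_mult[OF gaussian_dominated_minorant_collar[OF K]]
        integrable_weight_mult[OF gaussian_dominated_minorant_collar[OF L]]
        integrable_weight_mult[OF gaussian_dominated_gaussian]
      by simp
    finally have "(\<integral>x. ?\<rho> x * (?m k x * collar K j x) \<partial>lborel)
      \<le> (\<integral>x. ?\<rho> x * (?m j x * collar L k x) \<partial>lborel) + inverse (real (Suc k)) * P"
      by simp
    moreover have "(\<integral>x. ?\<rho> x * (?m k x * indicator K x) \<partial>lborel)
      \<le> (\<integral>x. ?\<rho> x * (?m k x * collar K j x) \<partial>lborel)"
      by (intro integral_mono int_\<rho>K integrable_weight_mult gaussian_dominated_minorant_collar K
          mult_left_mono indicator_le_collar minorant_bounds(1) nonneg)
    moreover have "(\<integral>x. ?\<rho> x * (?m j x * collar L k x) \<partial>lborel) \<le> (\<integral>x. collar L k x \<partial>lborel)"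
    proof (intro integral_mono integrable_weight_mult gaussian_dominated_minorant_collar L int_collar)
      show "?\<rho> x * (?m j x * collar L k x) \<le> collar L k x" for x
        using mult_right_mono[OF \<rho>_minorant[of x j] collar_nonneg[of L k x]] by (simp add: mult.assoc)
    qed
    ultimately show ?thesis by linarith
  qed
  have "(\<lambda>k. \<integral>x. ?\<rho> x * (?m k x * indicator K x) \<partial>lborel) \<longlonglongrightarrow> (\<integral>x. indicator K x \<partial>lborel)"
  proof (rule integral_dominated_convergence[OF _ _ int_K])
    \<comment> \<open>Almost everywhere only: at the origin the weight is 0 by convention, while the
      indicator of K may be 1.\<close>
    show "AE x in lborel. (\<lambda>k. ?\<rho> x * (?m k x * indicator K x)) \<longlonglongrightarrow> (indicator K x :: real)"
      using AE_lborel_singleton[of 0]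
    proof eventually_elim
      case (elim x)
      have "(\<lambda>k. ?\<rho> x * (?m k x * indicator K x)) \<longlonglongrightarrow> ?\<rho> x * (N x * indicator K x)"
        by (intro tendsto_mult tendsto_const minorant_tendsto)
      then show ?case
        using minkowski_pos[OF elim] by (simp add: mult.assoc[symmetric])
    qed
    show "AE x in lborel. norm (?\<rho> x * (?m k x * indicator K x)) \<le> (indicator K x :: real)" for k
      using \<rho>_minorant[of _ k] \<rho>_minorant_nonneg[of _ k] by (intro AE_I2) (auto simp: indicator_def)
  qed measurable
  moreover have "(\<lambda>k. (\<integral>x. collar L k x \<partial>lborel) + inverse (real (Suc k)) * P)
      \<longlonglongrightarrow> (\<integral>x. indicator L x \<partial>lborel) + 0 * P"
  proof (intro tendsto_add tendsto_mult tendsto_const LIMSEQ_inverse_real_of_nat)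
    show "(\<lambda>k. \<integral>x. collar L k x \<partial>lborel) \<longlonglongrightarrow> (\<integral>x. indicator L x \<partial>lborel)"
    proof (rule integral_dominated_convergence[OF _ _ int_collar[of 0]])
      show "AE x in lborel. (\<lambda>k. collar L k x) \<longlonglongrightarrow> indicator L x"
        using L by (intro AE_I2 collar_tendsto) (auto intro: compact_imp_closed)
      show "AE x in lborel. norm (collar L k x) \<le> collar L 0 x" for k
        using collar_nonneg[of L k] collar_antimono[of 0 k L] by (intro AE_I2) simp
      show "collar L k \<in> borel_measurable lborel" for k
        using int_collar by auto
    qed measurable
  qed
  ultimately have "(\<integral>x. indicator K x \<partial>lborel) \<le> (\<integral>x. indicator L x \<partial>lborel) + 0 * P"
    by (rule LIMSEQ_le) (use main in auto)
  then show ?thesis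
    by simp
qed

end

text \<open>The section integrals are taken in \<open>ennreal\<close> because the Minkowski
  functional may be unbounded, so they may a priori be infinite. The condition on dilation factors
  excludes directions in which the functional would have no meaning.\<close>

theorem lemma2:
  fixes M K L :: "(real ^ 'n) set"
  assumes "2 \<le> CARD('n)"
    and "star_shaped_body M" and "origin_symmetric M"
    and "\<forall>x. x \<noteq> 0 \<longrightarrow> (\<exists>a>0. x \<in> (*\<^sub>R) a ` M)"
    and "positive_definite_distribution (distribution_of (\<lambda>x. inverse (minkowski_functional M x)))"
    and "star_shaped_body K" and "origin_symmetric K"
    and "star_shaped_body L" and "origin_symmetric L"
    and "\<forall>\<xi>\<in>sphere 0 1.
           (\<integral>\<^sup>+x\<in>K \<inter> {\<xi>}\<^sup>\<bottom>. ennreal (minkowski_functional M x) \<partial>lborel_subspace ({\<xi>}\<^sup>\<bottom>))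
         \<le> (\<integral>\<^sup>+x\<in>L \<inter> {\<xi>}\<^sup>\<bottom>. ennreal (minkowski_functional M x) \<partial>lborel_subspace ({\<xi>}\<^sup>\<bottom>))"
  shows "measure lborel K \<le> measure lborel L"
proof -
  interpret symmetric_star_body M
    by unfold_locales (use assms in auto)
  have "compact K" "K \<noteq> {}" "compact L" "L \<noteq> {}"
    using assms interior_empty by (auto simp: star_shaped_body_def)
  then show ?thesis
    using assms by (intro volume_le_of_weighted_sections_le) auto
qed

end
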